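(* Let $k$ be an algebraically closed field of characteristic $0$, let $Q$ be a finite quiver and let $\alpha$ be a dimension vector for $Q$. Then the semi-invariant polynomial functions for the action of $\mathrm{Gl}(\alpha)$ on $R(Q,\alpha)$ are spanned by determinantal semi-invariants; that is, every semi-invariant polynomial function on $R(Q,\alpha)$ is a $k$-linear combination of determinantal semi-invariants $P_{\phi,\alpha}$.
   Context: $Q$ is a quiver with finite vertex set $V$, finite arrow set $A$, and maps $i,t:A\to V$ giving the initial vertex $ia$ and terminal vertex $ta$ of an arrow $a$; oriented cycles are allowed. A representation $R$ assigns a $k$-vector space $R(v)$ to each vertex and a linear map $R(a):R(ia)\to R(ta)$ to each arrow. A dimension vector is a function $\alpha:V\to\mathbb{N}$ (with $0\in\mathbb{N}$). Representations of dimension vector $\alpha$ are parametrised by $R(Q,\alpha)=\prod_{a\in A} M_{\alpha(ia)\times\alpha(ta)}(k)$; a point $p=(p_a)_{a\in A}$ gives the representation $R_p$ with $R_p(v)=k^{\alpha(v)}$ (row vectors) and $R_p(a)$ right multiplication by the $\alpha(ia)\times\alpha(ta)$ matrix $p_a$. The group $\mathrm{Gl}(\alpha)=\prod_{v\in V}\mathrm{GL}_{\alpha(v)}(k)$ acts by $(g\cdot p)_a=g_{ia}\,p_a\,g_{ta}^{-1}$, with orbits the isomorphism classes. It acts on the coordinate ring $S(Q,\alpha)$ of $R(Q,\alpha)$ by $(g f)(p)=f(g^{-1}\cdot p)$. An element $f\in S(Q,\alpha)$ is semi-invariant of weight $\psi$, where $\psi$ is a character of the algebraic group $\mathrm{Gl}(\alpha)$,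 if $g(f)=\psi(g)f$ for all $g\in\mathrm{Gl}(\alpha)$; it is a semi-invariant if it is so for some $\psi$. A path of length $n>0$ from $v$ to $w$ is a monomial $a_1\cdots a_n$ in arrows with $ia_1=v$, $ta_j=ia_{j+1}$ for $0<j<n$, $ta_n=w$; there is also a trivial path $e_v$ of length $0$ from $v$ to $v$. The additive $k$-category $\mathrm{add}(Q)$ has an object $O(v)$ for each vertex $v$, with $\mathrm{Hom}(O(v),O(w))$ the $k$-vector space with basis the paths from $v$ to $w$ (including the trivial path if $v=w$), composition being concatenation of paths; its objects are the finite direct sums of the $O(v)$, and morphisms are matrices of such elements (rows indexed by source summands, columns by target summands) composed by matrix multiplication. Every representation $R$ extends uniquely to a $k$-linear additive covariant functor $R:\mathrm{add}(Q)\to\mathrm{Mod}(k)$. For a map $\phi:\bigoplus_{v}O(v)^{a(v)}\to\bigoplus_v O(v)^{b(v)}$ in $\mathrm{add}(Q)$ and $p\in R(Q,\alpha)$, $R_p(\phi)$ is a $\sum_v a(v)\alpha(v)$ by $\sum_v b(v)\alpha(v)$ matrix, obtained by replacing each path $a_1\cdots a_n$ by $p_{a_1}\cdots p_{a_n}$ and each $e_v$ by the identity matrix of size $\alpha(v)$. If $\sum_v a(v)\alpha(v)=\sum_v b(v)\alpha(v)$, the determinantal semi-invariant associated to $\phi$ is the polynomial function $P_{\phi,\alpha}(p)=\det R_p(\phi)$ on $R(Q,\alpha)$. *)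

theory Defs
  imports
    "Graph_Theory.Arc_Walk"
    "Jordan_Normal_Form.Determinant"
    "HOL-Algebra.Product_Groups"
    "HOL-Library.Poly_Mapping"
begin

text \<open>
  A finite quiver is a digraph satisfying \<^locale>\<open>fin_digraph\<close> (loops, multiple arcs and oriented
  cycles are allowed), with initial vertex \<open>tail Q a\<close> and terminal vertex \<open>head Q a\<close> of an arrow
  \<open>a\<close>. A dimension vector is a function \<open>\<alpha>\<close> from vertices to \<^typ>\<open>nat\<close>; its values off \<open>verts Q\<close>
  are never used. Families indexed by arrows or vertices are extensional functions, so that they
  are equal iff their components are, and matrices act on row vectors from the right.
\<close>

definition rep_space :: "('v, 'a) pre_digraph \<Rightarrow> ('v \<Rightarrow> nat) \<Rightarrow> ('a \<Rightarrow> 'k::field mat) set" where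
  "rep_space Q \<alpha> = (\<Pi>\<^sub>E a\<in>arcs Q. carrier_mat (\<alpha> (tail Q a)) (\<alpha> (head Q a)))"

definition gl_group :: "('v, 'a) pre_digraph \<Rightarrow> ('v \<Rightarrow> nat) \<Rightarrow> ('v \<Rightarrow> 'k::field mat) monoid" where
  "gl_group Q \<alpha> = product_group (verts Q) (\<lambda>v. units_of (ring_mat TYPE('k) (\<alpha> v) ()))"

definition gl_act ::
  "('v, 'a) pre_digraph \<Rightarrow> ('v \<Rightarrow> nat) \<Rightarrow> ('v \<Rightarrow> 'k::field mat) \<Rightarrow> ('a \<Rightarrow> 'k mat) \<Rightarrow> 'a \<Rightarrow> 'k mat" where
  "gl_act Q \<alpha> g p =
    (\<lambda>a\<in>arcs Q. g (tail Q a) * p a * (inv\<^bsub>gl_group Q \<alpha>\<^esub> g) (head Q a))"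

text \<open>The algebra of functions on \<open>X\<close>, represented extensionally, generated by the functions in
  \<open>C\<close>.\<close>

inductive_set generated_algebra :: "'x set \<Rightarrow> ('x \<Rightarrow> 'k::comm_ring_1) set \<Rightarrow> ('x \<Rightarrow> 'k) set"
  for X C where
  const: "(\<lambda>x\<in>X. c) \<in> generated_algebra X C"
| generator: "h \<in> C \<Longrightarrow> (\<lambda>x\<in>X. h x) \<in> generated_algebra X C"
| add: "f \<in> generated_algebra X C \<Longrightarrow> h \<in> generated_algebra X C \<Longrightarrow>
    (\<lambda>x\<in>X. f x + h x) \<in> generated_algebra X C"
| mult: "f \<in> generated_algebra X C \<Longrightarrow> h \<in> generated_algebra X C \<Longrightarrow>
    (\<lambda>x\<in>X. f x * h x) \<in> generated_algebra X C"

definition coordinate_ring ::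
  "('v, 'a) pre_digraph \<Rightarrow> ('v \<Rightarrow> nat) \<Rightarrow> (('a \<Rightarrow> 'k::field mat) \<Rightarrow> 'k) set" where
  "coordinate_ring Q \<alpha> = generated_algebra (rep_space Q \<alpha>)
    {(\<lambda>p. p a $$ (i, j)) | a i j. a \<in> arcs Q \<and> i < \<alpha> (tail Q a) \<and> j < \<alpha> (head Q a)}"

text \<open>The regular functions on the algebraic group: its coordinate ring is the polynomial ring in
  the matrix entries, localised at the determinants.\<close>

definition gl_regular_functions ::
  "('v, 'a) pre_digraph \<Rightarrow> ('v \<Rightarrow> nat) \<Rightarrow> (('v \<Rightarrow> 'k::field mat) \<Rightarrow> 'k) set" where
  "gl_regular_functions Q \<alpha> = generated_algebra (carrier (gl_group Q \<alpha>))
    ({(\<lambda>g. g v $$ (i, j)) | v i j. v \<in> verts Q \<and> i < \<alpha> v \<and> j < \<alpha> v} \<union>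
     {(\<lambda>g. inverse (det (g v))) | v. v \<in> verts Q})"

definition multiplicative_group :: "'k::field monoid" where
  "multiplicative_group = \<lparr>carrier = UNIV - {0}, monoid.mult = (*), one = 1\<rparr>"

definition gl_characters ::
  "('v, 'a) pre_digraph \<Rightarrow> ('v \<Rightarrow> nat) \<Rightarrow> (('v \<Rightarrow> 'k::field mat) \<Rightarrow> 'k) set" where
  "gl_characters Q \<alpha> = hom (gl_group Q \<alpha>) multiplicative_group \<inter> gl_regular_functions Q \<alpha>"

definition gl_act_fun ::
  "('v, 'a) pre_digraph \<Rightarrow> ('v \<Rightarrow> nat) \<Rightarrow> ('v \<Rightarrow> 'k::field mat) \<Rightarrow>
    (('a \<Rightarrow> 'k mat) \<Rightarrow> 'k) \<Rightarrow> ('a \<Rightarrow> 'k mat) \<Rightarrow> 'k" where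
  "gl_act_fun Q \<alpha> g f = (\<lambda>p\<in>rep_space Q \<alpha>. f (gl_act Q \<alpha> (inv\<^bsub>gl_group Q \<alpha>\<^esub> g) p))"

definition semi_invariant_of_weight ::
  "('v, 'a) pre_digraph \<Rightarrow> ('v \<Rightarrow> nat) \<Rightarrow> (('v \<Rightarrow> 'k::field mat) \<Rightarrow> 'k) \<Rightarrow>
    (('a \<Rightarrow> 'k mat) \<Rightarrow> 'k) \<Rightarrow> bool" where
  "semi_invariant_of_weight Q \<alpha> \<psi> f \<longleftrightarrow>
    f \<in> coordinate_ring Q \<alpha> \<and> \<psi> \<in> gl_characters Q \<alpha> \<and>
    (\<forall>g\<in>carrier (gl_group Q \<alpha>). gl_act_fun Q \<alpha> g f = (\<lambda>p\<in>rep_space Q \<alpha>. \<psi> g * f p))"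

definition semi_invariant ::
  "('v, 'a) pre_digraph \<Rightarrow> ('v \<Rightarrow> nat) \<Rightarrow> (('a \<Rightarrow> 'k::field mat) \<Rightarrow> 'k) \<Rightarrow> bool" where
  "semi_invariant Q \<alpha> f \<longleftrightarrow> (\<exists>\<psi>. semi_invariant_of_weight Q \<alpha> \<psi> f)"

text \<open>
  The morphisms of \<open>add(Q)\<close>. An object \<open>O(x\<^sub>0) \<oplus> \<dots> \<oplus> O(x\<^sub>m)\<close> is the list of vertices
  \<open>[x\<^sub>0, \<dots>, x\<^sub>m]\<close>, so the multiplicity \<open>a(v)\<close> of \<open>O(v)\<close> in it is \<open>count_list xs v\<close> and
  \<open>\<Sum>v. a(v) \<alpha>(v)\<close> is \<open>sum_list (map \<alpha> xs)\<close>. A path is the list of its arrows (the trivial path at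
  any vertex being \<open>[]\<close>; its endpoints are known from the Hom space it is considered in), and an
  element of \<open>Hom(O(v), O(w))\<close> is a finitely supported function on the paths from \<open>v\<close> to \<open>w\<close>.
\<close>

definition path_hom :: "('v, 'a) pre_digraph \<Rightarrow> 'v \<Rightarrow> 'v \<Rightarrow> ('a list \<Rightarrow>\<^sub>0 'k::field) set" where
  "path_hom Q v w = {c. \<forall>\<pi>\<in>Poly_Mapping.keys c. pre_digraph.awalk Q v \<pi> w}"

definition add_hom ::
  "('v, 'a) pre_digraph \<Rightarrow> 'v list \<Rightarrow> 'v list \<Rightarrow> ('a list \<Rightarrow>\<^sub>0 'k::field) mat set" where
  "add_hom Q xs ys = {\<phi> \<in> carrier_mat (length xs) (length ys).
    \<forall>i<length xs. \<forall>j<length ys. \<phi> $$ (i, j) \<in> path_hom Q (xs ! i) (ys ! j)}"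

fun path_mat ::
  "('v, 'a) pre_digraph \<Rightarrow> ('v \<Rightarrow> nat) \<Rightarrow> ('a \<Rightarrow> 'k::field mat) \<Rightarrow> 'v \<Rightarrow> 'a list \<Rightarrow> 'k mat" where
  "path_mat Q \<alpha> p v [] = 1\<^sub>m (\<alpha> v)"
| "path_mat Q \<alpha> p v (a # \<pi>) = p a * path_mat Q \<alpha> p (head Q a) \<pi>"

definition path_hom_mat ::
  "('v, 'a) pre_digraph \<Rightarrow> ('v \<Rightarrow> nat) \<Rightarrow> ('a \<Rightarrow> 'k::field mat) \<Rightarrow> 'v \<Rightarrow> 'v \<Rightarrow>
    ('a list \<Rightarrow>\<^sub>0 'k) \<Rightarrow> 'k mat" where
  "path_hom_mat Q \<alpha> p v w c = mat (\<alpha> v) (\<alpha> w) (\<lambda>(s, t).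
    \<Sum>\<pi>\<in>Poly_Mapping.keys c. Poly_Mapping.lookup c \<pi> * path_mat Q \<alpha> p v \<pi> $$ (s, t))"

text \<open>\<open>block_indices \<alpha> xs\<close> lists, in order, the row (or column) labels of a block matrix whose
  blocks have sizes \<open>\<alpha>(x\<^sub>0), \<alpha>(x\<^sub>1), \<dots>\<close>; the label \<open>(i, s)\<close> is position \<open>s\<close> in block \<open>i\<close>.\<close>

definition block_indices :: "('v \<Rightarrow> nat) \<Rightarrow> 'v list \<Rightarrow> (nat \<times> nat) list" where
  "block_indices \<alpha> xs = concat (map (\<lambda>i. map (Pair i) [0..<\<alpha> (xs ! i)]) [0..<length xs])"

lemma length_block_indices: "length (block_indices \<alpha> xs) = sum_list (map \<alpha> xs)"
proof -
  have "length (block_indices \<alpha> xs) = sum_list (map (\<lambda>i. \<alpha> (xs ! i)) [0..<length xs])"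
    by (simp add: block_indices_def length_concat comp_def)
  also have "map (\<lambda>i. \<alpha> (xs ! i)) [0..<length xs] = map \<alpha> xs"
    by (rule nth_equalityI) simp_all
  finally show ?thesis .
qed

definition rep_functor_mat ::
  "('v, 'a) pre_digraph \<Rightarrow> ('v \<Rightarrow> nat) \<Rightarrow> ('a \<Rightarrow> 'k::field mat) \<Rightarrow> 'v list \<Rightarrow> 'v list \<Rightarrow>
    ('a list \<Rightarrow>\<^sub>0 'k) mat \<Rightarrow> 'k mat" where
  "rep_functor_mat Q \<alpha> p xs ys \<phi> =
    mat (sum_list (map \<alpha> xs)) (sum_list (map \<alpha> ys)) (\<lambda>(r, c).
      let (i, s) = block_indices \<alpha> xs ! r; (j, t) = block_indices \<alpha> ys ! c
      in path_hom_mat Q \<alpha> p (xs ! i) (ys ! j) (\<phi> $$ (i, j)) $$ (s, t))"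

definition determinantal_function ::
  "('v, 'a) pre_digraph \<Rightarrow> ('v \<Rightarrow> nat) \<Rightarrow> 'v list \<Rightarrow> 'v list \<Rightarrow> ('a list \<Rightarrow>\<^sub>0 'k::field) mat \<Rightarrow>
    ('a \<Rightarrow> 'k mat) \<Rightarrow> 'k" where
  "determinantal_function Q \<alpha> xs ys \<phi> =
    (\<lambda>p\<in>rep_space Q \<alpha>. det (rep_functor_mat Q \<alpha> p xs ys \<phi>))"

definition determinantal_semi_invariants ::
  "('v, 'a) pre_digraph \<Rightarrow> ('v \<Rightarrow> nat) \<Rightarrow> (('a \<Rightarrow> 'k::field mat) \<Rightarrow> 'k) set" where
  "determinantal_semi_invariants Q \<alpha> =
    {determinantal_function Q \<alpha> xs ys \<phi> | xs ys \<phi>.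
      xs \<in> lists (verts Q) \<and> ys \<in> lists (verts Q) \<and> \<phi> \<in> add_hom Q xs ys \<and>
      sum_list (map \<alpha> xs) = sum_list (map \<alpha> ys)}"

end

theory Submission
  imports Defs "Jordan_Normal_Form.Char_Poly" "Jordan_Normal_Form.Column_Operations"
begin

text \<open>
  Add a loop \<open>x\<^sub>v\<close> at every vertex \<open>v\<close> and replace a semi-invariant \<open>f\<close> by
  \<open>F (q, x) = f (q\<^sub>a x\<^sub>t\<^sub>a\<inverse>) \<Prod>\<^sub>v det (x\<^sub>v)\<^sup>m\<close>, a polynomial for large \<open>m\<close>. Then \<open>F (g p h, g h)\<close> equals \<open>f p\<close>
  times a product of powers of the \<open>det (g\<^sub>v)\<close> and the \<open>det (h\<^sub>v)\<close>, where \<open>g\<close> and \<open>h\<close> are now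
  independent; here characters of the general linear group are powers of the determinant. Being
  polynomial, this identity holds for all matrices \<open>g\<close>, \<open>h\<close>. Apply Cayley's omega process in \<open>g\<close>
  and in \<open>h\<close> to both sides. The left side becomes a nonzero multiple of \<open>f p\<close>, as the constant is a sum
  of squares. On the right side every monomial becomes a signed sum over permutations of
  products of entries of the \<open>p\<^sub>a\<close> and of the identity matrices at the vertices, and this sum is the coefficient of
  \<open>z\<^sub>1 \<dots> z\<^sub>N\<close> in \<open>det R\<^sub>p(\<Sum>\<^sub>l z\<^sub>l \<phi>\<^sub>l)\<close>, where each \<open>\<phi>\<^sub>l\<close> has a single nonzero entry: an
  arrow or a trivial path. By inclusion-exclusion such a coefficient is a
  combination of the determinants at \<open>z \<in> {0, 1}\<^sup>N\<close>.
\<close>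

section \<open>A polarised omega process\<close>

text \<open>The conjugation action contains \<open>g\<close> together with its inverse, so it is
  only rational in \<open>g\<close>, whereas the omega process needs polynomials. The loops absorb
  the inverse: no factor of \<open>(g p h, g h)\<close> is inverted, and a loop is the trivial path
  in disguise because it carries an identity matrix. The weights dictate the shape of the maps. If
  \<open>g\<close> contributes the powers \<open>s v\<close> of the determinants, the source
  consists of \<open>s v\<close> copies of each \<open>O(v)\<close>; the exponent \<open>m\<close>
  that clears denominators gives the target \<open>m\<close> copies of each \<open>O(v)\<close>.
  Both products of powers then become determinants of block-diagonal matrices of one common size
  \<open>N\<close>, and in each of the two omega processes the permutations that matter are those
  preserving the blocks. Characteristic 0 makes values determine polynomials, keeps distinct powers
  of 2 apart, and makes the positive integers produced by the two omega processes
  invertible.\<close>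

lemma alternating_sum_supersets:
  assumes "finite A" "R \<subseteq> A"
  shows "(\<Sum>S\<in>Pow A. (-1) ^ (card A - card S) * (if R \<subseteq> S then 1 else 0)) =
    (if R = A then 1 else (0::'k::comm_ring_1))"
proof -
  \<comment> \<open>The right side is the product over \<open>A\<close> of the indicators of
    \<open>x \<in> R\<close>. Writing each as 1 minus its complement and expanding gives a sum over
    subsets \<open>X\<close>, and \<open>X\<close> is the complement of the \<open>S\<close> in the
    claim.\<close>
  have "(if R = A then 1 else 0) = (\<Prod>x\<in>A. 1 - (if x \<in> R then 0 else (1::'k)))"
  proof (cases "R = A")
    case False
    then obtain x where "x \<in> A" "x \<notin> R" using assms by blast
    then have "(\<Prod>x\<in>A. 1 - (if x \<in> R then 0 else (1::'k))) = 0"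
      using assms by (intro prod_zero) auto
    with False show ?thesis by simp
  qed simp
  also have "\<dots> = (\<Sum>X\<in>Pow A. (-1) ^ card X * (\<Prod>x\<in>X. if x \<in> R then 0 else 1) * (\<Prod>x\<in>A - X. 1))"
    by (rule prod_diff_conv_sum) fact
  also have "\<dots> = (\<Sum>X\<in>Pow A. (-1) ^ card X * (if R \<inter> X = {} then 1 else 0))"
  proof (rule sum.cong)
    fix X assume "X \<in> Pow A"
    then have "finite X" using assms finite_subset by auto
    then have "(\<Prod>x\<in>X. if x \<in> R then 0 else (1::'k)) = (if R \<inter> X = {} then 1 else 0)"
      by (auto intro!: prod_zero prod.neutral)
    then show "(-1) ^ card X * (\<Prod>x\<in>X. if x \<in> R then 0 else 1) * (\<Prod>x\<in>A - X. 1) =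
        (-1) ^ card X * (if R \<inter> X = {} then 1 else (0::'k))" by simp
  qed simp
  also have "\<dots> = (\<Sum>S\<in>Pow A. (-1) ^ (card A - card S) * (if R \<subseteq> S then 1 else 0))"
  proof (rule sum.reindex_bij_witness[where i = "\<lambda>S. A - S" and j = "\<lambda>S. A - S"])
    fix X assume "X \<in> Pow A"
    then have X: "X \<subseteq> A" by simp
    then have "card A - card (A - X) = card X"
      using assms by (simp add: card_Diff_subset card_mono finite_subset)
    moreover have "R \<subseteq> A - X \<longleftrightarrow> R \<inter> X = {}" using assms by auto
    ultimately show "(-1) ^ (card A - card (A - X)) * (if R \<subseteq> A - X then 1 else 0) =
      (-1) ^ card X * (if R \<inter> X = {} then 1 else (0::'k))" by simp
  qed (use assms in auto)
  finally show ?thesis ..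
qed

text \<open>A surjective self-map of a finite set is a permutation. Only the conventions off
  \<open>A\<close> have to be translated: undefined for extensional functions, the identity for
  permutations.\<close>

lemma surj_PiE_bij_permutes:
  assumes "finite A"
  shows "bij_betw (\<lambda>\<theta>. restrict \<theta> A) {\<theta>. \<theta> permutes A} {\<zeta> \<in> A \<rightarrow>\<^sub>E A. \<zeta> ` A = A}"
proof (rule bij_betw_byWitness[where f' = "\<lambda>\<zeta> x. if x \<in> A then \<zeta> x else x"])
  show "\<forall>\<theta>\<in>{\<theta>. \<theta> permutes A}. (\<lambda>x. if x \<in> A then restrict \<theta> A x else x) = \<theta>"
    by (auto simp: permutes_def fun_eq_iff)
  show "\<forall>\<zeta>\<in>{\<zeta> \<in> A \<rightarrow>\<^sub>E A. \<zeta> ` A = A}. restrict (\<lambda>x. if x \<in> A then \<zeta> x else x) A = \<zeta>"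
    by (auto simp: fun_eq_iff PiE_def extensional_def)
  show "(\<lambda>\<theta>. restrict \<theta> A) ` {\<theta>. \<theta> permutes A} \<subseteq> {\<zeta> \<in> A \<rightarrow>\<^sub>E A. \<zeta> ` A = A}"
    by (auto simp: permutes_in_image permutes_image restrict_PiE_iff)
  show "(\<lambda>\<zeta> x. if x \<in> A then \<zeta> x else x) ` {\<zeta> \<in> A \<rightarrow>\<^sub>E A. \<zeta> ` A = A} \<subseteq> {\<theta>. \<theta> permutes A}"
  proof safe
    fix \<zeta> assume z: "\<zeta> \<in> A \<rightarrow>\<^sub>E A" "\<zeta> ` A = A"
    have "bij_betw \<zeta> A A"
      using z assms by (auto simp: bij_betw_def intro!: eq_card_imp_inj_on)
    then have "bij_betw (\<lambda>x. if x \<in> A then \<zeta> x else x) A A"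
      by (subst bij_betw_cong[where g = \<zeta>]) auto
    then show "(\<lambda>x. if x \<in> A then \<zeta> x else x) permutes A"
      by (rule bij_imp_permutes) simp
  qed
qed

text \<open>Expanding the product gives one term for each map \<open>\<zeta>\<close> from
  \<open>A\<close> to \<open>S\<close>; the alternating sum over \<open>S\<close> keeps exactly the
  surjective ones. The result is the permanent of \<open>\<phi>\<close>, that is, the multilinear
  coefficient of the product with \<open>S\<close> replaced by formal weights.\<close>

lemma polarization_permanent:
  fixes \<phi> :: "'l \<Rightarrow> 'l \<Rightarrow> 'k::comm_ring_1"
  assumes "finite A"
  shows "(\<Sum>S\<in>Pow A. (-1) ^ (card A - card S) * (\<Prod>l\<in>A. \<Sum>y\<in>S. \<phi> l y)) =
    (\<Sum>\<theta> | \<theta> permutes A. \<Prod>l\<in>A. \<phi> l (\<theta> l))"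
proof -
  have 1: "(\<Prod>l\<in>A. \<Sum>y\<in>S. \<phi> l y) =
      (\<Sum>\<zeta>\<in>A \<rightarrow>\<^sub>E A. (if \<zeta> ` A \<subseteq> S then 1 else 0) * (\<Prod>l\<in>A. \<phi> l (\<zeta> l)))" if "S \<subseteq> A" for S
  proof -
    have "(\<Prod>l\<in>A. \<Sum>y\<in>S. \<phi> l y) = (\<Sum>\<zeta>\<in>A \<rightarrow>\<^sub>E S. \<Prod>l\<in>A. \<phi> l (\<zeta> l))"
      using assms that finite_subset by (intro prod_sum_PiE) auto
    also have "\<dots> = (\<Sum>\<zeta>\<in>A \<rightarrow>\<^sub>E A. (if \<zeta> ` A \<subseteq> S then 1 else 0) * (\<Prod>l\<in>A. \<phi> l (\<zeta> l)))"
      using that assms by (intro sum.mono_neutral_cong_left) (auto simp: PiE_iff finite_PiE)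
    finally show ?thesis .
  qed
  have "(\<Sum>S\<in>Pow A. (-1) ^ (card A - card S) * (\<Prod>l\<in>A. \<Sum>y\<in>S. \<phi> l y)) =
     (\<Sum>S\<in>Pow A. \<Sum>\<zeta>\<in>A \<rightarrow>\<^sub>E A. (-1) ^ (card A - card S) * (if \<zeta> ` A \<subseteq> S then 1 else 0) *
        (\<Prod>l\<in>A. \<phi> l (\<zeta> l)))"
    by (rule sum.cong) (auto simp: 1 sum_distrib_left mult.assoc)
  also have "\<dots> = (\<Sum>\<zeta>\<in>A \<rightarrow>\<^sub>E A. (\<Sum>S\<in>Pow A. (-1) ^ (card A - card S) * (if \<zeta> ` A \<subseteq> S then 1 else 0)) *
        (\<Prod>l\<in>A. \<phi> l (\<zeta> l)))"
    by (subst sum.swap) (simp only: sum_distrib_right)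
  also have "\<dots> = (\<Sum>\<zeta>\<in>A \<rightarrow>\<^sub>E A. (if \<zeta> ` A = A then 1 else 0) * (\<Prod>l\<in>A. \<phi> l (\<zeta> l)))"
    by (intro sum.cong refl arg_cong2[where f = times] alternating_sum_supersets) (use assms in \<open>auto simp: PiE_iff\<close>)
  also have "\<dots> = (\<Sum>\<zeta>\<in>{\<zeta> \<in> A \<rightarrow>\<^sub>E A. \<zeta> ` A = A}. \<Prod>l\<in>A. \<phi> l (\<zeta> l))"
    by (rule sum.mono_neutral_cong_right) (use assms in \<open>auto simp: finite_PiE\<close>)
  also have "\<dots> = (\<Sum>\<theta> | \<theta> permutes A. \<Prod>l\<in>A. \<phi> l (restrict \<theta> A l))"
    by (rule sum.reindex_bij_betw[OF surj_PiE_bij_permutes[OF assms], symmetric])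
  finally show ?thesis by simp
qed

text \<open>Pairs with equal \<open>w\<close> are pairs inside one fibre, and each fibre contributes
  a product of two equal sums. This is the source of positivity in
  \<open>omega_det_pos\<close>.\<close>

lemma sum_fibres_square:
  fixes s :: "'j \<Rightarrow> 'k::comm_ring_1"
  assumes "finite J"
  shows "(\<Sum>i\<in>J. \<Sum>j\<in>J. if w i = w j then s i * s j else 0) =
    (\<Sum>\<zeta>\<in>w ` J. (\<Sum>j | j \<in> J \<and> w j = \<zeta>. s j)\<^sup>2)"
proof -
  have "(\<Sum>\<zeta>\<in>w ` J. (\<Sum>j | j \<in> J \<and> w j = \<zeta>. s j)\<^sup>2) =
      (\<Sum>\<zeta>\<in>w ` J. \<Sum>i | i \<in> J \<and> w i = \<zeta>. \<Sum>j | j \<in> J \<and> w j = w i. s i * s j)"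
    by (auto simp: power2_eq_square sum_product intro!: sum.cong)
  also have "\<dots> = (\<Sum>i\<in>J. \<Sum>j | j \<in> J \<and> w j = w i. s i * s j)"
    using assms by (subst sum.group) auto
  also have "\<dots> = (\<Sum>i\<in>J. \<Sum>j\<in>J. if w i = w j then s i * s j else 0)"
    using assms by (auto simp: sum.If_cases Int_def intro!: sum.cong)
  finally show ?thesis ..
qed

text \<open>The Young subgroup of the partition into blocks: a product of symmetric groups, one for
  each block. It indexes the nonzero terms in the Leibniz formula of a block-diagonal
  matrix.\<close>

definition block_perms :: "(nat \<Rightarrow> 'b) \<Rightarrow> nat \<Rightarrow> (nat \<Rightarrow> nat) set" where
  "block_perms bl N = {\<pi>. \<pi> permutes {0..<N} \<and> (\<forall>r<N. bl (\<pi> r) = bl r)}"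

definition unit_sum :: "(nat \<Rightarrow> 'v) \<Rightarrow> (nat \<Rightarrow> nat) \<Rightarrow> (nat \<Rightarrow> nat) \<Rightarrow> nat set \<Rightarrow> 'v \<Rightarrow> nat \<Rightarrow> nat \<Rightarrow> 'k::comm_ring_1" where
  "unit_sum vt pos \<pi> S v i j = (\<Sum>y\<in>S. if vt y = v \<and> pos y = i \<and> pos (\<pi> y) = j then 1 else 0)"

text \<open>Blocks are told apart by \<open>bl\<close>, while \<open>vt\<close> names the matrix
  that a block carries. Several blocks may share a vertex, and this repetition produces powers of
  \<open>det (\<gamma> v)\<close>.\<close>

definition block_diag :: "(nat \<Rightarrow> 'b) \<Rightarrow> (nat \<Rightarrow> 'v) \<Rightarrow> (nat \<Rightarrow> nat) \<Rightarrow> nat \<Rightarrow> ('v \<Rightarrow> nat \<Rightarrow> nat \<Rightarrow> 'k::comm_ring_1) \<Rightarrow> 'k mat" where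
  "block_diag bl vt pos N \<gamma> = mat N N (\<lambda>(r, c). if bl r = bl c then \<gamma> (vt r) (pos r) (pos c) else 0)"

text \<open>For \<open>P\<close> homogeneous of degree \<open>N\<close>, the inner sum is the derivative \<open>\<partial>\<^sub>x\<^sub>1 \<dots> \<partial>\<^sub>x\<^sub>N P\<close> along the
  elementary matrices \<open>x\<^sub>y\<close> with entry 1 at position \<open>(pos y, pos (\<pi> y))\<close>, so this is Cayley's
  \<open>\<Omega>\<close> process; writing it through evaluations avoids formal polynomials in matrix entries.\<close>

definition omega_process :: "(nat \<Rightarrow> 'b) \<Rightarrow> (nat \<Rightarrow> 'v) \<Rightarrow> (nat \<Rightarrow> nat) \<Rightarrow> nat \<Rightarrow>
    (('v \<Rightarrow> nat \<Rightarrow> nat \<Rightarrow> 'k::comm_ring_1) \<Rightarrow> 'k) \<Rightarrow> 'k" where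
  "omega_process bl vt pos N P = (\<Sum>\<pi>\<in>block_perms bl N. of_int (sign \<pi>) *
    (\<Sum>S\<in>Pow {0..<N}. (-1) ^ (N - card S) * P (unit_sum vt pos \<pi> S)))"

lemma finite_block_perms [simp]: "finite (block_perms bl N)"
  by (rule finite_subset[OF _ finite_permutations[of "{0..<N}"]]) (auto simp: block_perms_def)

lemma block_perms_less: "\<pi> \<in> block_perms bl N \<Longrightarrow> r < N \<Longrightarrow> \<pi> r < N"
  using permutes_in_image[of \<pi> "{0..<N}" r] by (auto simp: block_perms_def)

lemma det_block_diag:
  "det (block_diag bl vt pos N \<gamma>) =
    (\<Sum>\<rho>\<in>block_perms bl N. of_int (sign \<rho>) * (\<Prod>r=0..<N. \<gamma> (vt r) (pos r) (pos (\<rho> r))))"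
proof -
  have "det (block_diag bl vt pos N \<gamma>) = (\<Sum>\<rho> | \<rho> permutes {0..<N}. of_int (sign \<rho>) *
      (\<Prod>r=0..<N. block_diag bl vt pos N \<gamma> $$ (r, \<rho> r)))"
    by (rule det_def') (simp add: block_diag_def)
  also have "\<dots> = (\<Sum>\<rho>\<in>block_perms bl N. of_int (sign \<rho>) * (\<Prod>r=0..<N. \<gamma> (vt r) (pos r) (pos (\<rho> r))))"
  proof (rule sum.mono_neutral_cong_right)
    show "\<forall>\<rho>\<in>{\<rho>. \<rho> permutes {0..<N}} - block_perms bl N. of_int (sign \<rho>) *
        (\<Prod>r=0..<N. block_diag bl vt pos N \<gamma> $$ (r, \<rho> r)) = 0"
    proof
      fix \<rho> assume r: "\<rho> \<in> {\<rho>. \<rho> permutes {0..<N}} - block_perms bl N"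
      then obtain r where "r < N" "bl (\<rho> r) \<noteq> bl r" by (auto simp: block_perms_def)
      moreover from this r have "\<rho> r < N" using permutes_in_image[of \<rho> "{0..<N}" r] by auto
      ultimately have "(\<Prod>r=0..<N. block_diag bl vt pos N \<gamma> $$ (r, \<rho> r)) = 0"
        by (intro prod_zero) (auto simp: block_diag_def intro!: bexI[of _ r])
      then show "of_int (sign \<rho>) * (\<Prod>r=0..<N. block_diag bl vt pos N \<gamma> $$ (r, \<rho> r)) = 0" by simp
    qed
  next
    fix \<rho> assume r: "\<rho> \<in> block_perms bl N"
    then have "block_diag bl vt pos N \<gamma> $$ (r, \<rho> r) = \<gamma> (vt r) (pos r) (pos (\<rho> r))" if "r < N" for r
      using that block_perms_less[OF r that] by (simp add: block_diag_def) (simp add: block_perms_def)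
    then show "of_int (sign \<rho>) * (\<Prod>r=0..<N. block_diag bl vt pos N \<gamma> $$ (r, \<rho> r)) =
        of_int (sign \<rho>) * (\<Prod>r=0..<N. \<gamma> (vt r) (pos r) (pos (\<rho> r)))" by simp
  qed (auto simp: finite_permutations, simp add: block_perms_def)
  finally show ?thesis .
qed

text \<open>As in Fischer's inner product, \<open>N! C\<close> is a sum of squares of signed counts of
  permutations; the identity permutation contributes a positive one.\<close>

lemma omega_det_pos:
  assumes inj: "\<And>r r'. r < N \<Longrightarrow> r' < N \<Longrightarrow> bl r = bl r' \<Longrightarrow> pos r = pos r' \<Longrightarrow> r = r'"
  shows "\<exists>C>0. omega_process bl vt pos N (\<lambda>\<gamma>. det (block_diag bl vt pos N \<gamma>)) = (of_int C :: 'k::comm_ring_1)"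
proof -
  define X where "X = block_perms bl N"
  define \<zeta> where "\<zeta> \<pi> y = (vt y, pos y, pos (\<pi> y))" for \<pi> y
  define P where "P = {\<theta>. \<theta> permutes {0..<N}}"
  have finP: "finite P" by (auto simp: P_def finite_permutations)
  have finX: "finite X" by (simp add: X_def)
  define C :: int where "C = (\<Sum>\<pi>\<in>X. \<Sum>\<rho>\<in>X. \<Sum>\<theta>\<in>P. if \<forall>r<N. \<zeta> \<pi> (\<theta> r) = \<zeta> \<rho> r then sign \<pi> * sign \<rho> else 0)"
  have "omega_process bl vt pos N (\<lambda>\<gamma>. det (block_diag bl vt pos N \<gamma>)) = (of_int C :: 'k)"
  proof -
    have prod_if: "(\<Prod>r=0..<N. if Q r then 1 else 0) = (if \<forall>r<N. Q r then 1 else (0::'k))" for Q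
      by (auto intro!: prod_zero prod.neutral)
    have "omega_process bl vt pos N (\<lambda>\<gamma>. det (block_diag bl vt pos N \<gamma>)) =
       (\<Sum>\<pi>\<in>X. of_int (sign \<pi>) * (\<Sum>S\<in>Pow {0..<N}. (-1) ^ (N - card S) *
          (\<Sum>\<rho>\<in>X. of_int (sign \<rho>) * (\<Prod>r=0..<N. \<Sum>y\<in>S. if \<zeta> \<pi> y = \<zeta> \<rho> r then 1 else (0::'k)))))"
      by (simp add: omega_process_def det_block_diag unit_sum_def X_def \<zeta>_def)
    also have "\<dots> = (\<Sum>\<pi>\<in>X. of_int (sign \<pi>) * (\<Sum>\<rho>\<in>X. of_int (sign \<rho>) * (\<Sum>S\<in>Pow {0..<N}. (-1) ^ (N - card S) *
           (\<Prod>r=0..<N. \<Sum>y\<in>S. if \<zeta> \<pi> y = \<zeta> \<rho> r then 1 else (0::'k)))))"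
      by (subst sum_distrib_left, subst sum.swap) (simp add: sum_distrib_left mult_ac)
    also have "\<dots> = (\<Sum>\<pi>\<in>X. of_int (sign \<pi>) * (\<Sum>\<rho>\<in>X. of_int (sign \<rho>) *
        (\<Sum>\<theta>\<in>P. if \<forall>r<N. \<zeta> \<pi> (\<theta> r) = \<zeta> \<rho> r then 1 else 0)))"
      using polarization_permanent[of "{0..<N}" "\<lambda>r y. if \<zeta> \<pi> y = \<zeta> \<rho> r then 1 else (0::'k)" for \<pi> \<rho>]
      by (simp add: P_def prod_if)
    also have "\<dots> = of_int C"
      unfolding C_def of_int_sum sum_distrib_left
      by (intro sum.cong refl) auto
    finally show ?thesis .
  qed
  moreover have "C > 0"
  proof -
    define w where "w = (\<lambda>(\<pi>, \<alpha>). map (\<lambda>r. \<zeta> \<pi> (\<alpha> r)) [0..<N])"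
    define s where "s = (\<lambda>(\<pi>, \<alpha>::nat\<Rightarrow>nat). sign (\<pi>::nat\<Rightarrow>nat))"
    \<comment> \<open>A dummy summation over \<open>\<beta>\<close> accounts for the factor
      \<open>N!\<close>. Substituting for \<open>\<theta>\<close> the composite of
      \<open>\<alpha>\<close> with the inverse of \<open>\<beta>\<close> makes the condition
      symmetric in the pairs \<open>(\<pi>, \<alpha>)\<close> and \<open>(\<rho>, \<beta>)\<close>,
      as a sum of squares requires.\<close>
    have "int (fact N) * C = (\<Sum>\<pi>\<in>X. \<Sum>\<rho>\<in>X. \<Sum>\<beta>\<in>P. \<Sum>\<theta>\<in>P. if \<forall>r<N. \<zeta> \<pi> (\<theta> r) = \<zeta> \<rho> r then sign \<pi> * sign \<rho> else 0)"
      unfolding C_def sum_distrib_left using card_permutations[of "{0..<N}" N] by (simp add: P_def sum_distrib_left)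
    also have "\<dots> = (\<Sum>\<pi>\<in>X. \<Sum>\<rho>\<in>X. \<Sum>\<beta>\<in>P. \<Sum>\<alpha>\<in>P. if w (\<pi>, \<alpha>) = w (\<rho>, \<beta>) then s (\<pi>, \<alpha>) * s (\<rho>, \<beta>) else 0)"
    proof (rule sum.cong[OF refl], rule sum.cong[OF refl], rule sum.cong[OF refl])
      fix \<pi> \<rho> \<beta> assume "\<beta> \<in> P"
      then have b: "\<beta> permutes {0..<N}" by (simp add: P_def)
      have "(\<forall>r<N. \<zeta> \<pi> ((\<alpha> \<circ> Hilbert_Choice.inv \<beta>) r) = \<zeta> \<rho> r) \<longleftrightarrow> (\<forall>r<N. \<zeta> \<pi> (\<alpha> r) = \<zeta> \<rho> (\<beta> r))" for \<alpha>
        using permutes_in_image[OF b] permutes_in_image[OF permutes_inv[OF b]] permutes_inverses[OF b]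
        by (metis atLeastLessThan_iff comp_apply le0)
      then show "(\<Sum>\<theta>\<in>P. if \<forall>r<N. \<zeta> \<pi> (\<theta> r) = \<zeta> \<rho> r then sign \<pi> * sign \<rho> else 0) =
        (\<Sum>\<alpha>\<in>P. if w (\<pi>, \<alpha>) = w (\<rho>, \<beta>) then s (\<pi>, \<alpha>) * s (\<rho>, \<beta>) else 0)"
        using sum_permutations_compose_right[OF permutes_inv[OF b], of "\<lambda>\<theta>. if \<forall>r<N. \<zeta> \<pi> (\<theta> r) = \<zeta> \<rho> r then sign \<pi> * sign \<rho> else 0"]
        by (simp add: P_def w_def s_def Ball_def cong: if_cong)
    qed
    also have "\<dots> = (\<Sum>(\<pi>, \<alpha>)\<in>X \<times> P. \<Sum>(\<rho>, \<beta>)\<in>X \<times> P. if w (\<pi>, \<alpha>) = w (\<rho>, \<beta>) then s (\<pi>, \<alpha>) * s (\<rho>, \<beta>) else 0)"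
      unfolding sum.cartesian_product[symmetric]
      by (intro sum.cong[OF refl]) (rule trans[OF sum.cong[OF refl sum.swap] sum.swap])
    also have "\<dots> = (\<Sum>i\<in>X \<times> P. \<Sum>j\<in>X \<times> P. if w i = w j then s i * s j else 0)"
      unfolding case_prod_unfold prod.collapse ..
    also have "\<dots> = (\<Sum>z\<in>w ` (X \<times> P). (\<Sum>j | j \<in> X \<times> P \<and> w j = z. s j)\<^sup>2)"
      by (rule sum_fibres_square) (simp add: finX finP)
    also have "\<dots> > 0"
    proof (rule sum_pos2)
      have idX: "id \<in> X" by (simp add: X_def block_perms_def permutes_id)
      have idP: "id \<in> P" by (simp add: P_def permutes_id)
      show "w (id, id) \<in> w ` (X \<times> P)" using idX idP by blast
      \<comment> \<open>No cancellation occurs in the fibre of \<open>(id, id)\<close>: there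
        \<open>\<pi>\<close> fixes all positions and preserves all blocks, hence is the identity, so
        every sign is 1.\<close>
      have "s j = 1" if j: "j \<in> X \<times> P" "w j = w (id, id)" for j
      proof -
        obtain \<pi> \<alpha> where ja: "j = (\<pi>, \<alpha>)" by (cases j)
        have a: "\<alpha> permutes {0..<N}" and p: "\<pi> \<in> block_perms bl N" using j ja by (auto simp: P_def X_def)
        have "\<pi> r = r" if "r < N" for r
        proof -
          have "r \<in> \<alpha> ` {0..<N}" using that permutes_image[OF a] by simp
          then obtain r' where r': "r = \<alpha> r'" "r' < N" by auto
          have "\<zeta> \<pi> (\<alpha> r') = \<zeta> id r'" using j(2) r'(2) by (simp add: w_def ja)
          then have "pos (\<pi> r) = pos r" by (simp add: \<zeta>_def r')
          moreover have "bl (\<pi> r) = bl r" using p that by (simp add: block_perms_def)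
          ultimately show ?thesis using inj[of "\<pi> r" r] block_perms_less[OF p that] that by simp
        qed
        moreover have "\<pi> r = r" if "\<not> r < N" for r
          using p that permutes_not_in[of \<pi> "{0..<N}" r] by (simp add: block_perms_def)
        ultimately have "\<pi> = id" by (metis eq_id_iff)
        then show ?thesis by (simp add: s_def ja)
      qed
      then have "(\<Sum>j | j \<in> X \<times> P \<and> w j = w (id, id). s j) = int (card {j. j \<in> X \<times> P \<and> w j = w (id, id)})"
        by simp
      moreover have "card {j. j \<in> X \<times> P \<and> w j = w (id, id)} > 0"
      proof -
        have "finite {j. j \<in> X \<times> P \<and> w j = w (id, id)}" using finX finP by simp
        moreover have "(id, id) \<in> {j. j \<in> X \<times> P \<and> w j = w (id, id)}" using idX idP by simp
        ultimately show ?thesis using card_gt_0_iff by blast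
      qed
      ultimately show "(\<Sum>j | j \<in> X \<times> P \<and> w j = w (id, id). s j)\<^sup>2 > 0" by simp
    qed (use finX finP in auto)
    finally have "int (fact N) * C > 0" .
    moreover have "int (fact N) > 0" by simp
    ultimately show ?thesis using zero_less_mult_pos by blast
  qed
  ultimately show ?thesis by blast
qed

text \<open>Each factor \<open>B l\<close> is bilinear in \<open>(\<gamma>, \<eta>)\<close>.
  Polarising in one argument and then in the other assigns to factor \<open>l\<close> its own
  elementary matrices, numbered \<open>\<theta> l\<close> and \<open>\<theta>' l\<close>. The signs
  come from the outer sums of the omega processes and are untouched by this.\<close>

lemma double_omega_prod:
  fixes B :: "nat \<Rightarrow> ('v \<Rightarrow> nat \<Rightarrow> nat \<Rightarrow> 'k::comm_ring_1) \<Rightarrow> ('v \<Rightarrow> nat \<Rightarrow> nat \<Rightarrow> 'k) \<Rightarrow> 'k"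
  assumes B: "\<And>l \<pi> \<pi>' S S'. l < N \<Longrightarrow> \<pi> \<in> block_perms bl N \<Longrightarrow> \<pi>' \<in> block_perms bl' N \<Longrightarrow>
      S \<subseteq> {0..<N} \<Longrightarrow> S' \<subseteq> {0..<N} \<Longrightarrow>
      B l (unit_sum vt pos \<pi> S) (unit_sum vt' pos' \<pi>' S') = (\<Sum>y\<in>S. \<Sum>y'\<in>S'. A l y y' (\<pi> y) (\<pi>' y'))"
  shows "omega_process bl vt pos N (\<lambda>\<gamma>. omega_process bl' vt' pos' N (\<lambda>\<eta>. \<Prod>l=0..<N. B l \<gamma> \<eta>)) =
    (\<Sum>\<theta> | \<theta> permutes {0..<N}. \<Sum>\<theta>' | \<theta>' permutes {0..<N}.
      \<Sum>\<pi>\<in>block_perms bl N. \<Sum>\<pi>'\<in>block_perms bl' N. of_int (sign \<pi>) * of_int (sign \<pi>') *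
        (\<Prod>l=0..<N. A l (\<theta> l) (\<theta>' l) (\<pi> (\<theta> l)) (\<pi>' (\<theta>' l))))"
    (is "?L = ?R")
proof -
  define e :: "nat set \<Rightarrow> 'k" where "e S = (-1) ^ (N - card S)" for S
  have pol: "(\<Sum>S\<in>Pow {0..<N}. e S * (\<Prod>l=0..<N. \<Sum>y\<in>S. \<phi> l y)) =
    (\<Sum>\<theta> | \<theta> permutes {0..<N}. \<Prod>l=0..<N. \<phi> l (\<theta> l))" for \<phi>
    using polarization_permanent[of "{0..<N}" \<phi>] by (simp add: e_def)
  have pair: "(\<Sum>S\<in>Pow {0..<N}. e S * (\<Sum>S'\<in>Pow {0..<N}. e S' * (\<Prod>l=0..<N. \<Sum>y\<in>S. \<Sum>y'\<in>S'. \<phi> l y y'))) =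
    (\<Sum>\<theta> | \<theta> permutes {0..<N}. \<Sum>\<theta>' | \<theta>' permutes {0..<N}. \<Prod>l=0..<N. \<phi> l (\<theta> l) (\<theta>' l))" for \<phi>
  proof -
    have "(\<Sum>S\<in>Pow {0..<N}. e S * (\<Sum>S'\<in>Pow {0..<N}. e S' * (\<Prod>l=0..<N. \<Sum>y\<in>S. \<Sum>y'\<in>S'. \<phi> l y y'))) =
       (\<Sum>S\<in>Pow {0..<N}. e S * (\<Sum>\<theta>' | \<theta>' permutes {0..<N}. \<Prod>l=0..<N. \<Sum>y\<in>S. \<phi> l y (\<theta>' l)))"
    proof (intro sum.cong refl arg_cong2[where f = times])
      fix S
      have "(\<Prod>l=0..<N. \<Sum>y\<in>S. \<Sum>y'\<in>S'. \<phi> l y y') = (\<Prod>l=0..<N. \<Sum>y'\<in>S'. \<Sum>y\<in>S. \<phi> l y y')" for S'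
        by (intro prod.cong refl sum.swap)
      then show "(\<Sum>S'\<in>Pow {0..<N}. e S' * (\<Prod>l=0..<N. \<Sum>y\<in>S. \<Sum>y'\<in>S'. \<phi> l y y')) =
        (\<Sum>\<theta>' | \<theta>' permutes {0..<N}. \<Prod>l=0..<N. \<Sum>y\<in>S. \<phi> l y (\<theta>' l))"
        by (simp add: pol)
    qed
    also have "\<dots> = (\<Sum>\<theta>' | \<theta>' permutes {0..<N}. \<Sum>S\<in>Pow {0..<N}. e S * (\<Prod>l=0..<N. \<Sum>y\<in>S. \<phi> l y (\<theta>' l)))"
      by (subst sum.swap) (simp add: sum_distrib_left)
    also have "\<dots> = (\<Sum>\<theta>' | \<theta>' permutes {0..<N}. \<Sum>\<theta> | \<theta> permutes {0..<N}. \<Prod>l=0..<N. \<phi> l (\<theta> l) (\<theta>' l))"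
      by (simp add: pol)
    finally show ?thesis by (subst sum.swap)
  qed
  have "?L = (\<Sum>\<pi>\<in>block_perms bl N. of_int (sign \<pi>) * (\<Sum>S\<in>Pow {0..<N}. e S *
      (\<Sum>\<pi>'\<in>block_perms bl' N. of_int (sign \<pi>') * (\<Sum>S'\<in>Pow {0..<N}. e S' *
        (\<Prod>l=0..<N. \<Sum>y\<in>S. \<Sum>y'\<in>S'. A l y y' (\<pi> y) (\<pi>' y'))))))"
    unfolding omega_process_def e_def
    by (intro sum.cong refl arg_cong2[where f = times] prod.cong B) auto
  also have "\<dots> = (\<Sum>\<pi>\<in>block_perms bl N. \<Sum>\<pi>'\<in>block_perms bl' N. of_int (sign \<pi>) * of_int (sign \<pi>') *
     (\<Sum>S\<in>Pow {0..<N}. e S * (\<Sum>S'\<in>Pow {0..<N}. e S' *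
        (\<Prod>l=0..<N. \<Sum>y\<in>S. \<Sum>y'\<in>S'. A l y y' (\<pi> y) (\<pi>' y')))))"
    by (subst sum_distrib_left, subst (2) sum_distrib_left, subst (2) sum.swap) (simp add: sum_distrib_left mult_ac)
  also have "\<dots> = (\<Sum>\<pi>\<in>block_perms bl N. \<Sum>\<pi>'\<in>block_perms bl' N. 
      \<Sum>\<theta> | \<theta> permutes {0..<N}. \<Sum>\<theta>' | \<theta>' permutes {0..<N}. of_int (sign \<pi>) * of_int (sign \<pi>') *
        (\<Prod>l=0..<N. A l (\<theta> l) (\<theta>' l) (\<pi> (\<theta> l)) (\<pi>' (\<theta>' l))))"
    by (simp only: pair) (simp only: sum_distrib_left)
  also have "\<dots> = ?R"
    by (rule trans[OF sum.cong[OF refl sum.swap]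
          trans[OF sum.swap sum.cong[OF refl trans[OF sum.cong[OF refl sum.swap] sum.swap]]]])
  finally show ?thesis .
qed

text \<open>The left side is the coefficient of \<open>z\<^sub>1 \<dots> z\<^sub>N\<close> in the determinant with entries
  \<open>\<Sum>\<^sub>l z\<^sub>l A l r c\<close>, the sum restricted to those \<open>l\<close> whose block contains \<open>(r, c)\<close>.\<close>

lemma sum_Pow_det_blocks:
  fixes A :: "nat \<Rightarrow> nat \<Rightarrow> nat \<Rightarrow> 'k::comm_ring_1"
  assumes t: "\<theta> permutes {0..<N}" "\<theta>' permutes {0..<N}"
  shows "(\<Sum>S\<in>Pow {0..<N}. (-1) ^ (N - card S) * det (mat N N (\<lambda>(r, c). \<Sum>l\<in>S.
      if bl r = bl (\<theta> l) \<and> bl' c = bl' (\<theta>' l) then A l r c else 0))) =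
    of_int (sign \<theta>) * of_int (sign \<theta>') * 
     (\<Sum>\<pi>\<in>block_perms bl N. \<Sum>\<pi>'\<in>block_perms bl' N. of_int (sign \<pi>) * of_int (sign \<pi>') *
        (\<Prod>l=0..<N. A l (\<pi> (\<theta> l)) (\<pi>' (\<theta>' l))))"
proof -
  define m where "m l r c = (if bl r = bl (\<theta> l) \<and> bl' c = bl' (\<theta>' l) then A l r c else 0)" for l r c
  define P where "P = {\<theta>::nat\<Rightarrow>nat. \<theta> permutes {0..<N}}"
  have finP: "finite P" by (simp add: P_def finite_permutations)
  have bpP: "block_perms bl N \<subseteq> P" "block_perms bl' N \<subseteq> P" by (auto simp: P_def block_perms_def)
  have sc: "of_int (sign (p \<circ> q)) = (of_int (sign p) * of_int (sign q) :: 'k)" if "p \<in> P" "q \<in> P" for p q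
    using that by (auto simp: P_def intro: signof_compose)
  have "(\<Sum>S\<in>Pow {0..<N}. (-1) ^ (N - card S) * det (mat N N (\<lambda>(r, c). \<Sum>l\<in>S. m l r c))) =
     (\<Sum>S\<in>Pow {0..<N}. (-1) ^ (N - card S) * (\<Sum>\<eta>\<in>P. of_int (sign \<eta>) * (\<Prod>r=0..<N. \<Sum>l\<in>S. m l r (\<eta> r))))"
  proof (intro sum.cong refl arg_cong2[where f = times])
    fix S
    show "det (mat N N (\<lambda>(r, c). \<Sum>l\<in>S. m l r c)) = (\<Sum>\<eta>\<in>P. of_int (sign \<eta>) * (\<Prod>r=0..<N. \<Sum>l\<in>S. m l r (\<eta> r)))"
      unfolding P_def
    proof (subst det_def'[of _ N], simp, intro sum.cong refl arg_cong2[where f = times] prod.cong)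
      fix \<eta> i assume "\<eta> \<in> {\<eta>. \<eta> permutes {0..<N}}" "i \<in> {0..<N}"
      then have "\<eta> i < N" "i < N" using permutes_in_image[of \<eta> "{0..<N}" i] by auto
      then show "mat N N (\<lambda>(r, c). \<Sum>l\<in>S. m l r c) $$ (i, \<eta> i) = (\<Sum>l\<in>S. m l i (\<eta> i))" by simp
    qed
  qed
  also have "\<dots> = (\<Sum>\<eta>\<in>P. of_int (sign \<eta>) * (\<Sum>S\<in>Pow {0..<N}. (-1) ^ (N - card S) * (\<Prod>r=0..<N. \<Sum>l\<in>S. m l r (\<eta> r))))"
    by (simp only: sum_distrib_left, subst sum.swap) (simp add: mult_ac)
  also have "\<dots> = (\<Sum>\<eta>\<in>P. of_int (sign \<eta>) * (\<Sum>\<mu>\<in>P. \<Prod>r=0..<N. m (\<mu> r) r (\<eta> r)))"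
    using polarization_permanent[of "{0..<N}" "\<lambda>r l. m l r (\<eta> r)" for \<eta>] by (simp add: P_def)
  \<comment> \<open>Polarisation assigned a summand to every row. After inversion
    \<open>\<mu> l\<close> is the row, and \<open>\<eta> (\<mu> l)\<close> the column, in which
    summand \<open>l\<close> is used; that column becomes the new variable
    \<open>\<nu> l\<close>.\<close>
  also have "\<dots> = (\<Sum>\<eta>\<in>P. of_int (sign \<eta>) * (\<Sum>\<mu>\<in>P. \<Prod>r=0..<N. m (Hilbert_Choice.inv \<mu> r) r (\<eta> r)))"
    unfolding P_def by (intro sum.cong refl arg_cong2[where f = times] sum_permutations_inverse)
  also have "\<dots> = (\<Sum>\<eta>\<in>P. of_int (sign \<eta>) * (\<Sum>\<mu>\<in>P. \<Prod>l=0..<N. m l (\<mu> l) (\<eta> (\<mu> l))))"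
  proof (intro sum.cong refl arg_cong2[where f = times])
    fix \<eta> \<mu> assume "\<mu> \<in> P"
    then have p: "\<mu> permutes {0..<N}" by (simp add: P_def)
    show "(\<Prod>r=0..<N. m (Hilbert_Choice.inv \<mu> r) r (\<eta> r)) = (\<Prod>l=0..<N. m l (\<mu> l) (\<eta> (\<mu> l)))"
      using prod.permute[OF p, of "\<lambda>r. m (Hilbert_Choice.inv \<mu> r) r (\<eta> r)"] permutes_inverses[OF p] by (simp add: comp_def)
  qed
  also have "\<dots> = (\<Sum>\<mu>\<in>P. \<Sum>\<eta>\<in>P. of_int (sign \<eta>) * (\<Prod>l=0..<N. m l (\<mu> l) (\<eta> (\<mu> l))))"
    by (simp only: sum_distrib_left) (rule sum.swap)
  also have "\<dots> = (\<Sum>\<mu>\<in>P. \<Sum>\<nu>\<in>P. of_int (sign \<nu>) * of_int (sign \<mu>) * (\<Prod>l=0..<N. m l (\<mu> l) (\<nu> l)))"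
  proof (rule sum.cong[OF refl])
    fix \<mu> assume m: "\<mu> \<in> P"
    then have p: "\<mu> permutes {0..<N}" by (simp add: P_def)
    have ip: "Hilbert_Choice.inv \<mu> \<in> P" using permutes_inv[OF p] by (simp add: P_def)
    have si: "of_int (sign (Hilbert_Choice.inv \<mu>)) = (of_int (sign \<mu>) :: 'k)"
      by (rule signof_inv[OF _ p]) simp
    have "(\<Sum>\<eta>\<in>P. of_int (sign \<eta>) * (\<Prod>l=0..<N. m l (\<mu> l) (\<eta> (\<mu> l)))) =
      (\<Sum>\<nu>\<in>P. of_int (sign (\<nu> \<circ> Hilbert_Choice.inv \<mu>)) * (\<Prod>l=0..<N. m l (\<mu> l) ((\<nu> \<circ> Hilbert_Choice.inv \<mu>) (\<mu> l))))"
      unfolding P_def by (rule sum_permutations_compose_right[OF permutes_inv[OF p]])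
    also have "\<dots> = (\<Sum>\<nu>\<in>P. of_int (sign \<nu>) * of_int (sign \<mu>) * (\<Prod>l=0..<N. m l (\<mu> l) (\<nu> l)))"
      using permutes_inverses[OF p] sc[OF _ ip] by (intro sum.cong) (auto simp: si)
    finally show "(\<Sum>\<eta>\<in>P. of_int (sign \<eta>) * (\<Prod>l=0..<N. m l (\<mu> l) (\<eta> (\<mu> l)))) =
      (\<Sum>\<nu>\<in>P. of_int (sign \<nu>) * of_int (sign \<mu>) * (\<Prod>l=0..<N. m l (\<mu> l) (\<nu> l)))" .
  qed
  \<comment> \<open>Rows and columns are now measured relative to \<open>\<theta>\<close> and
    \<open>\<theta>'\<close>. With this choice the block condition inside \<open>m\<close> says
    precisely that \<open>\<pi>\<close> and \<open>\<pi>'\<close> preserve blocks.\<close>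
  also have "\<dots> = (\<Sum>\<pi>\<in>P. \<Sum>\<pi>'\<in>P. of_int (sign (\<pi>' \<circ> \<theta>')) * of_int (sign (\<pi> \<circ> \<theta>)) *
       (\<Prod>l=0..<N. m l ((\<pi> \<circ> \<theta>) l) ((\<pi>' \<circ> \<theta>') l)))"
    unfolding P_def
    by (subst sum_permutations_compose_right[OF t(1)], subst sum_permutations_compose_right[OF t(2)]) (rule refl)
  also have "\<dots> = (\<Sum>\<pi>\<in>P. \<Sum>\<pi>'\<in>P. if \<pi> \<in> block_perms bl N \<and> \<pi>' \<in> block_perms bl' N then
       of_int (sign \<theta>) * of_int (sign \<theta>') * (of_int (sign \<pi>) * of_int (sign \<pi>') *
       (\<Prod>l=0..<N. A l (\<pi> (\<theta> l)) (\<pi>' (\<theta>' l)))) else 0)"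
  proof (intro sum.cong refl)
    fix \<pi> \<pi>' assume p: "\<pi> \<in> P" "\<pi>' \<in> P"
    have lt: "\<theta> l < N" "\<theta>' l < N" if "l < N" for l using that permutes_in_image[OF t(1), of l] permutes_in_image[OF t(2), of l] by auto
    have ex: "\<exists>l<N. r = \<theta> l" "\<exists>l<N. r = \<theta>' l" if "r < N" for r
      using that permutes_image[OF t(1)] permutes_image[OF t(2)] by (metis atLeastLessThan_iff imageE le0)+
    have "(\<forall>l<N. bl (\<pi> (\<theta> l)) = bl (\<theta> l) \<and> bl' (\<pi>' (\<theta>' l)) = bl' (\<theta>' l)) \<longleftrightarrow>
        \<pi> \<in> block_perms bl N \<and> \<pi>' \<in> block_perms bl' N"
      using p lt ex unfolding block_perms_def P_def by (auto; metis)
    moreover have "(\<Prod>l=0..<N. m l (\<pi> (\<theta> l)) (\<pi>' (\<theta>' l))) =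
       (if \<forall>l<N. bl (\<pi> (\<theta> l)) = bl (\<theta> l) \<and> bl' (\<pi>' (\<theta>' l)) = bl' (\<theta>' l)
        then \<Prod>l=0..<N. A l (\<pi> (\<theta> l)) (\<pi>' (\<theta>' l)) else 0)"
      by (auto simp: m_def intro!: prod_zero)
    ultimately show "of_int (sign (\<pi>' \<circ> \<theta>')) * of_int (sign (\<pi> \<circ> \<theta>)) *
       (\<Prod>l=0..<N. m l ((\<pi> \<circ> \<theta>) l) ((\<pi>' \<circ> \<theta>') l)) =
       (if \<pi> \<in> block_perms bl N \<and> \<pi>' \<in> block_perms bl' N then
       of_int (sign \<theta>) * of_int (sign \<theta>') * (of_int (sign \<pi>) * of_int (sign \<pi>') *
       (\<Prod>l=0..<N. A l (\<pi> (\<theta> l)) (\<pi>' (\<theta>' l)))) else 0)"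
      using t p by (simp add: sc P_def mult_ac)
  qed
  also have "\<dots> = (\<Sum>\<pi>\<in>block_perms bl N. \<Sum>\<pi>'\<in>P. if \<pi> \<in> block_perms bl N \<and> \<pi>' \<in> block_perms bl' N then
       of_int (sign \<theta>) * of_int (sign \<theta>') * (of_int (sign \<pi>) * of_int (sign \<pi>') *
       (\<Prod>l=0..<N. A l (\<pi> (\<theta> l)) (\<pi>' (\<theta>' l)))) else 0)"
    by (rule sum.mono_neutral_right, rule finP, rule bpP, simp)
  also have "\<dots> = (\<Sum>\<pi>\<in>block_perms bl N. \<Sum>\<pi>'\<in>block_perms bl' N.
       of_int (sign \<theta>) * of_int (sign \<theta>') * (of_int (sign \<pi>) * of_int (sign \<pi>') *
       (\<Prod>l=0..<N. A l (\<pi> (\<theta> l)) (\<pi>' (\<theta>' l)))))"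
    by (rule sum.cong[OF refl], rule sum.mono_neutral_cong_right, rule finP,
      rule bpP, simp_all)
  finally show ?thesis unfolding m_def by (simp add: sum_distrib_left)
qed

section \<open>Polynomial functions\<close>

text \<open>One closure predicate serves both kinds of polynomial function used below:
  \<open>range poly\<close> in one variable and \<open>range poly_eval\<close> in the matrix
  entries.\<close>

definition fun_algebra :: "('x \<Rightarrow> 'k::comm_ring_1) set \<Rightarrow> bool" where
  "fun_algebra F \<longleftrightarrow> (\<forall>c. (\<lambda>x. c) \<in> F) \<and>
    (\<forall>f\<in>F. \<forall>g\<in>F. (\<lambda>x. f x + g x) \<in> F \<and> (\<lambda>x. f x * g x) \<in> F)"

lemma fun_algebra_const: "fun_algebra F \<Longrightarrow> (\<lambda>x. c) \<in> F"
  and fun_algebra_add: "fun_algebra F \<Longrightarrow> f \<in> F \<Longrightarrow> g \<in> F \<Longrightarrow> (\<lambda>x. f x + g x) \<in> F"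
  and fun_algebra_mult: "fun_algebra F \<Longrightarrow> f \<in> F \<Longrightarrow> g \<in> F \<Longrightarrow> (\<lambda>x. f x * g x) \<in> F"
  by (auto simp: fun_algebra_def)

lemma fun_algebra_sum:
  assumes "fun_algebra F" "\<And>i. i \<in> I \<Longrightarrow> f i \<in> F"
  shows "(\<lambda>x. \<Sum>i\<in>I. f i x) \<in> F"
  using assms(2)
  by (induction I rule: infinite_finite_induct)
    (auto intro: fun_algebra_const[OF assms(1)] fun_algebra_add[OF assms(1)])

lemma fun_algebra_prod:
  assumes "fun_algebra F" "\<And>i. i \<in> I \<Longrightarrow> f i \<in> F"
  shows "(\<lambda>x. \<Prod>i\<in>I. f i x) \<in> F"
  using assms(2)
  by (induction I rule: infinite_finite_induct)
    (auto intro: fun_algebra_const[OF assms(1)] fun_algebra_mult[OF assms(1)])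

lemma fun_algebra_power:
  assumes "fun_algebra F" "f \<in> F"
  shows "(\<lambda>x. f x ^ n) \<in> F"
  by (induction n) (auto intro: assms fun_algebra_const fun_algebra_mult)

lemma fun_algebra_det:
  assumes F: "fun_algebra F" and M: "\<And>x. M x \<in> carrier_mat n n"
    and entries: "\<And>i j. i < n \<Longrightarrow> j < n \<Longrightarrow> (\<lambda>x. M x $$ (i, j)) \<in> F"
  shows "(\<lambda>x. det (M x)) \<in> F"
  unfolding det_def'[OF M]
  by (intro fun_algebra_sum[OF F] fun_algebra_mult[OF F] fun_algebra_const[OF F]
      fun_algebra_prod[OF F] entries) (auto simp: permutes_in_image dest: permutes_in_image)

text \<open>A monomial is kept as a word, with order and repetitions, so that its factors are
  numbered; the permutations of the omega process act on these numbers.\<close>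

definition poly_eval :: "('k \<times> 'i list) list \<Rightarrow> ('i \<Rightarrow> 'k::comm_ring_1) \<Rightarrow> 'k" where
  "poly_eval ws z = (\<Sum>(c, w)\<leftarrow>ws. c * prod_list (map z w))"

lemma poly_eval_in_fun_algebra:
  assumes F: "fun_algebra F" and z: "\<And>i. (\<lambda>x. z x i) \<in> F"
  shows "(\<lambda>x. poly_eval ws (z x)) \<in> F"
proof -
  have mon: "(\<lambda>x. prod_list (map (z x) w)) \<in> F" for w
    by (induction w) (auto intro: fun_algebra_const[OF F] fun_algebra_mult[OF F] z)
  show ?thesis
    unfolding poly_eval_def
    by (induction ws) (auto intro!: fun_algebra_const[OF F] fun_algebra_add[OF F] fun_algebra_mult[OF F] mon)
qed

lemma fun_algebra_poly_eval: "fun_algebra (range (poly_eval :: ('k::comm_ring_1 \<times> 'i list) list \<Rightarrow> _))"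
  unfolding fun_algebra_def
proof (intro conjI allI ballI)
  fix c :: 'k
  show "(\<lambda>x. c) \<in> range poly_eval"
    by (rule range_eqI[of _ _ "[(c, [])]"]) (simp add: poly_eval_def fun_eq_iff)
next
  fix f g :: "('i \<Rightarrow> 'k) \<Rightarrow> 'k"
  assume "f \<in> range poly_eval" "g \<in> range poly_eval"
  then obtain u v where f: "f = poly_eval u" and g: "g = poly_eval v" by auto
  show "(\<lambda>x. f x + g x) \<in> range poly_eval"
    by (rule range_eqI[of _ _ "u @ v"]) (simp add: poly_eval_def fun_eq_iff f g)
  have "poly_eval (concat (map (\<lambda>(c, w). map (\<lambda>(d, w'). (c * d, w @ w')) v) u)) z = poly_eval u z * poly_eval v z" for z
  proof (induction u)
    case (Cons cw u)
    obtain c w where cw: "cw = (c, w)" by (cases cw)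
    have "poly_eval (map (\<lambda>(d, w'). (c * d, w @ w')) v) z = c * prod_list (map z w) * poly_eval v z"
      by (induction v) (auto simp: poly_eval_def algebra_simps)
    then show ?case using Cons.IH by (simp add: poly_eval_def cw algebra_simps)
  qed (simp add: poly_eval_def)
  then show "(\<lambda>x. f x * g x) \<in> range poly_eval"
    by (intro range_eqI[of _ _ "concat (map (\<lambda>(c, w). map (\<lambda>(d, w'). (c * d, w @ w')) v) u)"])
      (simp add: fun_eq_iff f g)
qed

lemma var_poly_eval: "(\<lambda>z. z i) \<in> range poly_eval"
  by (rule range_eqI[of _ _ "[(1, [i])]"]) (simp add: poly_eval_def fun_eq_iff)

section \<open>Polynomial functions of one variable\<close>

lemma fun_algebra_poly: "fun_algebra (range (poly :: 'k::comm_ring_1 poly \<Rightarrow> _))"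
  unfolding fun_algebra_def
proof (intro conjI allI ballI)
  fix c :: 'k
  show "(\<lambda>x. c) \<in> range poly" by (rule range_eqI[of _ _ "[:c:]"]) (simp add: fun_eq_iff)
next
  fix f g :: "'k \<Rightarrow> 'k" assume "f \<in> range poly" "g \<in> range poly"
  then obtain p q where "f = poly p" "g = poly q" by auto
  then have "(\<lambda>x. f x + g x) = poly (p + q)" "(\<lambda>x. f x * g x) = poly (p * q)"
    by (auto simp: fun_eq_iff)
  then show "(\<lambda>x. f x + g x) \<in> range poly" "(\<lambda>x. f x * g x) \<in> range poly" by blast+
qed

lemma id_range_poly: "(\<lambda>x. x) \<in> range (poly :: 'k::comm_ring_1 poly \<Rightarrow> _)"
  by (rule range_eqI[of _ _ "[:0, 1:]"]) (simp add: fun_eq_iff)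

text \<open>The product of \<open>h\<close> with the difference vanishes everywhere, hence vanishes
  as a polynomial, and \<open>h\<close> can be cancelled. It is used for identities known only at
  invertible arguments.\<close>

lemma range_poly_eqI:
  fixes f g :: "'k::{idom, ring_char_0} \<Rightarrow> 'k"
  assumes "f \<in> range poly" "g \<in> range poly" "h \<in> range poly" "h x\<^sub>0 \<noteq> 0"
    and "\<And>x. h x \<noteq> 0 \<Longrightarrow> f x = g x"
  shows "f = g"
proof -
  obtain p q r where pq: "f = poly p" "g = poly q" "h = poly r" using assms by auto
  have "r * (p - q) = 0"
    using assms(5) by (intro poly_all_0_iff_0[THEN iffD1]) (auto simp: pq)
  then show ?thesis using assms(4) by (auto simp: pq)
qed

text \<open>Comparing coefficients in \<open>f (2 * x) = f 2 * f x\<close> gives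
  \<open>2 ^ i = f 2\<close> for every exponent \<open>i\<close> that occurs. Powers of 2 are
  distinct in characteristic 0, so a single monomial remains, and \<open>f 1 = 1\<close> is its
  coefficient.\<close>

lemma multiplicative_poly_is_power:
  fixes f :: "'k::field_char_0 \<Rightarrow> 'k"
  assumes f: "f \<in> range poly" and "f 1 = 1"
    and mult: "\<And>x y. x \<noteq> 0 \<Longrightarrow> y \<noteq> 0 \<Longrightarrow> f (x * y) = f x * f y"
  shows "\<exists>s. \<forall>x. f x = x ^ s"
proof -
  obtain q where q: "f = poly q" using f by auto
  have "poly (pcompose q [:0, 2:]) = poly (smult (f 2) q)"
  proof (rule range_poly_eqI[of _ _ "\<lambda>x. x" 1])
    fix x :: 'k assume "x \<noteq> 0"
    then show "poly (pcompose q [:0, 2:]) x = poly (smult (f 2) q) x"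
      using mult[of 2 x] by (simp add: q poly_pcompose mult.commute)
  qed (auto simp: id_range_poly)
  then have eq: "pcompose q [:0, 2:] = smult (f 2) q" by (simp only: poly_eq_poly_eq_iff)
  have coeff2: "coeff q i * 2 ^ i = f 2 * coeff q i" for i
    using arg_cong[OF eq, of "\<lambda>p. coeff p i"] coeff_pcompose_linear[of q 2 i] by (simp add: mult.commute)
  have "q \<noteq> 0" using assms(2) q by auto
  then obtain s where s: "coeff q s \<noteq> 0" by (metis leading_coeff_neq_0)
  have "coeff q i = 0" if "i \<noteq> s" for i
  proof (rule ccontr)
    assume "coeff q i \<noteq> 0"
    then have "(2::'k) ^ i = 2 ^ s" using coeff2[of i] coeff2[of s] s by auto
    then have "of_nat (2 ^ i) = (of_nat (2 ^ s) :: 'k)" by simp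
    then show False using that by (simp only: of_nat_eq_iff) simp
  qed
  then have "q = monom (coeff q s) s" by (intro poly_eqI) (auto simp: coeff_monom)
  then have fx: "f x = coeff q s * x ^ s" for x by (metis poly_monom q)
  show ?thesis using fx fx[of 1] assms(2) by auto
qed

section \<open>Characters of the general linear group\<close>

text \<open>A section of the determinant: a character that depends only on the determinant is known
  from its values here. For \<open>n = 0\<close> this is the empty matrix, of determinant 1 for
  every \<open>x\<close>.\<close>

definition corner_mat :: "nat \<Rightarrow> 'k::comm_ring_1 \<Rightarrow> 'k mat" where
  "corner_mat n x = mat n n (\<lambda>(i, j). if i = j then if i = 0 then x else 1 else 0)"

lemma corner_mat_carrier [simp]: "corner_mat n x \<in> carrier_mat n n"
  by (simp add: corner_mat_def)

lemma corner_mat_one [simp]: "corner_mat n 1 = 1\<^sub>m n"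
  by (rule eq_matI) (auto simp: corner_mat_def)

lemma corner_mat_Suc: "corner_mat (Suc n) x = four_block_mat (mat 1 1 (\<lambda>_. x)) (0\<^sub>m 1 n) (0\<^sub>m n 1) (1\<^sub>m n)"
  by (rule eq_matI) (auto simp: corner_mat_def four_block_mat_def)

lemma det_corner_mat: "n > 0 \<Longrightarrow> det (corner_mat n (x::'k::field)) = x"
proof (cases n)
  case (Suc m)
  show ?thesis unfolding Suc corner_mat_Suc
    by (subst det_four_block_mat_upper_right_zero[of _ 1 _ m])
      (auto simp: det_def'[of _ 1] permutes_sing)
qed simp

lemma corner_mat_mult: "corner_mat n x * corner_mat n y = corner_mat n (x * y)"
proof (cases n)
  case (Suc m)
  show ?thesis unfolding Suc corner_mat_Suc
    by (subst mult_four_block_mat[of _ 1 1 _ m _ m _ _ 1 _ m])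
     (auto intro!: cong_four_block_mat eq_matI simp: scalar_prod_def)
qed (auto simp: corner_mat_def)

text \<open>These hypotheses are purely group-theoretic: outside characteristic 2, multiplicativity
  alone forces \<open>\<kappa>\<close> to factor through the determinant. Polynomiality enters
  later, to recognise the resulting character of the multiplicative group as a power.\<close>

locale gl_character =
  fixes n :: nat and \<kappa> :: "'k::field mat \<Rightarrow> 'k"
  assumes mult: "\<And>A B. A \<in> carrier_mat n n \<Longrightarrow> B \<in> carrier_mat n n \<Longrightarrow>
      det A \<noteq> 0 \<Longrightarrow> det B \<noteq> 0 \<Longrightarrow> \<kappa> (A * B) = \<kappa> A * \<kappa> B"
    and one: "\<kappa> (1\<^sub>m n) = 1"
    and two: "(2::'k) \<noteq> 0"
begin

lemma nonzero: "A \<in> carrier_mat n n \<Longrightarrow> det A \<noteq> 0 \<Longrightarrow> \<kappa> A \<noteq> 0"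
proof -
  assume A: "A \<in> carrier_mat n n" "det A \<noteq> 0"
  then have "A \<in> Units (ring_mat TYPE('k) n ())" by (rule det_non_zero_imp_unit)
  then obtain B where B: "B \<in> carrier_mat n n" "A * B = 1\<^sub>m n"
    by (auto simp: Units_def ring_mat_def)
  have "det A * det B = 1" using det_mult[OF A(1) B(1)] B by simp
  then have "\<kappa> A * \<kappa> B = 1" using mult[OF A(1) B(1)] A B one by (metis mult_zero_right zero_neq_one)
  then show ?thesis by auto
qed

end

text \<open>Induction by Schur complements. A block unipotent \<open>U r\<close> is conjugate to its square \<open>U (r + r)\<close>
  by \<open>diag (2, 1, \<dots>, 1)\<close>, which forces \<open>\<kappa> (U r) = 1\<close>.\<close>

lemma gl_character_corner:
  assumes "gl_character n \<kappa>" "A \<in> carrier_mat n n" "det A \<noteq> 0"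
  shows "\<kappa> A = \<kappa> (corner_mat n (det A))"
  using assms
proof (induction n arbitrary: \<kappa> A)
  case 0
  then have "A = corner_mat 0 (det A)" by (intro eq_matI) auto
  then show ?case by simp
next
  case (Suc n)
  interpret gl_character "Suc n" \<kappa> by fact
  define U where "U r = four_block_mat (1\<^sub>m 1) r (0\<^sub>m n 1) (1\<^sub>m n)" for r :: "'a mat"
  define L where "L c = four_block_mat (1\<^sub>m 1) (0\<^sub>m 1 n) c (1\<^sub>m n)" for c :: "'a mat"
  define D where "D x = corner_mat (Suc n) x" for x :: 'a
  define E where "E B = four_block_mat (1\<^sub>m 1) (0\<^sub>m 1 n) (0\<^sub>m n 1) B" for B :: "'a mat"
  note blocks = mult_four_block_mat[of _ 1 1 _ n _ n _ _ 1 _ n]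
  have carr [simp]: "U r \<in> carrier_mat (Suc n) (Suc n)" "L c \<in> carrier_mat (Suc n) (Suc n)"
      "D x \<in> carrier_mat (Suc n) (Suc n)" for r c x
    using four_block_carrier_mat[of "1\<^sub>m 1" 1 1 "1\<^sub>m n" n n] by (auto simp: U_def L_def D_def)
  have carrE [simp]: "E B \<in> carrier_mat (Suc n) (Suc n)" if "B \<in> carrier_mat n n" for B
    using that four_block_carrier_mat[of "1\<^sub>m 1" 1 1 B n n] by (auto simp: E_def)
  have detU: "det (U r) = 1" if "r \<in> carrier_mat 1 n" for r
    unfolding U_def using that by (subst det_four_block_mat_lower_left_zero[of _ 1 _ n]) auto
  have detL: "det (L c) = 1" if "c \<in> carrier_mat n 1" for c
    unfolding L_def using that by (subst det_four_block_mat_upper_right_zero[of _ 1 _ n]) auto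
  have detD: "det (D x) = x" for x by (simp add: D_def det_corner_mat)
  have detE: "det (E B) = det B" if "B \<in> carrier_mat n n" for B
    unfolding E_def using that by (subst det_four_block_mat_upper_right_zero[of _ 1 _ n]) auto
  have D_block: "D x = four_block_mat (mat 1 1 (\<lambda>_. x)) (0\<^sub>m 1 n) (0\<^sub>m n 1) (1\<^sub>m n)" for x
    by (simp add: D_def corner_mat_Suc)
  have \<kappa>U: "\<kappa> (U r) = 1" if r: "r \<in> carrier_mat 1 n" for r
  proof -
    have "D 2 * U r = U (r + r) * D 2"
      unfolding D_block U_def using r
      by (subst (1 2) blocks) (auto intro!: cong_four_block_mat eq_matI simp: scalar_prod_def)
    moreover have "U (r + r) = U r * U r"
      unfolding U_def using r by (subst blocks) (auto intro!: cong_four_block_mat)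
    ultimately have "\<kappa> (D 2) * \<kappa> (U r) = \<kappa> (U r) * \<kappa> (U r) * \<kappa> (D 2)"
      using mult_carrier_mat[OF carr(1) carr(1), of r r] r mult[of "D 2" "U r"] mult[of "U (r + r)" "D 2"] mult[of "U r" "U r"]
      by (simp add: detU detD two det_mult[of _ "Suc n"])
    then show ?thesis using nonzero[of "D 2"] nonzero[of "U r"] detU[OF r] detD two by auto
  qed
  have \<kappa>L: "\<kappa> (L c) = 1" if c: "c \<in> carrier_mat n 1" for c
  proof -
    have "L c * D 2 = D 2 * L (c + c)"
      unfolding D_block L_def using c
      by (subst (1 2) blocks) (auto intro!: cong_four_block_mat eq_matI simp: scalar_prod_def)
    moreover have "L (c + c) = L c * L c"
      unfolding L_def using c by (subst blocks) (auto intro!: cong_four_block_mat)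
    ultimately have "\<kappa> (L c) * \<kappa> (D 2) = \<kappa> (D 2) * (\<kappa> (L c) * \<kappa> (L c))"
      using mult_carrier_mat[OF carr(2) carr(2), of c c] c mult[of "L c" "D 2"] mult[of "D 2" "L (c + c)"] mult[of "L c" "L c"]
      by (simp add: detL detD two det_mult[of _ "Suc n"])
    then show ?thesis using nonzero[of "D 2"] nonzero[of "L c"] detL[OF c] detD two by auto
  qed
  have E_mult: "E (B * C) = E B * E C" if "B \<in> carrier_mat n n" "C \<in> carrier_mat n n" for B C
    unfolding E_def using that by (subst blocks) (auto intro!: cong_four_block_mat)
  interpret E: gl_character n "\<lambda>B. \<kappa> (E B)"
  proof
    show "\<kappa> (E (1\<^sub>m n)) = 1" using one by (simp add: E_def four_block_one_mat)
  qed (auto simp: E_mult mult detE two)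
  have \<kappa>E: "\<kappa> (E B) = \<kappa> (D (det B))" if B: "B \<in> carrier_mat n n" "det B \<noteq> 0" for B
  proof (cases n)
    case 0
    then have "E B = D (det B)" using B one by (intro eq_matI) (auto simp: E_def D_block)
    then show ?thesis by simp
  next
    case (Suc m)
    \<comment> \<open>Conjugation by this transposition carries diag (1, x, 1, ...), which is
      \<open>E\<close> of a corner matrix, to \<open>D x\<close>.\<close>
    define S where "S = (swaprows_mat (Suc n) 0 1 :: 'a mat)"
    have S: "S \<in> carrier_mat (Suc n) (Suc n)" "S * S = 1\<^sub>m (Suc n)"
      using swaprows_mat_inv[of 0 "Suc n" 1] by (auto simp: S_def Suc)
    have "\<kappa> (E B) = \<kappa> (E (corner_mat n (det B)))"
      by (rule Suc.IH) (use E.gl_character_axioms B in auto)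
    also have "\<dots> = \<kappa> (D (det B))"
    proof -
      define M where "M = E (corner_mat n (det B))"
      have M: "M \<in> carrier_mat (Suc n) (Suc n)" by (simp add: M_def)
      have detM: "det M = det B" by (simp add: M_def detE det_corner_mat Suc)
      have "det S * det S = 1" using det_mult[OF S(1) S(1)] S(2) by simp
      then have detS: "det S \<noteq> 0" by auto
      have "swaprows 0 1 M = swapcols 0 1 (D (det B))"
        by (rule eq_matI) (auto simp: M_def E_def D_def corner_mat_def four_block_mat_def Suc split: if_splits)
      then have "S * M = D (det B) * S"
        using swaprows_mat[OF M, of 0 1] swapcols_mat[OF carr(3)[of "det B"], of 0 1] Suc by (simp add: S_def)
      then have "\<kappa> S * \<kappa> M = \<kappa> (D (det B)) * \<kappa> S"
        using mult[OF S(1) M] mult[of "D (det B)" S] S detS B(2) detM by (auto simp: detD)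
      then show ?thesis using nonzero[OF S(1) detS] by (simp add: M_def)
    qed
    finally show ?thesis .
  qed
  have main: "\<kappa> A = \<kappa> (D (det A))"
    if A: "A \<in> carrier_mat (Suc n) (Suc n)" "det A \<noteq> 0" "A $$ (0, 0) \<noteq> 0" for A
  proof -
    define a where "a = A $$ (0, 0)"
    obtain A1 r c B where spl: "split_block A 1 1 = (A1, r, c, B)" by (metis prod_cases4)
    have dims: "A1 \<in> carrier_mat 1 1" "r \<in> carrier_mat 1 n" "c \<in> carrier_mat n 1" "B \<in> carrier_mat n n"
      and A_eq: "A = four_block_mat A1 r c B"
      using split_block[OF spl, of n n] A by auto
    have A1: "A1 = mat 1 1 (\<lambda>_. a)"
      using dims(1) by (intro eq_matI) (auto simp: a_def A_eq)
    \<comment> \<open>The Schur complement of the pivot \<open>a\<close>. Block elimination writes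
      the matrix as \<open>L\<close>, \<open>D a\<close>, \<open>E B'\<close>, \<open>U\<close> in
      this order, and \<open>\<kappa>\<close> is 1 on the two unipotent factors.\<close>
    define B' where "B' = B - (inverse a \<cdot>\<^sub>m c) * r"
    have B': "B' \<in> carrier_mat n n" using dims by (auto simp: B'_def)
    have a: "a \<noteq> 0" using A by (simp add: a_def)
    have c': "inverse a \<cdot>\<^sub>m c \<in> carrier_mat n 1" and r': "inverse a \<cdot>\<^sub>m r \<in> carrier_mat 1 n"
      using dims by auto
    have "D a * E B' = four_block_mat (mat 1 1 (\<lambda>_. a)) (0\<^sub>m 1 n) (0\<^sub>m n 1) B'"
      unfolding D_block E_def using B' by (subst blocks) (auto intro!: cong_four_block_mat)
    also have "\<dots> * U (inverse a \<cdot>\<^sub>m r) = four_block_mat (mat 1 1 (\<lambda>_. a)) r (0\<^sub>m n 1) B'"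
      unfolding U_def using B' r' a dims
      by (subst blocks) (auto intro!: cong_four_block_mat eq_matI simp: scalar_prod_def)
    finally have 1: "(D a * E B') * U (inverse a \<cdot>\<^sub>m r) = four_block_mat (mat 1 1 (\<lambda>_. a)) r (0\<^sub>m n 1) B'" .
    have dec: "A = L (inverse a \<cdot>\<^sub>m c) * ((D a * E B') * U (inverse a \<cdot>\<^sub>m r))"
      unfolding 1 unfolding L_def A_eq A1 using B' c' a dims
      by (subst blocks) (auto intro!: cong_four_block_mat eq_matI simp: scalar_prod_def B'_def)
    have mc [simp]: "X * Y \<in> carrier_mat (Suc n) (Suc n)"
      if "X \<in> carrier_mat (Suc n) (Suc n)" "Y \<in> carrier_mat (Suc n) (Suc n)" for X Y :: "'a mat"
      using that by (rule mult_carrier_mat)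
    have prod: "\<kappa> (X * Y) = \<kappa> X * \<kappa> Y \<and> det (X * Y) = det X * det Y"
      if "X \<in> carrier_mat (Suc n) (Suc n)" "Y \<in> carrier_mat (Suc n) (Suc n)" "det X * det Y \<noteq> 0" for X Y
      using mult[of X Y] det_mult[of X "Suc n" Y] that by auto
    have detA: "det A = a * det B'"
      unfolding dec using B' detL[OF c'] detU[OF r']
      by (simp add: det_mult[of _ "Suc n"] detD detE)
    then have nz: "det B' \<noteq> 0" using A by auto
    have "\<kappa> A = \<kappa> (L (inverse a \<cdot>\<^sub>m c)) * ((\<kappa> (D a) * \<kappa> (E B')) * \<kappa> (U (inverse a \<cdot>\<^sub>m r)))"
      unfolding dec using B' detL[OF c'] detU[OF r'] a nz
      by (simp add: prod detD detE)
    also have "\<dots> = \<kappa> (D a) * \<kappa> (D (det B'))"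
      using \<kappa>E[OF B' nz] \<kappa>L[OF c'] \<kappa>U[OF r'] by simp
    also have "\<dots> = \<kappa> (D a * D (det B'))" using a nz by (simp add: prod detD)
    also have "\<dots> = \<kappa> (D (det A))" by (simp add: D_def corner_mat_mult detA)
    finally show ?thesis .
  qed
  show ?case
  proof (cases "A $$ (0, 0) = 0")
    case False
    then show ?thesis using main[OF Suc.prems(2,3)] by (simp add: D_def)
  next
    case True
    obtain A1 r c B where spl: "split_block A 1 1 = (A1, r, c, B)" by (metis prod_cases4)
    have dims: "A1 \<in> carrier_mat 1 1" "r \<in> carrier_mat 1 n" "c \<in> carrier_mat n 1" "B \<in> carrier_mat n n"
      and A_eq: "A = four_block_mat A1 r c B"
      using split_block[OF spl, of n n] Suc.prems(2) by auto
    have A1: "A1 = 0\<^sub>m 1 1"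
      using dims(1) True by (intro eq_matI) (auto simp: A_eq)
    have "c \<noteq> 0\<^sub>m n 1"
    proof
      assume "c = 0\<^sub>m n 1"
      then have "det A = det A1 * det B"
        unfolding A_eq using dims by (intro det_four_block_mat_lower_left_zero) auto
      then show False using Suc.prems(3) A1 by simp
    qed
    then obtain i where i: "i < n" "c $$ (i, 0) \<noteq> 0"
      using dims(3) by (metis (no_types, lifting) carrier_matD eq_matI index_zero_mat less_one)
    \<comment> \<open>With a zero corner, invertibility yields a nonzero entry of \<open>c\<close>.
      Left multiplication by \<open>U u\<close> adds its row to row 0, which supplies a pivot and
      changes neither \<open>\<kappa>\<close> nor the determinant.\<close>
    define u where "u = mat 1 n (\<lambda>(_, j). if j = i then 1 else (0::'a))"
    have u: "u \<in> carrier_mat 1 n" by (simp add: u_def)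
    have "U u * A = four_block_mat (u * c) (r + u * B) c B"
      unfolding U_def A_eq A1 using dims u by (subst blocks) (auto intro!: cong_four_block_mat)
    then have "(U u * A) $$ (0, 0) = (u * c) $$ (0, 0)" using dims u by simp
    also have "\<dots> = c $$ (i, 0)"
      using dims i by (simp add: u_def scalar_prod_def if_distrib if_distribR cong: if_cong)
    finally have nz: "(U u * A) $$ (0, 0) \<noteq> 0" using i by simp
    have d: "det (U u * A) = det A" using Suc.prems(2) detU[OF u] by (simp add: det_mult[of _ "Suc n"])
    have "\<kappa> (U u * A) = \<kappa> (D (det (U u * A)))"
      by (rule main) (use mult_carrier_mat[OF carr(1) Suc.prems(2)] Suc.prems nz d in auto)
    then show ?thesis using mult[of "U u" A] Suc.prems \<kappa>U[OF u] detU[OF u] d by (simp add: D_def)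
  qed
qed

lemma det_corner_mat_nonzero: "x \<noteq> 0 \<Longrightarrow> det (corner_mat n (x::'k::field)) \<noteq> 0"
  by (cases "n = 0") (auto simp: det_corner_mat)

text \<open>A character of a product group is the product of its restrictions to the factors, and
  each restriction depends only on a determinant. Polynomiality on corner matrices then yields
  natural exponents, which excludes negative powers of determinants.\<close>

lemma gl_family_character:
  fixes K :: "('v \<Rightarrow> 'k::field_char_0 mat) \<Rightarrow> 'k" and \<alpha> :: "'v \<Rightarrow> nat" and V :: "'v set"
  defines "G \<equiv> {g. \<forall>v\<in>V. g v \<in> carrier_mat (\<alpha> v) (\<alpha> v) \<and> det (g v) \<noteq> 0}"
  assumes fin: "finite V"
    and mult: "\<And>g h. g \<in> G \<Longrightarrow> h \<in> G \<Longrightarrow> K (\<lambda>v. g v * h v) = K g * K h"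
    and cong: "\<And>g h. g \<in> G \<Longrightarrow> (\<And>v. v \<in> V \<Longrightarrow> g v = h v) \<Longrightarrow> K g = K h"
    and one: "K (\<lambda>v. 1\<^sub>m (\<alpha> v)) = 1"
    and poly: "\<And>v. v \<in> V \<Longrightarrow> \<exists>f\<in>range poly. \<forall>x. x \<noteq> 0 \<longrightarrow>
      K ((\<lambda>w. 1\<^sub>m (\<alpha> w))(v := corner_mat (\<alpha> v) x)) = f x"
  shows "\<exists>s. \<forall>g\<in>G. K g = (\<Prod>v\<in>V. det (g v) ^ s v)"
proof -
  define \<delta> where "\<delta> v A = (\<lambda>w. 1\<^sub>m (\<alpha> w))(v := A)" for v and A :: "'k mat"
  have \<delta>G: "\<delta> v A \<in> G" if "A \<in> carrier_mat (\<alpha> v) (\<alpha> v)" "det A \<noteq> 0" for v A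
    using that by (auto simp: \<delta>_def G_def)
  have \<delta>_mult: "K (\<delta> v (A * B)) = K (\<delta> v A) * K (\<delta> v B)"
    if "A \<in> carrier_mat (\<alpha> v) (\<alpha> v)" "B \<in> carrier_mat (\<alpha> v) (\<alpha> v)" "det A \<noteq> 0" "det B \<noteq> 0" for v A B
  proof -
    have "(\<lambda>w. \<delta> v A w * \<delta> v B w) = \<delta> v (A * B)" by (auto simp: \<delta>_def)
    then show ?thesis using mult[OF \<delta>G \<delta>G, of A v B v] that by simp
  qed
  have "\<exists>s. \<forall>A. A \<in> carrier_mat (\<alpha> v) (\<alpha> v) \<longrightarrow> det A \<noteq> 0 \<longrightarrow> K (\<delta> v A) = det A ^ s" if v: "v \<in> V" for v
  proof -
    have char: "gl_character (\<alpha> v) (\<lambda>A. K (\<delta> v A))"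
    proof
      have "\<delta> v (1\<^sub>m (\<alpha> v)) = (\<lambda>v. 1\<^sub>m (\<alpha> v))" by (auto simp: \<delta>_def)
      then show "K (\<delta> v (1\<^sub>m (\<alpha> v))) = 1" using one by simp
    qed (auto simp: \<delta>_mult)
    then interpret gl_character "\<alpha> v" "\<lambda>A. K (\<delta> v A)" .
    obtain f where f: "f \<in> range poly" "\<And>x. x \<noteq> 0 \<Longrightarrow> K (\<delta> v (corner_mat (\<alpha> v) x)) = f x"
      using poly[OF v] unfolding \<delta>_def by blast
    have "f 1 = 1" using f(2)[of 1] one by simp
    moreover have "f (x * y) = f x * f y" if "x \<noteq> 0" "y \<noteq> 0" for x y
      using that f(2)[of x] f(2)[of y] f(2)[of "x * y"]
        \<delta>_mult[of "corner_mat (\<alpha> v) x" v "corner_mat (\<alpha> v) y"]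
      by (simp add: corner_mat_mult det_corner_mat_nonzero)
    ultimately obtain s where "\<And>x. f x = x ^ s" using multiplicative_poly_is_power[OF f(1)] by blast
    then show ?thesis using gl_character_corner[OF char] f(2) by metis
  qed
  then obtain s where s: "\<And>v A. v \<in> V \<Longrightarrow> A \<in> carrier_mat (\<alpha> v) (\<alpha> v) \<Longrightarrow> det A \<noteq> 0 \<Longrightarrow> K (\<delta> v A) = det A ^ s v"
    by metis
  have "K g = (\<Prod>v\<in>V. det (g v) ^ s v)" if g: "g \<in> G" for g
  proof -
    \<comment> \<open>The vertices are switched from the identity to \<open>g v\<close> one at a
      time; each switch splits off one embedded factor \<open>\<delta> v (g v)\<close>.\<close>
    have "K (\<lambda>v. if v \<in> W then g v else 1\<^sub>m (\<alpha> v)) = (\<Prod>v\<in>W. det (g v) ^ s v)" if "W \<subseteq> V" for W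
      using finite_subset[OF that fin] that
    proof (induction W rule: finite_induct)
      case (insert v W)
      have gW: "(\<lambda>v. if v \<in> W then g v else 1\<^sub>m (\<alpha> v)) \<in> G" using g by (auto simp: G_def)
      have gv: "g v \<in> carrier_mat (\<alpha> v) (\<alpha> v)" "det (g v) \<noteq> 0" using g insert by (auto simp: G_def)
      have "K (\<lambda>u. if u \<in> insert v W then g u else 1\<^sub>m (\<alpha> u)) =
          K (\<lambda>u. \<delta> v (g v) u * (if u \<in> W then g u else 1\<^sub>m (\<alpha> u)))"
        by (rule cong) (use g insert in \<open>auto simp: G_def \<delta>_def\<close>)
      also have "\<dots> = K (\<delta> v (g v)) * K (\<lambda>u. if u \<in> W then g u else 1\<^sub>m (\<alpha> u))"
        by (rule mult[OF \<delta>G[OF gv] gW])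
      finally show ?case using insert s[OF _ gv] by simp
    qed (simp add: one)
    from this[of V] have "K (\<lambda>v. if v \<in> V then g v else 1\<^sub>m (\<alpha> v)) = (\<Prod>v\<in>V. det (g v) ^ s v)" by simp
    moreover have "K g = K (\<lambda>v. if v \<in> V then g v else 1\<^sub>m (\<alpha> v))" by (rule cong[OF g]) simp
    ultimately show ?thesis by simp
  qed
  then show ?thesis by blast
qed

section \<open>The two-sided action\<close>

text \<open>The summand \<open>Inr v\<close> is the additional loop \<open>x\<^sub>v\<close> at the vertex \<open>v\<close>.\<close>

definition ext_tail :: "('v, 'a) pre_digraph \<Rightarrow> 'a + 'v \<Rightarrow> 'v" where
  "ext_tail Q b = (case b of Inl a \<Rightarrow> tail Q a | Inr v \<Rightarrow> v)"

definition ext_head :: "('v, 'a) pre_digraph \<Rightarrow> 'a + 'v \<Rightarrow> 'v" where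
  "ext_head Q b = (case b of Inl a \<Rightarrow> head Q a | Inr v \<Rightarrow> v)"

definition ext_indices :: "('v, 'a) pre_digraph \<Rightarrow> ('v \<Rightarrow> nat) \<Rightarrow> (('a + 'v) \<times> nat \<times> nat) set" where
  "ext_indices Q \<alpha> = {(b, i, j). b \<in> arcs Q <+> verts Q \<and> i < \<alpha> (ext_tail Q b) \<and> j < \<alpha> (ext_head Q b)}"

text \<open>The point at which polynomials in the entries are evaluated. The value 0 off
  \<open>ext_indices\<close> makes it depend only on \<open>q\<close> over the arcs and on
  \<open>x\<close> over the vertices, so no extensionality is demanded of these families.\<close>

definition ext_entries :: "('v, 'a) pre_digraph \<Rightarrow> ('v \<Rightarrow> nat) \<Rightarrow> ('a \<Rightarrow> 'k::field mat) \<Rightarrow> ('v \<Rightarrow> 'k mat) \<Rightarrow>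
    ('a + 'v) \<times> nat \<times> nat \<Rightarrow> 'k" where
  "ext_entries Q \<alpha> q x = (\<lambda>(b, i, j). if (b, i, j) \<in> ext_indices Q \<alpha> then case_sum q x b $$ (i, j) else 0)"

text \<open>By Cramer, \<open>det (x v)\<close> times the inverse \<open>y v\<close> is the
  adjugate, which is polynomial in \<open>x v\<close>. A coordinate therefore costs one factor of
  the common determinant, and the exponents add under both sums and products.\<close>

lemma clear_denominators:
  fixes Q :: "('v, 'a) pre_digraph" and f :: "('a \<Rightarrow> 'k::field mat) \<Rightarrow> 'k"
  assumes Q: "fin_digraph Q" and f: "f \<in> coordinate_ring Q \<alpha>"
  shows "\<exists>m. \<exists>F\<in>range poly_eval. \<forall>q\<in>rep_space Q \<alpha>. \<forall>x y.
    (\<forall>v\<in>verts Q. x v \<in> carrier_mat (\<alpha> v) (\<alpha> v) \<and> y v \<in> carrier_mat (\<alpha> v) (\<alpha> v) \<and> x v * y v = 1\<^sub>m (\<alpha> v)) \<longrightarrow>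
    f (\<lambda>a\<in>arcs Q. q a * y (head Q a)) * (\<Prod>v\<in>verts Q. det (x v)) ^ m = F (ext_entries Q \<alpha> q x)"
proof -
  interpret fin_digraph Q by fact
  define inverses where "inverses x y \<longleftrightarrow> (\<forall>v\<in>verts Q. x v \<in> carrier_mat (\<alpha> v) (\<alpha> v) \<and>
      y v \<in> carrier_mat (\<alpha> v) (\<alpha> v) \<and> x v * y v = 1\<^sub>m (\<alpha> v))" for x y :: "'v \<Rightarrow> 'k mat"
  define act where "act q y = (\<lambda>a\<in>arcs Q. q a * y (head Q a))" for q :: "'a \<Rightarrow> 'k mat" and y
  define \<Delta> :: "('v \<Rightarrow> 'k mat) \<Rightarrow> 'k" where "\<Delta> x = (\<Prod>v\<in>verts Q. det (x v))" for x
  define X :: "'v \<Rightarrow> (('a + 'v) \<times> nat \<times> nat \<Rightarrow> 'k) \<Rightarrow> 'k mat"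
    where "X v z = mat (\<alpha> v) (\<alpha> v) (\<lambda>(i, j). z (Inr v, i, j))" for v z
  note alg = fun_algebra_poly_eval[where 'i = "('a + 'v) \<times> nat \<times> nat" and 'k = 'k]
  have act_in: "act q y \<in> rep_space Q \<alpha>" if "q \<in> rep_space Q \<alpha>" "inverses x y" for q x y
    using that head_in_verts by (fastforce simp: act_def rep_space_def inverses_def PiE_iff)
  have X_eq: "X v (ext_entries Q \<alpha> q x) = x v" if "inverses x y" "v \<in> verts Q" for v q x y
    using that by (intro eq_matI) (auto simp: X_def ext_entries_def ext_indices_def inverses_def
        ext_tail_def ext_head_def)
  have det_X: "(\<lambda>z. det (X v z)) \<in> range poly_eval" for v
    by (rule fun_algebra_det[OF alg, of _ "\<alpha> v"]) (auto simp: X_def intro: var_poly_eval)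
  define \<Delta>X where "\<Delta>X z = (\<Prod>v\<in>verts Q. det (X v z))" for z
  have \<Delta>X: "\<Delta>X \<in> range poly_eval" unfolding \<Delta>X_def by (intro fun_algebra_prod[OF alg] det_X)
  have \<Delta>X_eq: "\<Delta>X (ext_entries Q \<alpha> q x) = \<Delta> x" if "inverses x y" for q x y
    unfolding \<Delta>X_def \<Delta>_def by (intro prod.cong refl arg_cong[of _ _ det] X_eq[OF that])
  define good where "good f m F \<longleftrightarrow> (\<forall>q\<in>rep_space Q \<alpha>. \<forall>x y. inverses x y \<longrightarrow>
      f (act q y) * \<Delta> x ^ m = F (ext_entries Q \<alpha> q x))" for f :: "('a \<Rightarrow> 'k mat) \<Rightarrow> 'k" and m F
  have "\<exists>m. \<exists>F\<in>range poly_eval. good f m F"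
    using f unfolding coordinate_ring_def
  proof (induction rule: generated_algebra.induct)
    case (const c)
    show ?case
      by (rule exI[of _ 0], rule bexI[of _ "\<lambda>_. c"])
        (auto simp: good_def act_in intro: fun_algebra_const[OF alg])
  next
    case (generator h)
    then obtain a i j where h: "h = (\<lambda>p. p a $$ (i, j))" and a: "a \<in> arcs Q"
      and i: "i < \<alpha> (tail Q a)" and j: "j < \<alpha> (head Q a)" by blast
    define v where "v = head Q a"
    have v: "v \<in> verts Q" using a by (simp add: v_def)
    \<comment> \<open>The entry \<open>(i, j)\<close> of \<open>q a\<close> times the adjugate at
      the head of \<open>a\<close>. The determinants at the other vertices are included so that the
      denominator cleared is the same for all coordinates.\<close>
    define F where "F z = (\<Sum>k<\<alpha> v. z (Inl a, i, k) * cofactor (X v z) j k) * (\<Prod>u\<in>verts Q - {v}. det (X u z))" for z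
    have "F \<in> range poly_eval"
    proof -
      have "(\<lambda>z. det (mat_delete (X v z) j k)) \<in> range poly_eval" if "k < \<alpha> v" for k
      proof (rule fun_algebra_det[OF alg, of _ "\<alpha> v - 1"])
        fix i' j' assume "i' < \<alpha> v - 1" "j' < \<alpha> v - 1"
        then show "(\<lambda>z. mat_delete (X v z) j k $$ (i', j')) \<in> range poly_eval"
          by (simp add: mat_delete_def X_def var_poly_eval)
      qed (simp add: mat_delete_def X_def)
      then show ?thesis
        unfolding F_def[abs_def] cofactor_def
        by (intro fun_algebra_mult[OF alg] fun_algebra_sum[OF alg] fun_algebra_prod[OF alg]
            fun_algebra_const[OF alg] var_poly_eval det_X) auto
    qed
    moreover have "good (restrict h (rep_space Q \<alpha>)) 1 F"
      unfolding good_def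
    proof (intro ballI allI impI)
      fix q :: "'a \<Rightarrow> 'k mat" and x y assume q: "q \<in> rep_space Q \<alpha>" and xy: "inverses x y"
      have qa: "q a \<in> carrier_mat (\<alpha> (tail Q a)) (\<alpha> v)" using q a by (auto simp: rep_space_def v_def)
      have x: "x v \<in> carrier_mat (\<alpha> v) (\<alpha> v)" "y v \<in> carrier_mat (\<alpha> v) (\<alpha> v)" "x v * y v = 1\<^sub>m (\<alpha> v)"
        using xy v by (auto simp: inverses_def)
      have "adj_mat (x v) = adj_mat (x v) * (x v * y v)" using adj_mat(1)[OF x(1)] x(3) by simp
      also have "\<dots> = (adj_mat (x v) * x v) * y v" using adj_mat(1)[OF x(1)] x by (simp add: assoc_mult_mat)
      also have "\<dots> = det (x v) \<cdot>\<^sub>m y v" using adj_mat(3)[OF x(1)] x(2)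
        by (simp add: mult_smult_assoc_mat[of _ "\<alpha> v" "\<alpha> v"])
      finally have adj: "adj_mat (x v) = det (x v) \<cdot>\<^sub>m y v" .
      have yk: "det (x v) * y v $$ (k, j) = cofactor (x v) j k" if "k < \<alpha> v" for k
        using arg_cong[OF adj, of "\<lambda>M. M $$ (k, j)"] that j x by (simp add: adj_mat_def v_def)
      have qy: "(q a * y v) $$ (i, j) = (\<Sum>k<\<alpha> v. q a $$ (i, k) * y v $$ (k, j))"
        using qa x i j by (simp add: scalar_prod_def v_def lessThan_atLeast0)
      have \<Delta>x: "\<Delta> x = det (x v) * (\<Prod>u\<in>verts Q - {v}. det (x u))"
        unfolding \<Delta>_def by (rule prod.remove) (use v in auto)
      have "restrict h (rep_space Q \<alpha>) (act q y) = (q a * y v) $$ (i, j)"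
        using act_in[OF q xy] a by (simp add: h act_def v_def)
      then have "restrict h (rep_space Q \<alpha>) (act q y) * \<Delta> x ^ 1 =
          (\<Sum>k<\<alpha> v. q a $$ (i, k) * y v $$ (k, j)) * (det (x v) * (\<Prod>u\<in>verts Q - {v}. det (x u)))"
        by (simp only: qy \<Delta>x power_one_right)
      also have "(\<Sum>k<\<alpha> v. q a $$ (i, k) * y v $$ (k, j)) * (det (x v) * (\<Prod>u\<in>verts Q - {v}. det (x u))) =
          (\<Sum>k<\<alpha> v. q a $$ (i, k) * cofactor (x v) j k) * (\<Prod>u\<in>verts Q - {v}. det (x u))"
        unfolding mult.assoc[symmetric] sum_distrib_right
        by (intro sum.cong refl) (simp add: yk[symmetric] mult_ac)
      also have "\<dots> = F (ext_entries Q \<alpha> q x)"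
      proof -
        have "ext_entries Q \<alpha> q x (Inl a, i, k) = q a $$ (i, k)" if "k < \<alpha> v" for k
          using that a i by (auto simp: ext_entries_def ext_indices_def ext_tail_def ext_head_def v_def)
        then show ?thesis unfolding F_def using X_eq[OF xy] v by simp
      qed
      finally show "restrict h (rep_space Q \<alpha>) (act q y) * \<Delta> x ^ 1 = F (ext_entries Q \<alpha> q x)" .
    qed
    ultimately show ?case by blast
  next
    case (add f h)
    then obtain m F m' F' where F: "F \<in> range poly_eval" "good f m F" "F' \<in> range poly_eval" "good h m' F'" by blast
    \<comment> \<open>Each summand is multiplied by the power of the determinant with which the
      other one was cleared.\<close>
    have "good (\<lambda>x\<in>rep_space Q \<alpha>. f x + h x) (m + m') (\<lambda>z. F z * \<Delta>X z ^ m' + F' z * \<Delta>X z ^ m)"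
      unfolding good_def
    proof (intro ballI allI impI)
      fix q :: "'a \<Rightarrow> 'k mat" and x y assume q: "q \<in> rep_space Q \<alpha>" and xy: "inverses x y"
      have "F (ext_entries Q \<alpha> q x) = f (act q y) * \<Delta> x ^ m" "F' (ext_entries Q \<alpha> q x) = h (act q y) * \<Delta> x ^ m'"
        using F q xy by (auto simp: good_def)
      then show "(\<lambda>x\<in>rep_space Q \<alpha>. f x + h x) (act q y) * \<Delta> x ^ (m + m') =
          F (ext_entries Q \<alpha> q x) * \<Delta>X (ext_entries Q \<alpha> q x) ^ m' + F' (ext_entries Q \<alpha> q x) * \<Delta>X (ext_entries Q \<alpha> q x) ^ m"
        using act_in[OF q xy] \<Delta>X_eq[OF xy] by (simp add: power_add algebra_simps)
    qed
    moreover have "(\<lambda>z. F z * \<Delta>X z ^ m' + F' z * \<Delta>X z ^ m) \<in> range poly_eval"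
      by (intro fun_algebra_add[OF alg] fun_algebra_mult[OF alg] fun_algebra_power[OF alg] F \<Delta>X)
    ultimately show ?case by blast
  next
    case (mult f h)
    then obtain m F m' F' where F: "F \<in> range poly_eval" "good f m F" "F' \<in> range poly_eval" "good h m' F'" by blast
    have "good (\<lambda>x\<in>rep_space Q \<alpha>. f x * h x) (m + m') (\<lambda>z. F z * F' z)"
      unfolding good_def
    proof (intro ballI allI impI)
      fix q :: "'a \<Rightarrow> 'k mat" and x y assume q: "q \<in> rep_space Q \<alpha>" and xy: "inverses x y"
      have "F (ext_entries Q \<alpha> q x) = f (act q y) * \<Delta> x ^ m" "F' (ext_entries Q \<alpha> q x) = h (act q y) * \<Delta> x ^ m'"
        using F q xy by (auto simp: good_def)
      then show "(\<lambda>x\<in>rep_space Q \<alpha>. f x * h x) (act q y) * \<Delta> x ^ (m + m') =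
          F (ext_entries Q \<alpha> q x) * F' (ext_entries Q \<alpha> q x)"
        using act_in[OF q xy] by (simp add: power_add mult_ac)
    qed
    moreover have "(\<lambda>z. F z * F' z) \<in> range poly_eval"
      by (intro fun_algebra_mult[OF alg] F)
    ultimately show ?case by blast
  qed
  then show ?thesis unfolding good_def inverses_def act_def \<Delta>_def by blast
qed

section \<open>The group \<open>Gl(\<alpha>)\<close> as families of invertible matrices\<close>

lemma gl_group_carrier:
  "carrier (gl_group Q \<alpha> :: ('v \<Rightarrow> 'k::field mat) monoid) =
    (\<Pi>\<^sub>E v\<in>verts Q. {A \<in> carrier_mat (\<alpha> v) (\<alpha> v). det A \<noteq> 0})"
proof -
  have "Units (ring_mat TYPE('k) n ()) = {A \<in> carrier_mat n n. det A \<noteq> 0}" for n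
    using det_non_zero_imp_unit[of _ n] unit_imp_det_non_zero[of _ n]
    by (auto simp: Units_def ring_mat_def)
  then show ?thesis by (simp add: gl_group_def units_of_def)
qed

lemma group_units_ring_mat: "Group.group (units_of (ring_mat TYPE('k::field) n ()))"
proof -
  interpret ring "ring_mat TYPE('k) n ()" by (rule ring_mat)
  show ?thesis by (rule units_group)
qed

lemma group_gl_group: "Group.group (gl_group Q \<alpha> :: ('v \<Rightarrow> 'k::field mat) monoid)"
  unfolding gl_group_def by (rule product_group) (rule group_units_ring_mat)

lemma gl_group_mult: "g \<otimes>\<^bsub>gl_group Q \<alpha>\<^esub> h = (\<lambda>v\<in>verts Q. g v * h v)"
  by (simp add: gl_group_def units_of_def ring_mat_def)

lemma gl_group_one: "\<one>\<^bsub>gl_group Q \<alpha>\<^esub> = (\<lambda>v\<in>verts Q. 1\<^sub>m (\<alpha> v))"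
  by (simp add: gl_group_def units_of_def ring_mat_def)

text \<open>Setting \<open>q = g p h\<close> and \<open>x = g h\<close> turns the conjugation action into two independent actions,
  polynomial in \<open>g\<close> and \<open>h\<close> once denominators are cleared.\<close>

lemma semi_invariant_two_sided:
  fixes Q :: "('v, 'a) pre_digraph" and f :: "('a \<Rightarrow> 'k::field_char_0 mat) \<Rightarrow> 'k"
  assumes Q: "fin_digraph Q" and f: "semi_invariant Q \<alpha> f"
    and nz: "p\<^sub>0 \<in> rep_space Q \<alpha>" "f p\<^sub>0 \<noteq> 0"
  shows "\<exists>m s. \<exists>F\<in>range poly_eval. \<forall>p\<in>rep_space Q \<alpha>. \<forall>g h.
    (\<forall>v\<in>verts Q. g v \<in> carrier_mat (\<alpha> v) (\<alpha> v) \<and> det (g v) \<noteq> 0) \<longrightarrow>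
    (\<forall>v\<in>verts Q. h v \<in> carrier_mat (\<alpha> v) (\<alpha> v) \<and> det (h v) \<noteq> 0) \<longrightarrow>
    f p * (\<Prod>v\<in>verts Q. det (g v) ^ s v) * (\<Prod>v\<in>verts Q. det (h v) ^ m) =
      F (ext_entries Q \<alpha> (\<lambda>a. g (tail Q a) * p a * h (head Q a)) (\<lambda>v. g v * h v))"
proof -
  interpret fin_digraph Q by fact
  define V where "V = verts Q"
  define GL where "GL = (gl_group Q \<alpha> :: ('v \<Rightarrow> 'k mat) monoid)"
  interpret GL: Group.group GL unfolding GL_def by (rule group_gl_group)
  define G where "G = {g :: 'v \<Rightarrow> 'k mat. \<forall>v\<in>V. g v \<in> carrier_mat (\<alpha> v) (\<alpha> v) \<and> det (g v) \<noteq> 0}"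
  obtain \<psi> where fc: "f \<in> coordinate_ring Q \<alpha>" and \<psi>: "\<psi> \<in> hom GL multiplicative_group"
    and weight: "\<And>g. g \<in> carrier GL \<Longrightarrow> gl_act_fun Q \<alpha> g f = (\<lambda>p\<in>rep_space Q \<alpha>. \<psi> g * f p)"
    using f unfolding semi_invariant_def semi_invariant_of_weight_def gl_characters_def GL_def by auto
  have GL_carrier: "carrier GL = (\<Pi>\<^sub>E v\<in>V. {A \<in> carrier_mat (\<alpha> v) (\<alpha> v). det A \<noteq> 0})"
    by (simp add: GL_def V_def gl_group_carrier)
  have restr: "restrict g V \<in> carrier GL" if "g \<in> G" for g
    using that by (auto simp: GL_carrier G_def)
  \<comment> \<open>The weight is defined through the action of the inverse of \<open>g\<close> on
    points. Composing with inversion gives the factor by which \<open>f\<close> changes under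
    \<open>p\<close> going to \<open>g p\<close>.\<close>
  define \<chi> where "\<chi> g = \<psi> (inv\<^bsub>GL\<^esub> (restrict g V))" for g
  have \<psi>_mult: "\<psi> (g \<otimes>\<^bsub>GL\<^esub> h) = \<psi> g * \<psi> h" "\<psi> g \<noteq> 0" if "g \<in> carrier GL" "h \<in> carrier GL" for g h
    using hom_mult[OF \<psi> that] hom_in_carrier[OF \<psi> that(1)] by (auto simp: multiplicative_group_def)
  have "\<psi> \<one>\<^bsub>GL\<^esub> * 1 = \<psi> \<one>\<^bsub>GL\<^esub> * \<psi> \<one>\<^bsub>GL\<^esub>" "\<psi> \<one>\<^bsub>GL\<^esub> \<noteq> 0"
    using \<psi>_mult(1)[OF GL.one_closed GL.one_closed] \<psi>_mult(2)[OF GL.one_closed GL.one_closed]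
    by (simp_all only: GL.l_one GL.one_closed mult_1_right not_False_eq_True)
  then have \<psi>_one: "\<psi> \<one>\<^bsub>GL\<^esub> = 1" by (simp only: mult_cancel_left) simp
  obtain m F where F: "F \<in> range poly_eval" and mF: "\<And>q x y. q \<in> rep_space Q \<alpha> \<Longrightarrow>
      (\<And>v. v \<in> V \<Longrightarrow> x v \<in> carrier_mat (\<alpha> v) (\<alpha> v) \<and> y v \<in> carrier_mat (\<alpha> v) (\<alpha> v) \<and> x v * y v = 1\<^sub>m (\<alpha> v)) \<Longrightarrow>
      f (\<lambda>a\<in>arcs Q. q a * y (head Q a)) * (\<Prod>v\<in>V. det (x v)) ^ m = F (ext_entries Q \<alpha> q x)"
  proof -
    obtain m F where F: "F \<in> range poly_eval" and raw: "\<forall>q\<in>rep_space Q \<alpha>. \<forall>x y.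
      (\<forall>v\<in>verts Q. x v \<in> carrier_mat (\<alpha> v) (\<alpha> v) \<and> y v \<in> carrier_mat (\<alpha> v) (\<alpha> v) \<and> x v * y v = 1\<^sub>m (\<alpha> v)) \<longrightarrow>
      f (\<lambda>a\<in>arcs Q. q a * y (head Q a)) * (\<Prod>v\<in>verts Q. det (x v)) ^ m = F (ext_entries Q \<alpha> q x)"
      using clear_denominators[OF Q fc] by (elim exE bexE)
    show thesis
    proof (rule that[OF F])
      fix q :: "'a \<Rightarrow> 'k mat" and x y :: "'v \<Rightarrow> 'k mat" assume "q \<in> rep_space Q \<alpha>"
        "\<And>v. v \<in> V \<Longrightarrow> x v \<in> carrier_mat (\<alpha> v) (\<alpha> v) \<and> y v \<in> carrier_mat (\<alpha> v) (\<alpha> v) \<and> x v * y v = 1\<^sub>m (\<alpha> v)"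
      then show "f (\<lambda>a\<in>arcs Q. q a * y (head Q a)) * (\<Prod>v\<in>V. det (x v)) ^ m = F (ext_entries Q \<alpha> q x)"
        using raw[rule_format, of q x y] by (simp add: V_def)
    qed
  qed
  define \<Delta> where "\<Delta> g = (\<Prod>v\<in>V. det (g v))" for g :: "'v \<Rightarrow> 'k mat"
  have \<Delta>_mult: "\<Delta> (\<lambda>v. g v * h v) = \<Delta> g * \<Delta> h" if "g \<in> G" "h \<in> G" for g h
    unfolding \<Delta>_def prod.distrib[symmetric]
    by (rule prod.cong) (use that in \<open>auto simp: G_def intro: det_mult\<close>)
  have key: "f p * (\<chi> g * \<Delta> g ^ m) * \<Delta> h ^ m =
      F (ext_entries Q \<alpha> (\<lambda>a. g (tail Q a) * p a * h (head Q a)) (\<lambda>v. g v * h v))"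
    if p: "p \<in> rep_space Q \<alpha>" and g: "g \<in> G" and h: "h \<in> G" for p g h
  proof -
    define g' where "g' = inv\<^bsub>GL\<^esub> (restrict g V)"
    define h' where "h' = inv\<^bsub>GL\<^esub> (restrict h V)"
    have inv_carrier: "g' \<in> carrier GL" "h' \<in> carrier GL" using restr g h by (auto simp: g'_def h'_def)
    have inv_mult: "g v * g' v = 1\<^sub>m (\<alpha> v)" "h v * h' v = 1\<^sub>m (\<alpha> v)" if "v \<in> V" for v
    proof -
      have "restrict g V \<otimes>\<^bsub>GL\<^esub> g' = \<one>\<^bsub>GL\<^esub>" "restrict h V \<otimes>\<^bsub>GL\<^esub> h' = \<one>\<^bsub>GL\<^esub>"
        using GL.r_inv restr g h by (auto simp: g'_def h'_def)
      then have "(restrict g V \<otimes>\<^bsub>GL\<^esub> g') v = 1\<^sub>m (\<alpha> v)" "(restrict h V \<otimes>\<^bsub>GL\<^esub> h') v = 1\<^sub>m (\<alpha> v)"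
        using that by (simp_all add: GL_def gl_group_one V_def)
      then show "g v * g' v = 1\<^sub>m (\<alpha> v)" "h v * h' v = 1\<^sub>m (\<alpha> v)"
        using that by (simp_all add: GL_def gl_group_mult V_def)
    qed
    have carr: "g v \<in> carrier_mat (\<alpha> v) (\<alpha> v)" "h v \<in> carrier_mat (\<alpha> v) (\<alpha> v)"
        "g' v \<in> carrier_mat (\<alpha> v) (\<alpha> v)" "h' v \<in> carrier_mat (\<alpha> v) (\<alpha> v)" if "v \<in> V" for v
      using that g h inv_carrier by (auto simp: G_def GL_carrier)
    have pa: "p a \<in> carrier_mat (\<alpha> (tail Q a)) (\<alpha> (head Q a))" and ta: "tail Q a \<in> V" and ha: "head Q a \<in> V"
      if "a \<in> arcs Q" for a
      using p that by (auto simp: rep_space_def V_def)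
    define q where "q = (\<lambda>a\<in>arcs Q. g (tail Q a) * p a * h (head Q a))"
    have q: "q \<in> rep_space Q \<alpha>"
      unfolding q_def rep_space_def
      by (intro restrict_PiE_iff[THEN iffD2] ballI mult_carrier_mat) (auto intro: carr pa ta ha)
    have "f (\<lambda>a\<in>arcs Q. q a * (h' (head Q a) * g' (head Q a))) * (\<Prod>v\<in>V. det (g v * h v)) ^ m =
        F (ext_entries Q \<alpha> q (\<lambda>v. g v * h v))"
    proof (rule mF[OF q])
      fix v assume v: "v \<in> V"
      have "(g v * h v) * (h' v * g' v) = g v * ((h v * h' v) * g' v)"
        using carr[OF v] by (simp add: assoc_mult_mat[of _ "\<alpha> v" "\<alpha> v" _ "\<alpha> v" _ "\<alpha> v"] mult_carrier_mat[of _ "\<alpha> v" "\<alpha> v" _ "\<alpha> v"])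
      also have "\<dots> = 1\<^sub>m (\<alpha> v)" using inv_mult[OF v] carr[OF v] by simp
      finally show "g v * h v \<in> carrier_mat (\<alpha> v) (\<alpha> v) \<and> h' v * g' v \<in> carrier_mat (\<alpha> v) (\<alpha> v) \<and>
          g v * h v * (h' v * g' v) = 1\<^sub>m (\<alpha> v)"
        using carr[OF v] by (auto intro: mult_carrier_mat)
    qed
    \<comment> \<open>The inverse of \<open>g h\<close> at the head of an arrow cancels
      \<open>h\<close> and leaves the conjugate of \<open>p\<close> by \<open>g\<close>. Thus
      \<open>h\<close> survives only in the determinant factor.\<close>
    also have "(\<lambda>a\<in>arcs Q. q a * (h' (head Q a) * g' (head Q a))) = gl_act Q \<alpha> (inv\<^bsub>GL\<^esub> g') p"
    proof -
      have "inv\<^bsub>GL\<^esub> g' = restrict g V" unfolding g'_def using restr[OF g] by (rule GL.inv_inv)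
      then have "gl_act Q \<alpha> (inv\<^bsub>GL\<^esub> g') p = (\<lambda>a\<in>arcs Q. g (tail Q a) * p a * g' (head Q a))"
        using ta GL.inv_inv[OF inv_carrier(1)] by (auto simp: gl_act_def GL_def[symmetric] fun_eq_iff)
      moreover have "q a * (h' (head Q a) * g' (head Q a)) = g (tail Q a) * p a * g' (head Q a)" if a: "a \<in> arcs Q" for a
      proof -
        let ?t = "\<alpha> (tail Q a)" and ?h = "\<alpha> (head Q a)"
        have gp: "g (tail Q a) * p a \<in> carrier_mat ?t ?h"
          using carr(1)[OF ta[OF a]] pa[OF a] by (rule mult_carrier_mat)
        note hh = carr(2,3,4)[OF ha[OF a]]
        have "(g (tail Q a) * p a * h (head Q a)) * (h' (head Q a) * g' (head Q a)) =
            (g (tail Q a) * p a) * (h (head Q a) * (h' (head Q a) * g' (head Q a)))"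
          by (rule assoc_mult_mat[OF gp hh(1) mult_carrier_mat[OF hh(3,2)]])
        also have "h (head Q a) * (h' (head Q a) * g' (head Q a)) = (h (head Q a) * h' (head Q a)) * g' (head Q a)"
          by (rule assoc_mult_mat[OF hh(1,3,2), symmetric])
        also have "\<dots> = g' (head Q a)" using inv_mult(2)[OF ha[OF a]] hh by simp
        finally show ?thesis using a by (simp add: q_def)
      qed
      ultimately show ?thesis by (auto simp: fun_eq_iff)
    qed
    also have "f (gl_act Q \<alpha> (inv\<^bsub>GL\<^esub> g') p) = \<chi> g * f p"
      using fun_cong[OF weight[OF inv_carrier(1)], of p] p
      by (simp add: gl_act_fun_def GL_def[symmetric] \<chi>_def g'_def)
    also have "(\<Prod>v\<in>V. det (g v * h v)) = \<Delta> g * \<Delta> h"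
      using \<Delta>_mult[OF g h] by (simp add: \<Delta>_def)
    also have "ext_entries Q \<alpha> q (\<lambda>v. g v * h v) =
        ext_entries Q \<alpha> (\<lambda>a. g (tail Q a) * p a * h (head Q a)) (\<lambda>v. g v * h v)"
      by (auto simp: ext_entries_def ext_indices_def fun_eq_iff q_def split: sum.splits)
    finally show ?thesis by (simp add: power_mult_distrib mult_ac)
  qed
  define one where "one = (\<lambda>v. 1\<^sub>m (\<alpha> v) :: 'k mat)"
  have one: "one \<in> G" by (simp add: one_def G_def)
  have \<Delta>_one: "\<Delta> one = 1" by (simp add: \<Delta>_def one_def)
  \<comment> \<open>The full factor contributed by \<open>g\<close> in \<open>key\<close>: the
    weight, corrected by the power of the determinant that cleared denominators.\<close>
  define K where "K g = \<chi> g * \<Delta> g ^ m" for g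
  have "\<exists>s. \<forall>g\<in>{g. \<forall>v\<in>V. g v \<in> carrier_mat (\<alpha> v) (\<alpha> v) \<and> det (g v) \<noteq> 0}.
      K g = (\<Prod>v\<in>V. det (g v) ^ s v)"
  proof (rule gl_family_character)
    show "finite V" by (simp add: V_def)
  next
    fix g h :: "'v \<Rightarrow> 'k mat"
    assume "g \<in> {g. \<forall>v\<in>V. g v \<in> carrier_mat (\<alpha> v) (\<alpha> v) \<and> det (g v) \<noteq> 0}"
      "h \<in> {g. \<forall>v\<in>V. g v \<in> carrier_mat (\<alpha> v) (\<alpha> v) \<and> det (g v) \<noteq> 0}"
    then have gh: "g \<in> G" "h \<in> G" by (auto simp: G_def)
    have "restrict (\<lambda>v. g v * h v) V = restrict g V \<otimes>\<^bsub>GL\<^esub> restrict h V"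
      by (auto simp: GL_def gl_group_mult V_def)
    then have "\<chi> (\<lambda>v. g v * h v) = \<chi> g * \<chi> h"
      using restr gh by (simp add: \<chi>_def GL.inv_mult_group \<psi>_mult)
    then show "K (\<lambda>v. g v * h v) = K g * K h"
      using \<Delta>_mult[OF gh] by (simp add: K_def power_mult_distrib mult_ac)
  next
    fix g h :: "'v \<Rightarrow> 'k mat" assume "\<And>v. v \<in> V \<Longrightarrow> g v = h v"
    then have "restrict g V = restrict h V" "\<Delta> g = \<Delta> h" by (auto simp: \<Delta>_def)
    then show "K g = K h" by (simp add: K_def \<chi>_def)
  next
    have "restrict one V = \<one>\<^bsub>GL\<^esub>" by (simp add: one_def GL_def gl_group_one V_def)
    then have "\<chi> one = 1" by (simp add: \<chi>_def \<psi>_one)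
    then show "K (\<lambda>v. 1\<^sub>m (\<alpha> v)) = 1" using \<Delta>_one by (simp add: K_def one_def)
  next
    fix v assume v: "v \<in> V"
    define \<delta> where "\<delta> x = (\<lambda>w. 1\<^sub>m (\<alpha> w))(v := corner_mat (\<alpha> v) x)" for x :: 'k
    define z where "z x = ext_entries Q \<alpha> (\<lambda>a. \<delta> x (tail Q a) * p\<^sub>0 a * one (head Q a)) (\<lambda>v. \<delta> x v * one v)" for x
    have \<delta>c: "\<delta> x w \<in> carrier_mat (\<alpha> w) (\<alpha> w)" for x w by (simp add: \<delta>_def)
    have \<delta>poly: "(\<lambda>x. \<delta> x w $$ (i, j)) \<in> range poly" if "i < \<alpha> w" "j < \<alpha> w" for w i j
      using that by (cases "w = v"; cases "i = j"; cases "i = 0")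
        (auto simp: \<delta>_def corner_mat_def intro: id_range_poly fun_algebra_const[OF fun_algebra_poly])
    have "(\<lambda>x. z x bij) \<in> range poly" for bij
    proof -
      obtain b i j where bij: "bij = (b, i, j)" by (metis prod_cases3)
      show ?thesis
      proof (cases "(b, i, j) \<in> ext_indices Q \<alpha>")
        case False
        then show ?thesis by (simp add: z_def bij ext_entries_def fun_algebra_const[OF fun_algebra_poly])
      next
        case idx: True
        show ?thesis
        proof (cases b)
          case (Inl a)
          then have a: "a \<in> arcs Q" and i: "i < \<alpha> (tail Q a)" and j: "j < \<alpha> (head Q a)"
            using idx by (auto simp: ext_indices_def ext_tail_def ext_head_def)
          have pa: "p\<^sub>0 a \<in> carrier_mat (\<alpha> (tail Q a)) (\<alpha> (head Q a))" using nz(1) a by (auto simp: rep_space_def)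
          have "z x bij = (\<Sum>k = 0..<\<alpha> (tail Q a). \<delta> x (tail Q a) $$ (i, k) * p\<^sub>0 a $$ (k, j))" for x
          proof -
            have "\<delta> x (tail Q a) * p\<^sub>0 a \<in> carrier_mat (\<alpha> (tail Q a)) (\<alpha> (head Q a))"
              using \<delta>c pa by (rule mult_carrier_mat)
            from right_mult_one_mat[OF this] have "z x bij = (\<delta> x (tail Q a) * p\<^sub>0 a) $$ (i, j)"
              using idx by (simp add: z_def bij ext_entries_def Inl one_def)
            also have "\<dots> = (\<Sum>k = 0..<\<alpha> (tail Q a). \<delta> x (tail Q a) $$ (i, k) * p\<^sub>0 a $$ (k, j))"
              using \<delta>c[of x "tail Q a"] pa i j by (simp add: scalar_prod_def)
            finally show ?thesis .
          qed
          then show ?thesis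
            using i by (auto intro!: fun_algebra_sum[OF fun_algebra_poly] fun_algebra_mult[OF fun_algebra_poly]
                fun_algebra_const[OF fun_algebra_poly] \<delta>poly)
        next
          case (Inr w)
          then have w: "w \<in> V" and i: "i < \<alpha> w" and j: "j < \<alpha> w"
            using idx by (auto simp: ext_indices_def ext_tail_def ext_head_def V_def)
          have "z x bij = \<delta> x w $$ (i, j)" for x
            using idx \<delta>c[of x w] by (simp add: z_def bij ext_entries_def Inr one_def)
          then show ?thesis using \<delta>poly[OF i j] by simp
        qed
      qed
    qed
    moreover obtain ws where "F = poly_eval ws" using F by auto
    ultimately have "(\<lambda>x. F (z x)) \<in> range poly"
      using poly_eval_in_fun_algebra[OF fun_algebra_poly, of z ws] by simp
    then have "(\<lambda>x. inverse (f p\<^sub>0) * F (z x)) \<in> range poly"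
      by (intro fun_algebra_mult[OF fun_algebra_poly] fun_algebra_const[OF fun_algebra_poly])
    \<comment> \<open>At the point \<open>p\<^sub>0\<close> with \<open>h\<close> the identity,
      \<open>key\<close> says that \<open>f p\<^sub>0 * K g\<close> is a polynomial in the entries
      of \<open>g\<close>. Dividing by the nonzero value makes \<open>K\<close> polynomial along the
      corner matrices.\<close>
    moreover have "K (\<delta> x) = inverse (f p\<^sub>0) * F (z x)" if "x \<noteq> 0" for x
    proof -
      have "\<delta> x \<in> G" using that by (auto simp: G_def \<delta>_def det_corner_mat_nonzero)
      from key[OF nz(1) this one] show ?thesis using nz(2) \<Delta>_one by (simp add: K_def z_def field_simps)
    qed
    ultimately show "\<exists>f\<in>range poly. \<forall>x. x \<noteq> 0 \<longrightarrow> K ((\<lambda>w. 1\<^sub>m (\<alpha> w))(v := corner_mat (\<alpha> v) x)) = f x"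
      unfolding \<delta>_def[symmetric] by (intro bexI[of _ "\<lambda>x. inverse (f p\<^sub>0) * F (z x)"]) auto
  qed
  then obtain s where s: "\<And>g. g \<in> G \<Longrightarrow> K g = (\<Prod>v\<in>V. det (g v) ^ s v)"
    unfolding G_def by auto
  have "f p * (\<Prod>v\<in>V. det (g v) ^ s v) * (\<Prod>v\<in>V. det (h v) ^ m) =
      F (ext_entries Q \<alpha> (\<lambda>a. g (tail Q a) * p a * h (head Q a)) (\<lambda>v. g v * h v))"
    if "p \<in> rep_space Q \<alpha>" "g \<in> G" "h \<in> G" for p g h
    using key[OF that] s[OF that(2)] by (simp add: K_def \<Delta>_def prod_power_distrib)
  then show ?thesis
    by (intro exI[of _ m] exI[of _ s] bexI[OF _ F] ballI allI impI) (simp add: G_def V_def)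
qed

section \<open>Block-diagonal matrices\<close>

text \<open>Blocks are identified by their place in the list, not by their vertex, since a vertex
  may occur several times.\<close>

definition block_of :: "('v \<Rightarrow> nat) \<Rightarrow> 'v list \<Rightarrow> nat \<Rightarrow> nat" where
  "block_of \<alpha> xs r = fst (block_indices \<alpha> xs ! r)"

definition pos_of :: "('v \<Rightarrow> nat) \<Rightarrow> 'v list \<Rightarrow> nat \<Rightarrow> nat" where
  "pos_of \<alpha> xs r = snd (block_indices \<alpha> xs ! r)"

definition vertex_of :: "('v \<Rightarrow> nat) \<Rightarrow> 'v list \<Rightarrow> nat \<Rightarrow> 'v" where
  "vertex_of \<alpha> xs r = xs ! block_of \<alpha> xs r"

abbreviation total_dim :: "('v \<Rightarrow> nat) \<Rightarrow> 'v list \<Rightarrow> nat" where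
  "total_dim \<alpha> xs \<equiv> sum_list (map \<alpha> xs)"

lemma set_block_indices: "set (block_indices \<alpha> xs) = {(i, s). i < length xs \<and> s < \<alpha> (xs ! i)}"
  by (auto simp: block_indices_def)

lemma block_indices_Cons:
  "block_indices \<alpha> (x # xs) = map (Pair 0) [0..<\<alpha> x] @ map (\<lambda>(i, s). (Suc i, s)) (block_indices \<alpha> xs)"
  by (simp add: block_indices_def upt_conv_Cons map_Suc_upt[symmetric] map_concat comp_def del: upt_Suc)

lemma distinct_block_indices: "distinct (block_indices \<alpha> xs)"
proof (induction xs)
  case Nil
  then show ?case by (simp add: block_indices_def)
next
  case (Cons x xs)
  then show ?case
    by (auto simp: block_indices_Cons distinct_map inj_on_def)
qed

lemma block_of_bounds:
  assumes "r < total_dim \<alpha> xs"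
  shows "block_of \<alpha> xs r < length xs" "pos_of \<alpha> xs r < \<alpha> (vertex_of \<alpha> xs r)"
    "vertex_of \<alpha> xs r \<in> set xs"
proof -
  have "block_indices \<alpha> xs ! r \<in> set (block_indices \<alpha> xs)"
    using assms by (simp add: length_block_indices)
  then show "block_of \<alpha> xs r < length xs" "pos_of \<alpha> xs r < \<alpha> (vertex_of \<alpha> xs r)"
    "vertex_of \<alpha> xs r \<in> set xs"
    unfolding set_block_indices block_of_def pos_of_def vertex_of_def by (auto simp: case_prod_unfold)
qed

lemma block_pos_inj:
  assumes "r < total_dim \<alpha> xs" "r' < total_dim \<alpha> xs"
    "block_of \<alpha> xs r = block_of \<alpha> xs r'" "pos_of \<alpha> xs r = pos_of \<alpha> xs r'"
  shows "r = r'"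
proof -
  have "block_indices \<alpha> xs ! r = block_indices \<alpha> xs ! r'"
    using assms(3,4) by (simp add: block_of_def pos_of_def prod_eq_iff)
  then show ?thesis
    using assms(1,2) distinct_block_indices[of \<alpha> xs]
    by (simp add: nth_eq_iff_index_eq length_block_indices)
qed

lemma block_of_Cons:
  "r < \<alpha> x \<Longrightarrow> block_of \<alpha> (x # xs) r = 0" "r < \<alpha> x \<Longrightarrow> pos_of \<alpha> (x # xs) r = r"
  "r < \<alpha> x \<Longrightarrow> vertex_of \<alpha> (x # xs) r = x"
  "\<alpha> x \<le> r \<Longrightarrow> r < \<alpha> x + total_dim \<alpha> xs \<Longrightarrow> block_of \<alpha> (x # xs) r = Suc (block_of \<alpha> xs (r - \<alpha> x))"
  "\<alpha> x \<le> r \<Longrightarrow> r < \<alpha> x + total_dim \<alpha> xs \<Longrightarrow> pos_of \<alpha> (x # xs) r = pos_of \<alpha> xs (r - \<alpha> x)"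
  "\<alpha> x \<le> r \<Longrightarrow> r < \<alpha> x + total_dim \<alpha> xs \<Longrightarrow> vertex_of \<alpha> (x # xs) r = vertex_of \<alpha> xs (r - \<alpha> x)"
  by (auto simp: block_of_def pos_of_def vertex_of_def block_indices_Cons nth_append
      length_block_indices case_prod_unfold)

abbreviation list_block_diag :: "('v \<Rightarrow> nat) \<Rightarrow> 'v list \<Rightarrow> ('v \<Rightarrow> nat \<Rightarrow> nat \<Rightarrow> 'k::comm_ring_1) \<Rightarrow> 'k mat" where
  "list_block_diag \<alpha> xs \<equiv> block_diag (block_of \<alpha> xs) (vertex_of \<alpha> xs) (pos_of \<alpha> xs) (total_dim \<alpha> xs)"

lemma det_list_block_diag:
  fixes \<gamma> :: "'v \<Rightarrow> nat \<Rightarrow> nat \<Rightarrow> 'k::field"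
  shows "det (list_block_diag \<alpha> xs \<gamma>) =
    prod_list (map (\<lambda>v. det (mat (\<alpha> v) (\<alpha> v) (\<lambda>(i, j). \<gamma> v i j))) xs)"
proof (induction xs)
  case Nil
  then show ?case by (simp add: block_diag_def)
next
  case (Cons x xs)
  have "list_block_diag \<alpha> (x # xs) \<gamma> = four_block_mat (mat (\<alpha> x) (\<alpha> x) (\<lambda>(i, j). \<gamma> x i j))
      (0\<^sub>m (\<alpha> x) (total_dim \<alpha> xs)) (0\<^sub>m (total_dim \<alpha> xs) (\<alpha> x)) (list_block_diag \<alpha> xs \<gamma>)"
    by (rule eq_matI) (auto simp: block_diag_def four_block_mat_def Let_def block_of_Cons not_less)
  then have "det (list_block_diag \<alpha> (x # xs) \<gamma>) =
      det (mat (\<alpha> x) (\<alpha> x) (\<lambda>(i, j). \<gamma> x i j)) * det (list_block_diag \<alpha> xs \<gamma>)"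
    by (simp only:) (rule det_four_block_mat_upper_right_zero, auto simp: block_diag_def)
  then show ?case by (simp add: Cons.IH)
qed

text \<open>Encodes a weight as an object of \<open>add(Q)\<close>: \<open>v\<close> is repeated
  \<open>s v\<close> times. The lists obtained here become the source and the target of the maps
  whose determinants are taken.\<close>

lemma prod_powers_as_list:
  assumes "finite V"
  shows "\<exists>xs. set xs \<subseteq> V \<and> (\<forall>D :: 'v \<Rightarrow> 'k::comm_monoid_mult. prod_list (map D xs) = (\<Prod>v\<in>V. D v ^ s v))"
  using assms
proof (induction V rule: finite_induct)
  case (insert v V)
  then obtain xs where xs: "set xs \<subseteq> V" "\<And>D :: 'v \<Rightarrow> 'k. prod_list (map D xs) = (\<Prod>v\<in>V. D v ^ s v)" by blast
  show ?case
    using xs insert by (intro exI[of _ "replicate (s v) v @ xs"]) (auto simp: prod_list_replicate)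
qed simp

lemma det_block_diag_scale:
  fixes \<gamma> :: "'v \<Rightarrow> nat \<Rightarrow> nat \<Rightarrow> 'k::comm_ring_1"
  shows "det (block_diag bl vt pos N (\<lambda>v i j. c * \<gamma> v i j)) = c ^ N * det (block_diag bl vt pos N \<gamma>)"
proof -
  have "block_diag bl vt pos N (\<lambda>v i j. c * \<gamma> v i j) = c \<cdot>\<^sub>m block_diag bl vt pos N \<gamma>"
    by (rule eq_matI) (auto simp: block_diag_def)
  then show ?thesis by (simp add: block_diag_def)
qed

text \<open>The pair \<open>(p, 1)\<close>: multiplying it by \<open>g\<close> on the left and
  \<open>h\<close> on the right gives \<open>(g p h, g h)\<close>.\<close>

definition ext_mat :: "('v \<Rightarrow> nat) \<Rightarrow> ('a \<Rightarrow> 'k::field mat) \<Rightarrow> 'a + 'v \<Rightarrow> 'k mat" where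
  "ext_mat \<alpha> p b = case_sum p (\<lambda>v. 1\<^sub>m (\<alpha> v)) b"

text \<open>The second argument is transposed so that both sides carry the same index convention.\<close>

definition two_sided_entries :: "('v, 'a) pre_digraph \<Rightarrow> ('v \<Rightarrow> nat) \<Rightarrow> ('a \<Rightarrow> 'k::field mat) \<Rightarrow>
    ('v \<Rightarrow> nat \<Rightarrow> nat \<Rightarrow> 'k) \<Rightarrow> ('v \<Rightarrow> nat \<Rightarrow> nat \<Rightarrow> 'k) \<Rightarrow> ('a + 'v) \<times> nat \<times> nat \<Rightarrow> 'k" where
  "two_sided_entries Q \<alpha> p \<gamma> \<eta> = (\<lambda>(b, i, j). if (b, i, j) \<in> ext_indices Q \<alpha> then
    \<Sum>i'<\<alpha> (ext_tail Q b). \<Sum>j'<\<alpha> (ext_head Q b).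
      \<gamma> (ext_tail Q b) i i' * ext_mat \<alpha> p b $$ (i', j') * \<eta> (ext_head Q b) j j' else 0)"

lemma two_sided_entries_scale:
  "two_sided_entries Q \<alpha> p (\<lambda>v i j. c * \<gamma> v i j) (\<lambda>v i j. d * \<eta> v i j) \<iota> = c * d * two_sided_entries Q \<alpha> p \<gamma> \<eta> \<iota>"
  by (auto simp: two_sided_entries_def sum_distrib_left mult_ac split: prod.splits)

lemma ext_entries_two_sided:
  fixes Q :: "('v, 'a) pre_digraph" and p :: "'a \<Rightarrow> 'k::field mat"
  assumes p: "p \<in> rep_space Q \<alpha>"
  shows "ext_entries Q \<alpha> (\<lambda>a. mat (\<alpha> (tail Q a)) (\<alpha> (tail Q a)) (\<lambda>(i, j). \<gamma> (tail Q a) i j) * p a *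
        mat (\<alpha> (head Q a)) (\<alpha> (head Q a)) (\<lambda>(i, j). \<eta> (head Q a) j i))
      (\<lambda>v. mat (\<alpha> v) (\<alpha> v) (\<lambda>(i, j). \<gamma> v i j) * mat (\<alpha> v) (\<alpha> v) (\<lambda>(i, j). \<eta> v j i)) =
    two_sided_entries Q \<alpha> p \<gamma> \<eta>"
proof -
  have trip: "(mat m m (\<lambda>(i, j). g i j) * A * mat n n (\<lambda>(i, j). h j i)) $$ (i, j) =
      (\<Sum>i'<m. \<Sum>j'<n. g i i' * A $$ (i', j') * h j j')"
    if "A \<in> carrier_mat m n" "i < m" "j < n" for A :: "'k mat" and m n i j g h
  proof -
    have "(mat m m (\<lambda>(i, j). g i j) * A * mat n n (\<lambda>(i, j). h j i)) $$ (i, j) =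
        (\<Sum>j'<n. (\<Sum>i'<m. g i i' * A $$ (i', j')) * h j j')"
      using that by (simp add: scalar_prod_def lessThan_atLeast0)
    then show ?thesis by (simp add: sum_distrib_right sum.swap[of _ "{..<m}"])
  qed
  show ?thesis
  proof
    fix \<iota> :: "('a + 'v) \<times> nat \<times> nat"
    obtain b i j where b: "\<iota> = (b, i, j)" by (metis prod_cases3)
    show "ext_entries Q \<alpha> (\<lambda>a. mat (\<alpha> (tail Q a)) (\<alpha> (tail Q a)) (\<lambda>(i, j). \<gamma> (tail Q a) i j) * p a *
        mat (\<alpha> (head Q a)) (\<alpha> (head Q a)) (\<lambda>(i, j). \<eta> (head Q a) j i))
      (\<lambda>v. mat (\<alpha> v) (\<alpha> v) (\<lambda>(i, j). \<gamma> v i j) * mat (\<alpha> v) (\<alpha> v) (\<lambda>(i, j). \<eta> v j i)) \<iota> =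
      two_sided_entries Q \<alpha> p \<gamma> \<eta> \<iota>"
    proof (cases "(b, i, j) \<in> ext_indices Q \<alpha>")
      case True
      show ?thesis
      proof (cases b)
        case (Inl a)
        then have "p a \<in> carrier_mat (\<alpha> (tail Q a)) (\<alpha> (head Q a))" "i < \<alpha> (tail Q a)" "j < \<alpha> (head Q a)"
          using True p by (auto simp: ext_indices_def ext_tail_def ext_head_def rep_space_def)
        from trip[OF this, of "\<gamma> (tail Q a)" "\<eta> (head Q a)"] show ?thesis
          using True by (simp add: b Inl ext_entries_def two_sided_entries_def ext_mat_def ext_tail_def ext_head_def)
      next
        case (Inr v)
        then have "(1\<^sub>m (\<alpha> v) :: 'k mat) \<in> carrier_mat (\<alpha> v) (\<alpha> v)" "i < \<alpha> v" "j < \<alpha> v"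
          using True by (auto simp: ext_indices_def ext_tail_def ext_head_def)
        moreover have "mat (\<alpha> v) (\<alpha> v) (\<lambda>(i, j). \<gamma> v i j) * 1\<^sub>m (\<alpha> v) = mat (\<alpha> v) (\<alpha> v) (\<lambda>(i, j). \<gamma> v i j)"
          by (rule right_mult_one_mat[of _ "\<alpha> v"]) simp
        ultimately show ?thesis using trip[of "1\<^sub>m (\<alpha> v)" "\<alpha> v" "\<alpha> v" i j "\<gamma> v" "\<eta> v"]
          using True by (simp add: b Inr ext_entries_def two_sided_entries_def ext_mat_def ext_tail_def ext_head_def)
      qed
    qed (simp add: b ext_entries_def two_sided_entries_def)
  qed
qed

text \<open>Both sides are polynomial in \<open>t\<close> after adding \<open>t\<close> times the identity, which is invertible for all
  but finitely many \<open>t\<close>.\<close>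

lemma extend_to_all_matrices:
  fixes L R :: "('v \<Rightarrow> nat \<Rightarrow> nat \<Rightarrow> 'k::field_char_0) \<Rightarrow> ('v \<Rightarrow> nat \<Rightarrow> nat \<Rightarrow> 'k) \<Rightarrow> 'k"
  assumes fin: "finite V"
    and poly: "\<And>\<gamma> \<eta>. (\<lambda>t. L (\<lambda>v i j. \<gamma> v i j + (if i = j then t else 0)) (\<lambda>v i j. \<eta> v i j + (if i = j then t else 0))) \<in> range poly"
      "\<And>\<gamma> \<eta>. (\<lambda>t. R (\<lambda>v i j. \<gamma> v i j + (if i = j then t else 0)) (\<lambda>v i j. \<eta> v i j + (if i = j then t else 0))) \<in> range poly"
    and eq: "\<And>\<gamma> \<eta>. (\<And>v. v \<in> V \<Longrightarrow> det (mat (\<alpha> v) (\<alpha> v) (\<lambda>(i, j). \<gamma> v i j)) \<noteq> 0) \<Longrightarrow>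
      (\<And>v. v \<in> V \<Longrightarrow> det (mat (\<alpha> v) (\<alpha> v) (\<lambda>(i, j). \<eta> v i j)) \<noteq> 0) \<Longrightarrow> L \<gamma> \<eta> = R \<gamma> \<eta>"
  shows "L \<gamma> \<eta> = R \<gamma> \<eta>"
proof -
  define sh where "sh t \<gamma> = (\<lambda>v i j. \<gamma> v i j + (if i = j then t else 0))" for t and \<gamma> :: "'v \<Rightarrow> nat \<Rightarrow> nat \<Rightarrow> 'k"
  \<comment> \<open>The characteristic polynomial of the negative of a matrix evaluates at
    \<open>t\<close> to the determinant of that matrix shifted by \<open>t\<close>. Being monic, it
    is nonzero.\<close>
  define q where "q \<gamma> v = char_poly (- mat (\<alpha> v) (\<alpha> v) (\<lambda>(i, j). \<gamma> v i j))" for \<gamma> :: "'v \<Rightarrow> nat \<Rightarrow> nat \<Rightarrow> 'k" and v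
  have q: "poly (q \<gamma> v) t = det (mat (\<alpha> v) (\<alpha> v) (\<lambda>(i, j). sh t \<gamma> v i j))" for \<gamma> v t
  proof -
    have "- char_matrix (- mat (\<alpha> v) (\<alpha> v) (\<lambda>(i, j). \<gamma> v i j)) t = mat (\<alpha> v) (\<alpha> v) (\<lambda>(i, j). sh t \<gamma> v i j)"
      by (rule eq_matI) (auto simp: char_matrix_def sh_def)
    then show ?thesis unfolding q_def by (subst char_poly_matrix[of _ "\<alpha> v"]) auto
  qed
  have q0: "q \<gamma> v \<noteq> 0" for \<gamma> v
    using degree_monic_char_poly[of "- mat (\<alpha> v) (\<alpha> v) (\<lambda>(i, j). \<gamma> v i j)" "\<alpha> v"] by (auto simp: q_def)
  define h where "h = (\<Prod>v\<in>V. q \<gamma> v * q \<eta> v)"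
  have "h \<noteq> 0" using fin q0 by (simp add: h_def)
  then obtain t\<^sub>0 where t0: "poly h t\<^sub>0 \<noteq> 0" using poly_all_0_iff_0 by blast
  have "(\<lambda>t. L (sh t \<gamma>) (sh t \<eta>)) = (\<lambda>t. R (sh t \<gamma>) (sh t \<eta>))"
  proof (rule range_poly_eqI[of _ _ "poly h" t\<^sub>0])
    fix t assume "poly h t \<noteq> 0"
    then have "poly (q \<gamma> v) t \<noteq> 0" "poly (q \<eta> v) t \<noteq> 0" if "v \<in> V" for v
      using that fin by (auto simp: h_def poly_prod)
    then show "L (sh t \<gamma>) (sh t \<eta>) = R (sh t \<gamma>) (sh t \<eta>)" unfolding q by (intro eq) auto
  qed (use poly t0 in \<open>auto simp: sh_def\<close>)
  from fun_cong[OF this, of 0] show ?thesis by (simp add: sh_def)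
qed

text \<open>In \<open>poly_eval ws\<close> at \<open>t z\<close> a word of length \<open>n\<close>
  carries \<open>t ^ n\<close>, so the filtered sum is the coefficient of \<open>t ^ N\<close>. It
  discards monomials whose number of factors does not match the size of the omega process.\<close>

lemma poly_eval_homogeneous_part:
  fixes c :: "'k::{idom, ring_char_0}"
  assumes "\<And>t. poly_eval ws (\<lambda>i. t * z i) = t ^ N * c"
  shows "poly_eval (filter (\<lambda>(c, w). length w = N) ws) z = c"
proof -
  define q where "q = (\<Sum>(c, w)\<leftarrow>ws. monom (c * prod_list (map z w)) (length w))"
  have scale: "prod_list (map (\<lambda>i. t * z i) w) = t ^ length w * prod_list (map z w)" for t w
    by (induction w) (auto simp: mult_ac)
  have "poly q t = poly_eval ws (\<lambda>i. t * z i)" for t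
    unfolding q_def poly_eval_def
    by (induction ws) (auto simp: poly_monom scale mult_ac)
  then have "poly q = poly (monom c N)" by (auto simp: assms poly_monom fun_eq_iff mult_ac)
  then have "coeff q N = c" by (simp add: poly_eq_poly_eq_iff)
  moreover have "coeff q N = poly_eval (filter (\<lambda>(c, w). length w = N) ws) z"
    unfolding q_def poly_eval_def by (induction ws) (auto simp: coeff_monom)
  ultimately show ?thesis by simp
qed

lemma omega_process_linear:
  "omega_process bl vt pos N (\<lambda>\<gamma>. c * P \<gamma>) = c * omega_process bl vt pos N P"
  "omega_process bl vt pos N (\<lambda>\<gamma>. P \<gamma> * c) = omega_process bl vt pos N P * c"
  "omega_process bl vt pos N (\<lambda>\<gamma>. P \<gamma> + P' \<gamma>) = omega_process bl vt pos N P + omega_process bl vt pos N P'"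
  "omega_process bl vt pos N (\<lambda>\<gamma>. 0) = 0"
  by (simp_all add: omega_process_def sum_distrib_left sum_distrib_right sum.distrib algebra_simps)

section \<open>Images of monomials under the omega process\<close>

text \<open>Values are compared only on \<open>rep_space\<close>, so intermediate functions need not
  be extensional.\<close>

definition det_span :: "('v, 'a) pre_digraph \<Rightarrow> ('v \<Rightarrow> nat) \<Rightarrow> (('a \<Rightarrow> 'k::field mat) \<Rightarrow> 'k) set" where
  "det_span Q \<alpha> = {f. \<exists>D c. finite D \<and> D \<subseteq> determinantal_semi_invariants Q \<alpha> \<and>
    (\<forall>p\<in>rep_space Q \<alpha>. f p = (\<Sum>P\<in>D. c P * P p))}"

section \<open>Closure properties of the span of determinants\<close>

lemma det_span_zero: "(\<lambda>p. 0) \<in> det_span Q \<alpha>"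
  unfolding det_span_def by (auto intro!: exI[of _ "{}"])

lemma det_span_scale:
  assumes "f \<in> det_span Q \<alpha>"
  shows "(\<lambda>p. d * f p) \<in> det_span Q \<alpha>"
proof -
  obtain D c where D: "finite D" "D \<subseteq> determinantal_semi_invariants Q \<alpha>"
    and f: "\<And>p. p \<in> rep_space Q \<alpha> \<Longrightarrow> f p = (\<Sum>P\<in>D. c P * P p)"
    using assms by (auto simp: det_span_def)
  have "\<forall>p\<in>rep_space Q \<alpha>. d * f p = (\<Sum>P\<in>D. (d * c P) * P p)"
    by (simp add: f sum_distrib_left mult.assoc)
  with D show ?thesis
    unfolding det_span_def by (intro CollectI exI[of _ D] exI[of _ "\<lambda>P. d * c P"] conjI)
qed

lemma det_span_add:
  assumes "f \<in> det_span Q \<alpha>" "g \<in> det_span Q \<alpha>"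
  shows "(\<lambda>p. f p + g p) \<in> det_span Q \<alpha>"
proof -
  obtain D c where D: "finite D" "D \<subseteq> determinantal_semi_invariants Q \<alpha>"
    and f: "\<And>p. p \<in> rep_space Q \<alpha> \<Longrightarrow> f p = (\<Sum>P\<in>D. c P * P p)"
    using assms(1) by (auto simp: det_span_def)
  obtain E e where E: "finite E" "E \<subseteq> determinantal_semi_invariants Q \<alpha>"
    and g: "\<And>p. p \<in> rep_space Q \<alpha> \<Longrightarrow> g p = (\<Sum>P\<in>E. e P * P p)"
    using assms(2) by (auto simp: det_span_def)
  define u where "u P = (if P \<in> D then c P else 0) + (if P \<in> E then e P else 0)" for P
  have "f p + g p = (\<Sum>P\<in>D \<union> E. u P * P p)" if p: "p \<in> rep_space Q \<alpha>" for p
  proof -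
    have "(\<Sum>P\<in>D. c P * P p) = (\<Sum>P\<in>D \<union> E. (if P \<in> D then c P else 0) * P p)"
      using D(1) E(1) by (intro sum.mono_neutral_cong_left) auto
    moreover have "(\<Sum>P\<in>E. e P * P p) = (\<Sum>P\<in>D \<union> E. (if P \<in> E then e P else 0) * P p)"
      using D(1) E(1) by (intro sum.mono_neutral_cong_left) auto
    ultimately show ?thesis
      unfolding f[OF p] g[OF p] u_def distrib_right sum.distrib by (simp only:)
  qed
  moreover have "finite (D \<union> E)" "D \<union> E \<subseteq> determinantal_semi_invariants Q \<alpha>" using D E by auto
  ultimately show ?thesis
    unfolding det_span_def by (intro CollectI exI[of _ "D \<union> E"] exI[of _ u] conjI ballI)
qed

lemma det_span_sum:
  "(\<And>i. i \<in> I \<Longrightarrow> f i \<in> det_span Q \<alpha>) \<Longrightarrow> (\<lambda>p. \<Sum>i\<in>I. f i p) \<in> det_span Q \<alpha>"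
  by (induction I rule: infinite_finite_induct) (auto intro: det_span_zero det_span_add)

lemma det_span_base:
  assumes "xs \<in> lists (verts Q)" "ys \<in> lists (verts Q)" "\<phi> \<in> add_hom Q xs ys"
    "total_dim \<alpha> xs = total_dim \<alpha> ys"
    "\<And>p. p \<in> rep_space Q \<alpha> \<Longrightarrow> f p = det (rep_functor_mat Q \<alpha> p xs ys \<phi>)"
  shows "f \<in> det_span Q \<alpha>"
proof -
  have "determinantal_function Q \<alpha> xs ys \<phi> \<in> determinantal_semi_invariants Q \<alpha>"
    unfolding determinantal_semi_invariants_def
    by (intro CollectI exI conjI) (rule refl assms)+
  moreover have "\<forall>p\<in>rep_space Q \<alpha>. f p =
      (\<Sum>P\<in>{determinantal_function Q \<alpha> xs ys \<phi>}. 1 * P p)"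
    using assms(5) by (simp add: determinantal_function_def)
  ultimately show ?thesis
    unfolding det_span_def
    by (intro CollectI exI[of _ "{determinantal_function Q \<alpha> xs ys \<phi>}"] exI[of _ "\<lambda>_. 1"] conjI)
      (simp_all only: finite.intros insert_subset empty_subsetI simp_thms)
qed

definition ext_path :: "'a + 'v \<Rightarrow> 'a list" where
  "ext_path b = case_sum (\<lambda>a. [a]) (\<lambda>v. []) b"

lemma path_hom_sum:
  fixes Q :: "('v, 'a) pre_digraph" and c :: "'l \<Rightarrow> ('a list \<Rightarrow>\<^sub>0 'k::field)"
  assumes "\<And>l. l \<in> S \<Longrightarrow> c l \<in> path_hom Q v w"
  shows "(\<Sum>l\<in>S. c l) \<in> path_hom Q v w"
proof -
  have add: "x + y \<in> path_hom Q v w" if "x \<in> path_hom Q v w" "y \<in> path_hom Q v w" for x y :: "'a list \<Rightarrow>\<^sub>0 'k"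
    using that Poly_Mapping.keys_add[of x y] by (auto simp: path_hom_def)
  have zero: "0 \<in> path_hom Q v w" by (simp add: path_hom_def)
  show ?thesis using assms
    by (induction S rule: infinite_finite_induct) (simp_all add: add zero)
qed

lemma single_ext_path_hom:
  assumes "fin_digraph Q" "b \<in> arcs Q <+> verts Q"
  shows "Poly_Mapping.single (ext_path b) c \<in> path_hom Q (ext_tail Q b) (ext_head Q b)"
proof -
  interpret fin_digraph Q by fact
  have "awalk (ext_tail Q b) (ext_path b) (ext_head Q b)"
    using assms(2) by (auto simp: ext_path_def ext_tail_def ext_head_def awalk_def)
  then show ?thesis by (auto simp: path_hom_def keys_single)
qed

lemma keys_sum_additive:
  fixes G :: "'x \<Rightarrow> 'k::comm_ring_1" and c :: "'l \<Rightarrow> ('x \<Rightarrow>\<^sub>0 'k)"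
  defines "val \<equiv> \<lambda>c. \<Sum>\<pi>\<in>Poly_Mapping.keys c. Poly_Mapping.lookup c \<pi> * G \<pi>"
  shows "val (\<Sum>l\<in>S. c l) = (\<Sum>l\<in>S. val (c l))"
proof -
  \<comment> \<open>Supports may shrink under addition through cancellation; evaluating over a
    common larger index set avoids tracking this.\<close>
  have super: "val d = (\<Sum>\<pi>\<in>T. Poly_Mapping.lookup d \<pi> * G \<pi>)" if "finite T" "Poly_Mapping.keys d \<subseteq> T" for d T
    unfolding val_def using that by (intro sum.mono_neutral_left) (auto simp: in_keys_iff)
  have "val (d + e) = val d + val e" for d e
  proof -
    let ?T = "Poly_Mapping.keys d \<union> Poly_Mapping.keys e"
    have "val (d + e) = (\<Sum>\<pi>\<in>?T. Poly_Mapping.lookup (d + e) \<pi> * G \<pi>)"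
      by (rule super) (auto dest: Poly_Mapping.keys_add[THEN subsetD])
    then show ?thesis
      using super[of ?T d] super[of ?T e] by (simp add: lookup_add distrib_right sum.distrib)
  qed
  moreover have "val 0 = 0" by (simp add: val_def)
  ultimately show ?thesis by (induction S rule: infinite_finite_induct) auto
qed

text \<open>Each \<open>l\<close> in \<open>S\<close> with \<open>ok l\<close> places one arrow or
  trivial path in block \<open>(\<beta> l, \<beta>' l)\<close>, and \<open>\<phi>\<close> is the sum
  of these one-entry maps. The endpoint hypothesis makes them morphisms; since \<open>ok\<close>,
  \<open>\<beta>\<close> and \<open>\<beta>'\<close> do not involve \<open>p\<close>, a single
  \<open>\<phi>\<close> serves all representations.\<close>

lemma block_pattern_det_in_span:
  fixes Q :: "('v, 'a) pre_digraph" and b :: "'l \<Rightarrow> 'a + 'v"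
  assumes Q: "fin_digraph Q" and xs: "set xs \<subseteq> verts Q" and ys: "set ys \<subseteq> verts Q"
    and N: "total_dim \<alpha> xs = N" "total_dim \<alpha> ys = N"
    and ok: "\<And>l. l \<in> S \<Longrightarrow> ok l \<Longrightarrow> b l \<in> arcs Q <+> verts Q \<and>
      ext_tail Q (b l) = xs ! \<beta> l \<and> ext_head Q (b l) = ys ! \<beta>' l"
  shows "(\<lambda>p. det (mat N N (\<lambda>(r, c). \<Sum>l\<in>S.
      if block_of \<alpha> xs r = \<beta> l \<and> block_of \<alpha> ys c = \<beta>' l then
        if ok l then ext_mat \<alpha> p (b l) $$ (pos_of \<alpha> xs r, pos_of \<alpha> ys c) else 0 else (0::'k::field))))
    \<in> det_span Q \<alpha>"
proof -
  define e :: "nat \<Rightarrow> nat \<Rightarrow> 'l \<Rightarrow> ('a list \<Rightarrow>\<^sub>0 'k)" where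
    "e i j l = (if i = \<beta> l \<and> j = \<beta>' l \<and> ok l then Poly_Mapping.single (ext_path (b l)) 1 else 0)" for i j l
  define \<phi> where "\<phi> = mat (length xs) (length ys) (\<lambda>(i, j). \<Sum>l\<in>S. e i j l)"
  show ?thesis
  proof (rule det_span_base)
    show "xs \<in> lists (verts Q)" "ys \<in> lists (verts Q)" using xs ys by auto
    show "total_dim \<alpha> xs = total_dim \<alpha> ys" using N by simp
    show "\<phi> \<in> add_hom Q xs ys"
      unfolding add_hom_def
    proof (intro CollectI conjI allI impI)
      fix i j assume ij: "i < length xs" "j < length ys"
      have "(\<Sum>l\<in>S. e i j l) \<in> path_hom Q (xs ! i) (ys ! j)"
      proof (rule path_hom_sum)
        fix l assume l: "l \<in> S"
        show "e i j l \<in> path_hom Q (xs ! i) (ys ! j)"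
        proof (cases "i = \<beta> l \<and> j = \<beta>' l \<and> ok l")
          case True
          then show ?thesis
            using ok[OF l] single_ext_path_hom[OF Q, of "b l" "1::'k"] by (simp add: e_def)
        next
          case False
          then have "e i j l = 0" unfolding e_def by (rule if_not_P)
          then show ?thesis by (simp add: path_hom_def)
        qed
      qed
      then show "\<phi> $$ (i, j) \<in> path_hom Q (xs ! i) (ys ! j)" using ij by (simp add: \<phi>_def)
    qed (simp add: \<phi>_def)
  next
    fix p :: "'a \<Rightarrow> 'k mat" assume p: "p \<in> rep_space Q \<alpha>"
    have "mat N N (\<lambda>(r, c). \<Sum>l\<in>S. if block_of \<alpha> xs r = \<beta> l \<and> block_of \<alpha> ys c = \<beta>' l then
        if ok l then ext_mat \<alpha> p (b l) $$ (pos_of \<alpha> xs r, pos_of \<alpha> ys c) else 0 else 0) =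
      rep_functor_mat Q \<alpha> p xs ys \<phi>"
    proof (rule eq_matI)
      fix r c assume "r < dim_row (rep_functor_mat Q \<alpha> p xs ys \<phi>)" "c < dim_col (rep_functor_mat Q \<alpha> p xs ys \<phi>)"
      then have r: "r < N" "r < total_dim \<alpha> xs" and c: "c < N" "c < total_dim \<alpha> ys"
        using N by (auto simp: rep_functor_mat_def)
      define i j s t where "i = block_of \<alpha> xs r" "j = block_of \<alpha> ys c" "s = pos_of \<alpha> xs r" "t = pos_of \<alpha> ys c"
      note ijst = this
      have ij: "i < length xs" "j < length ys" "s < \<alpha> (xs ! i)" "t < \<alpha> (ys ! j)"
        using block_of_bounds[OF r(2)] block_of_bounds[OF c(2)] by (auto simp: ijst vertex_of_def)
      define G where "G \<pi> = path_mat Q \<alpha> p (xs ! i) \<pi> $$ (s, t)" for \<pi>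
      have "rep_functor_mat Q \<alpha> p xs ys \<phi> $$ (r, c) =
          path_hom_mat Q \<alpha> p (xs ! i) (ys ! j) (\<phi> $$ (i, j)) $$ (s, t)"
      proof -
        have "block_indices \<alpha> xs ! r = (i, s)" "block_indices \<alpha> ys ! c = (j, t)"
          by (simp_all add: ijst block_of_def pos_of_def)
        then show ?thesis using r c by (simp add: rep_functor_mat_def)
      qed
      also have "\<dots> = (\<Sum>\<pi>\<in>Poly_Mapping.keys (\<Sum>l\<in>S. e i j l). Poly_Mapping.lookup (\<Sum>l\<in>S. e i j l) \<pi> * G \<pi>)"
        using ij by (simp add: path_hom_mat_def \<phi>_def G_def)
      also have "\<dots> = (\<Sum>l\<in>S. \<Sum>\<pi>\<in>Poly_Mapping.keys (e i j l). Poly_Mapping.lookup (e i j l) \<pi> * G \<pi>)"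
        by (rule keys_sum_additive)
      also have "\<dots> = (\<Sum>l\<in>S. if i = \<beta> l \<and> j = \<beta>' l then if ok l then ext_mat \<alpha> p (b l) $$ (s, t) else 0 else 0)"
      proof (rule sum.cong[OF refl])
        fix l assume l: "l \<in> S"
        show "(\<Sum>\<pi>\<in>Poly_Mapping.keys (e i j l). Poly_Mapping.lookup (e i j l) \<pi> * G \<pi>) =
          (if i = \<beta> l \<and> j = \<beta>' l then if ok l then ext_mat \<alpha> p (b l) $$ (s, t) else 0 else 0)"
        proof (cases "i = \<beta> l \<and> j = \<beta>' l \<and> ok l")
          case True
          have "G (ext_path (b l)) = ext_mat \<alpha> p (b l) $$ (s, t)"
          proof (cases "b l")
            case (Inl a)
            then have "a \<in> arcs Q" using ok[OF l] True by auto
            then have "p a \<in> carrier_mat (\<alpha> (tail Q a)) (\<alpha> (head Q a))" using p by (auto simp: rep_space_def)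
            then show ?thesis using right_mult_one_mat by (simp add: G_def ext_path_def ext_mat_def Inl)
          next
            case (Inr v)
            \<comment> \<open>The list \<open>[]\<close> has forgotten its vertex;
              \<open>path_mat\<close> reads it from the row block, which therefore has to agree with
              the vertex of the loop.\<close>
            then have "v = xs ! i" using ok[OF l] True by (auto simp: ext_tail_def)
            then show ?thesis by (simp add: G_def ext_path_def ext_mat_def Inr)
          qed
          with True show ?thesis by (simp add: e_def)
        qed (auto simp: e_def)
      qed
      finally show "mat N N (\<lambda>(r, c). \<Sum>l\<in>S. if block_of \<alpha> xs r = \<beta> l \<and> block_of \<alpha> ys c = \<beta>' l then
          if ok l then ext_mat \<alpha> p (b l) $$ (pos_of \<alpha> xs r, pos_of \<alpha> ys c) else 0 else 0) $$ (r, c) =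
        rep_functor_mat Q \<alpha> p xs ys \<phi> $$ (r, c)"
        using r c by (simp add: ijst cong: if_cong)
    qed (auto simp: rep_functor_mat_def N)
    then show "det (mat N N (\<lambda>(r, c). \<Sum>l\<in>S. if block_of \<alpha> xs r = \<beta> l \<and> block_of \<alpha> ys c = \<beta>' l then
        if ok l then ext_mat \<alpha> p (b l) $$ (pos_of \<alpha> xs r, pos_of \<alpha> ys c) else 0 else 0)) =
      det (rep_functor_mat Q \<alpha> p xs ys \<phi>)" by simp
  qed
qed

abbreviation list_omega :: "('v \<Rightarrow> nat) \<Rightarrow> 'v list \<Rightarrow> (('v \<Rightarrow> nat \<Rightarrow> nat \<Rightarrow> 'k::comm_ring_1) \<Rightarrow> 'k) \<Rightarrow> 'k" where
  "list_omega \<alpha> xs \<equiv> omega_process (block_of \<alpha> xs) (vertex_of \<alpha> xs) (pos_of \<alpha> xs) (total_dim \<alpha> xs)"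

section \<open>Entries of \<open>g p h\<close> and \<open>g h\<close> at sums of elementary
  matrices\<close>

lemma sum_double_delta:
  fixes M :: "nat \<Rightarrow> nat \<Rightarrow> 'k::comm_ring_1"
  assumes "P \<Longrightarrow> x < m" "P' \<Longrightarrow> y < n"
  shows "(\<Sum>i<m. \<Sum>j<n. (if P \<and> x = i then 1 else 0) * M i j * (if P' \<and> y = j then 1 else 0)) =
    (if P \<and> P' then M x y else 0)"
proof (cases "P \<and> P'")
  case True
  have "(\<Sum>j<n. (if P \<and> x = i then 1 else 0) * M i j * (if P' \<and> y = j then 1 else 0)) =
      (if x = i then M i y else 0)" for i
  proof -
    have "(\<Sum>j<n. (if P \<and> x = i then 1 else 0) * M i j * (if P' \<and> y = j then 1 else 0)) =
        (\<Sum>j<n. if y = j then if x = i then M i j else 0 else 0)"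
      by (rule sum.cong) (use True in auto)
    then show ?thesis using assms(2) True by simp
  qed
  then show ?thesis using assms(1) True by simp
qed auto

text \<open>An elementary matrix on each side selects one entry of the middle matrix. Since
  \<open>\<pi>\<close> and \<open>\<pi>'\<close> preserve blocks, they preserve vertices, which
  keeps the selected positions within the dimensions of that matrix.\<close>

lemma two_sided_entries_unit_sum:
  fixes Q :: "('v, 'a) pre_digraph"
  assumes \<pi>: "\<pi> \<in> block_perms (block_of \<alpha> xs) (total_dim \<alpha> xs)" and S: "S \<subseteq> {0..<total_dim \<alpha> xs}"
    and \<pi>': "\<pi>' \<in> block_perms (block_of \<alpha> ys) (total_dim \<alpha> ys)" and S': "S' \<subseteq> {0..<total_dim \<alpha> ys}"
  shows "two_sided_entries Q \<alpha> p (unit_sum (vertex_of \<alpha> xs) (pos_of \<alpha> xs) \<pi> S)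
      (unit_sum (vertex_of \<alpha> ys) (pos_of \<alpha> ys) \<pi>' S') (b, i, j) =
    (\<Sum>y\<in>S. \<Sum>y'\<in>S'. if (b, i, j) \<in> ext_indices Q \<alpha> \<and>
        vertex_of \<alpha> xs y = ext_tail Q b \<and> pos_of \<alpha> xs y = i \<and>
        vertex_of \<alpha> ys y' = ext_head Q b \<and> pos_of \<alpha> ys y' = j
      then ext_mat \<alpha> p b $$ (pos_of \<alpha> xs (\<pi> y), pos_of \<alpha> ys (\<pi>' y')) else (0::'k::field))"
proof (cases "(b, i, j) \<in> ext_indices Q \<alpha>")
  case True
  define u where "u y \<longleftrightarrow> vertex_of \<alpha> xs y = ext_tail Q b \<and> pos_of \<alpha> xs y = i" for y
  define u' where "u' y \<longleftrightarrow> vertex_of \<alpha> ys y = ext_head Q b \<and> pos_of \<alpha> ys y = j" for y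
  have bnd: "pos_of \<alpha> zs (\<rho> y) < \<alpha> (vertex_of \<alpha> zs y)"
    if "\<rho> \<in> block_perms (block_of \<alpha> zs) (total_dim \<alpha> zs)" "y < total_dim \<alpha> zs" for \<rho> y zs
    using block_of_bounds(2)[OF block_perms_less[OF that]] that
    by (simp add: vertex_of_def block_perms_def)
  have expand: "(\<Sum>y\<in>S. F y) * M * (\<Sum>y'\<in>S'. G y') = (\<Sum>y\<in>S. \<Sum>y'\<in>S'. F y * M * G y')"
    for F G :: "nat \<Rightarrow> 'k" and M
    by (subst sum_distrib_right) (rule sum_product)
  have "two_sided_entries Q \<alpha> p (unit_sum (vertex_of \<alpha> xs) (pos_of \<alpha> xs) \<pi> S)
      (unit_sum (vertex_of \<alpha> ys) (pos_of \<alpha> ys) \<pi>' S') (b, i, j) =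
    (\<Sum>i'<\<alpha> (ext_tail Q b). \<Sum>j'<\<alpha> (ext_head Q b). \<Sum>y\<in>S. \<Sum>y'\<in>S'.
      (if u y \<and> pos_of \<alpha> xs (\<pi> y) = i' then 1 else 0) * ext_mat \<alpha> p b $$ (i', j') *
      (if u' y' \<and> pos_of \<alpha> ys (\<pi>' y') = j' then 1 else 0))"
    using True unfolding two_sided_entries_def unit_sum_def expand[symmetric] u_def u'_def conj_assoc by simp
  also have "\<dots> = (\<Sum>y\<in>S. \<Sum>y'\<in>S'. \<Sum>i'<\<alpha> (ext_tail Q b). \<Sum>j'<\<alpha> (ext_head Q b).
      (if u y \<and> pos_of \<alpha> xs (\<pi> y) = i' then 1 else 0) * ext_mat \<alpha> p b $$ (i', j') *
      (if u' y' \<and> pos_of \<alpha> ys (\<pi>' y') = j' then 1 else 0))"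
    by (rule trans[OF sum.cong[OF refl sum.swap] trans[OF sum.swap sum.cong[OF refl trans[OF sum.cong[OF refl sum.swap] sum.swap]]]])
  also have "\<dots> = (\<Sum>y\<in>S. \<Sum>y'\<in>S'. if u y \<and> u' y'
      then ext_mat \<alpha> p b $$ (pos_of \<alpha> xs (\<pi> y), pos_of \<alpha> ys (\<pi>' y')) else 0)"
  proof (rule sum.cong[OF refl], rule sum.cong[OF refl], rule sum_double_delta)
    fix y y' assume y: "y \<in> S" "y' \<in> S'"
    show "pos_of \<alpha> xs (\<pi> y) < \<alpha> (ext_tail Q b)" if "u y"
      using bnd[OF \<pi>, of y] y S that by (auto simp: u_def)
    show "pos_of \<alpha> ys (\<pi>' y') < \<alpha> (ext_head Q b)" if "u' y'"
      using bnd[OF \<pi>', of y'] y S' that by (auto simp: u'_def)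
  qed
  finally show ?thesis using True by (simp add: u_def u'_def conj_assoc)
qed (simp add: two_sided_entries_def)

text \<open>The length of the word equals the size of the process, so polarisation uses every factor
  once. For fixed \<open>\<theta>\<close> and \<open>\<theta>'\<close> the signed sum over block
  permutations is, by \<open>sum_Pow_det_blocks\<close>, an alternating sum of determinants of maps
  that do not depend on \<open>p\<close>.\<close>

lemma omega_monomial_in_span:
  fixes Q :: "('v, 'a) pre_digraph"
  assumes Q: "fin_digraph Q" and xs: "set xs \<subseteq> verts Q" and ys: "set ys \<subseteq> verts Q"
    and N: "total_dim \<alpha> xs = N" "total_dim \<alpha> ys = N" and w: "length w = N"
  shows "(\<lambda>p. list_omega \<alpha> xs (\<lambda>\<gamma>. list_omega \<alpha> ys (\<lambda>\<eta>.
      prod_list (map (two_sided_entries Q \<alpha> p \<gamma> \<eta>) w))) :: 'k::field) \<in> det_span Q \<alpha>"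
proof -
  define b i j where "b l = fst (w ! l)" and "i l = fst (snd (w ! l))" and "j l = snd (snd (w ! l))" for l
  define ok where "ok l y y' \<longleftrightarrow> (b l, i l, j l) \<in> ext_indices Q \<alpha> \<and>
        vertex_of \<alpha> xs y = ext_tail Q (b l) \<and> pos_of \<alpha> xs y = i l \<and>
        vertex_of \<alpha> ys y' = ext_head Q (b l) \<and> pos_of \<alpha> ys y' = j l" for l y y'
  define A :: "('a \<Rightarrow> 'k mat) \<Rightarrow> nat \<Rightarrow> nat \<Rightarrow> nat \<Rightarrow> nat \<Rightarrow> nat \<Rightarrow> 'k" where
    "A p l y y' r c = (if ok l y y' then ext_mat \<alpha> p (b l) $$ (pos_of \<alpha> xs r, pos_of \<alpha> ys c) else 0)" for p l y y' r c
  have expansion: "list_omega \<alpha> xs (\<lambda>\<gamma>. list_omega \<alpha> ys (\<lambda>\<eta>. prod_list (map (two_sided_entries Q \<alpha> p \<gamma> \<eta>) w))) =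
    (\<Sum>\<theta> | \<theta> permutes {0..<N}. \<Sum>\<theta>' | \<theta>' permutes {0..<N}. of_int (sign \<theta>) * of_int (sign \<theta>') *
      (\<Sum>S\<in>Pow {0..<N}. (-1) ^ (N - card S) * det (mat N N (\<lambda>(r, c). \<Sum>l\<in>S.
        if block_of \<alpha> xs r = block_of \<alpha> xs (\<theta> l) \<and> block_of \<alpha> ys c = block_of \<alpha> ys (\<theta>' l)
        then A p l (\<theta> l) (\<theta>' l) r c else 0))))" for p
  proof -
    have "prod_list (map (two_sided_entries Q \<alpha> p \<gamma> \<eta>) w) =
        (\<Prod>l=0..<N. two_sided_entries Q \<alpha> p \<gamma> \<eta> (w ! l))" for \<gamma> \<eta>
      using w by (simp add: prod.list_conv_set_nth)
    then have "list_omega \<alpha> xs (\<lambda>\<gamma>. list_omega \<alpha> ys (\<lambda>\<eta>. prod_list (map (two_sided_entries Q \<alpha> p \<gamma> \<eta>) w))) =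
      omega_process (block_of \<alpha> xs) (vertex_of \<alpha> xs) (pos_of \<alpha> xs) N (\<lambda>\<gamma>.
        omega_process (block_of \<alpha> ys) (vertex_of \<alpha> ys) (pos_of \<alpha> ys) N (\<lambda>\<eta>.
          \<Prod>l=0..<N. two_sided_entries Q \<alpha> p \<gamma> \<eta> (w ! l)))"
      using N by simp
    also have "\<dots> = (\<Sum>\<theta> | \<theta> permutes {0..<N}. \<Sum>\<theta>' | \<theta>' permutes {0..<N}.
      \<Sum>\<pi>\<in>block_perms (block_of \<alpha> xs) N. \<Sum>\<pi>'\<in>block_perms (block_of \<alpha> ys) N. of_int (sign \<pi>) * of_int (sign \<pi>') *
        (\<Prod>l=0..<N. A p l (\<theta> l) (\<theta>' l) (\<pi> (\<theta> l)) (\<pi>' (\<theta>' l))))"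
    proof (rule double_omega_prod)
      fix l \<pi> \<pi>' S S'
      assume "\<pi> \<in> block_perms (block_of \<alpha> xs) N" "\<pi>' \<in> block_perms (block_of \<alpha> ys) N"
        "S \<subseteq> {0..<N}" "S' \<subseteq> {0..<N}"
      moreover have "w ! l = (b l, i l, j l)" by (simp add: b_def i_def j_def)
      ultimately show "two_sided_entries Q \<alpha> p (unit_sum (vertex_of \<alpha> xs) (pos_of \<alpha> xs) \<pi> S)
          (unit_sum (vertex_of \<alpha> ys) (pos_of \<alpha> ys) \<pi>' S') (w ! l) =
        (\<Sum>y\<in>S. \<Sum>y'\<in>S'. A p l y y' (\<pi> y) (\<pi>' y'))"
        using two_sided_entries_unit_sum[of \<pi> \<alpha> xs S \<pi>' ys S' Q p "b l" "i l" "j l"] N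
        by (simp add: A_def ok_def)
    qed
    also have "\<dots> = (\<Sum>\<theta> | \<theta> permutes {0..<N}. \<Sum>\<theta>' | \<theta>' permutes {0..<N}. of_int (sign \<theta>) * of_int (sign \<theta>') *
      (\<Sum>S\<in>Pow {0..<N}. (-1) ^ (N - card S) * det (mat N N (\<lambda>(r, c). \<Sum>l\<in>S.
        if block_of \<alpha> xs r = block_of \<alpha> xs (\<theta> l) \<and> block_of \<alpha> ys c = block_of \<alpha> ys (\<theta>' l)
        then A p l (\<theta> l) (\<theta>' l) r c else 0))))"
    proof (rule sum.cong[OF refl], rule sum.cong[OF refl])
      fix \<theta> \<theta>' assume t: "\<theta> \<in> {\<theta>. \<theta> permutes {0..<N}}" "\<theta>' \<in> {\<theta>'. \<theta>' permutes {0..<N}}"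
      \<comment> \<open>The signs of \<open>\<theta>\<close> and \<open>\<theta>'\<close> square to
        1, so they may be moved to the other side of \<open>sum_Pow_det_blocks\<close>.\<close>
      have sq: "(u * v) * ((u * v) * x) = x" if "u \<in> {1, - 1}" "v \<in> {1, - 1}" for u v x :: 'k
        using that by auto
      show "(\<Sum>\<pi>\<in>block_perms (block_of \<alpha> xs) N. \<Sum>\<pi>'\<in>block_perms (block_of \<alpha> ys) N. of_int (sign \<pi>) * of_int (sign \<pi>') *
        (\<Prod>l=0..<N. A p l (\<theta> l) (\<theta>' l) (\<pi> (\<theta> l)) (\<pi>' (\<theta>' l)))) = of_int (sign \<theta>) * of_int (sign \<theta>') *
      (\<Sum>S\<in>Pow {0..<N}. (-1) ^ (N - card S) * det (mat N N (\<lambda>(r, c). \<Sum>l\<in>S.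
        if block_of \<alpha> xs r = block_of \<alpha> xs (\<theta> l) \<and> block_of \<alpha> ys c = block_of \<alpha> ys (\<theta>' l)
        then A p l (\<theta> l) (\<theta>' l) r c else 0)))"
        using sum_Pow_det_blocks[of \<theta> N \<theta>' "block_of \<alpha> xs" "block_of \<alpha> ys" "\<lambda>l. A p l (\<theta> l) (\<theta>' l)"] t
        by (simp only: mem_Collect_eq sq[OF signof_pm_one signof_pm_one])
    qed
    finally show ?thesis .
  qed
  show ?thesis
    unfolding expansion
  proof (intro det_span_sum det_span_scale)
    fix \<theta> \<theta>' S
    have "b l \<in> arcs Q <+> verts Q \<and> ext_tail Q (b l) = xs ! block_of \<alpha> xs (\<theta> l) \<and>
        ext_head Q (b l) = ys ! block_of \<alpha> ys (\<theta>' l)" if "ok l (\<theta> l) (\<theta>' l)" for l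
      using that unfolding ok_def ext_indices_def vertex_of_def by simp
    then show "(\<lambda>p. det (mat N N (\<lambda>(r, c). \<Sum>l\<in>S.
        if block_of \<alpha> xs r = block_of \<alpha> xs (\<theta> l) \<and> block_of \<alpha> ys c = block_of \<alpha> ys (\<theta>' l)
        then A p l (\<theta> l) (\<theta>' l) r c else 0))) \<in> det_span Q \<alpha>"
      unfolding A_def by (intro block_pattern_det_in_span[OF Q xs ys N])
  qed
qed

lemma omega_process_poly_eval:
  "omega_process bl vt pos N (\<lambda>\<gamma>. omega_process bl' vt' pos' N' (\<lambda>\<eta>. poly_eval ws (z \<gamma> \<eta>))) =
    (\<Sum>(c, w)\<leftarrow>ws. c * omega_process bl vt pos N (\<lambda>\<gamma>. omega_process bl' vt' pos' N' (\<lambda>\<eta>.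
      prod_list (map (z \<gamma> \<eta>) w))))"
  by (induction ws) (auto simp: poly_eval_def omega_process_linear)

section \<open>The polynomial identity of a semi-invariant on all matrices\<close>

lemma block_diag_shift_range_poly:
  "(\<lambda>t. det (block_diag bl vt pos N (\<lambda>v i j. \<gamma> v i j + (if i = j then t else 0)))) \<in>
    range (poly :: 'k::comm_ring_1 poly \<Rightarrow> _)"
proof (rule fun_algebra_det[OF fun_algebra_poly, of _ N])
  fix r c assume rc: "r < N" "c < N"
  have "(\<lambda>t. \<gamma> v i j + (if i = j then t else 0)) \<in> range poly" for v i j
    by (cases "i = j") (auto intro!: fun_algebra_add[OF fun_algebra_poly] fun_algebra_const[OF fun_algebra_poly] id_range_poly)
  then show "(\<lambda>t. block_diag bl vt pos N (\<lambda>v i j. \<gamma> v i j + (if i = j then t else 0)) $$ (r, c)) \<in> range poly"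
    using rc by (cases "bl r = bl c") (simp_all add: block_diag_def fun_algebra_const[OF fun_algebra_poly])
qed (simp add: block_diag_def)

lemma two_sided_entries_shift_range_poly:
  "(\<lambda>t. two_sided_entries Q \<alpha> p (\<lambda>v i j. \<gamma> v i j + (if i = j then t else 0))
    (\<lambda>v i j. \<eta> v i j + (if i = j then t else 0)) \<iota>) \<in> range (poly :: 'k::field poly \<Rightarrow> _)"
proof -
  obtain b i j where \<iota>: "\<iota> = (b, i, j)" by (metis prod_cases3)
  have shift: "(\<lambda>t. \<gamma> v i j + (if i = j then t else 0)) \<in> range poly" for \<gamma> :: "'b \<Rightarrow> nat \<Rightarrow> nat \<Rightarrow> 'k" and v i j
    by (cases "i = j") (auto intro!: fun_algebra_add[OF fun_algebra_poly] fun_algebra_const[OF fun_algebra_poly] id_range_poly)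
  show ?thesis
  proof (cases "(b, i, j) \<in> ext_indices Q \<alpha>")
    case True
    then show ?thesis
      by (simp only: two_sided_entries_def \<iota> prod.case if_True)
        (intro fun_algebra_sum[OF fun_algebra_poly] fun_algebra_mult[OF fun_algebra_poly]
          fun_algebra_const[OF fun_algebra_poly] shift)
  qed (simp add: two_sided_entries_def \<iota> fun_algebra_const[OF fun_algebra_poly])
qed

lemma generated_algebra_restrict: "f \<in> generated_algebra X C \<Longrightarrow> f = restrict f X"
  by (cases rule: generated_algebra.cases) auto

lemma semi_invariant_block_identity:
  fixes Q :: "('v, 'a) pre_digraph" and f :: "('a \<Rightarrow> 'k::field_char_0 mat) \<Rightarrow> 'k"
  assumes Q: "fin_digraph Q" and f: "semi_invariant Q \<alpha> f"
    and nz: "p\<^sub>0 \<in> rep_space Q \<alpha>" "f p\<^sub>0 \<noteq> 0"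
  shows "\<exists>xs ys ws. set xs \<subseteq> verts Q \<and> set ys \<subseteq> verts Q \<and> (\<forall>p\<in>rep_space Q \<alpha>. \<forall>\<gamma> \<eta>.
    f p * det (list_block_diag \<alpha> xs \<gamma>) * det (list_block_diag \<alpha> ys \<eta>) =
      poly_eval ws (two_sided_entries Q \<alpha> p \<gamma> \<eta>))"
proof -
  interpret fin_digraph Q by fact
  obtain m s F where F: "F \<in> range poly_eval"
    and id: "\<forall>p\<in>rep_space Q \<alpha>. \<forall>g h.
      (\<forall>v\<in>verts Q. g v \<in> carrier_mat (\<alpha> v) (\<alpha> v) \<and> det (g v) \<noteq> 0) \<longrightarrow>
      (\<forall>v\<in>verts Q. h v \<in> carrier_mat (\<alpha> v) (\<alpha> v) \<and> det (h v) \<noteq> 0) \<longrightarrow>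
      f p * (\<Prod>v\<in>verts Q. det (g v) ^ s v) * (\<Prod>v\<in>verts Q. det (h v) ^ m) =
        F (ext_entries Q \<alpha> (\<lambda>a. g (tail Q a) * p a * h (head Q a)) (\<lambda>v. g v * h v))"
    using semi_invariant_two_sided[OF Q f nz] by (elim exE bexE)
  obtain ws where ws: "F = poly_eval ws" using F by auto
  obtain xs where xs: "set xs \<subseteq> verts Q"
    and xs_prod: "\<And>D :: 'v \<Rightarrow> 'k. prod_list (map D xs) = (\<Prod>v\<in>verts Q. D v ^ s v)"
    using prod_powers_as_list[OF finite_verts, of s] by blast
  obtain ys where ys: "set ys \<subseteq> verts Q"
    and ys_prod: "\<And>D :: 'v \<Rightarrow> 'k. prod_list (map D ys) = (\<Prod>v\<in>verts Q. D v ^ m)"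
    using prod_powers_as_list[OF finite_verts, of "\<lambda>_. m"] by blast
  have "f p * det (list_block_diag \<alpha> xs \<gamma>) * det (list_block_diag \<alpha> ys \<eta>) =
      poly_eval ws (two_sided_entries Q \<alpha> p \<gamma> \<eta>)" if p: "p \<in> rep_space Q \<alpha>" for p \<gamma> \<eta>
  proof (rule extend_to_all_matrices[of "verts Q" "\<lambda>\<gamma> \<eta>. f p * det (list_block_diag \<alpha> xs \<gamma>) * det (list_block_diag \<alpha> ys \<eta>)"
        "\<lambda>\<gamma> \<eta>. poly_eval ws (two_sided_entries Q \<alpha> p \<gamma> \<eta>)" \<alpha>])
    fix \<gamma> \<eta> :: "'v \<Rightarrow> nat \<Rightarrow> nat \<Rightarrow> 'k"
    show "(\<lambda>t. f p * det (list_block_diag \<alpha> xs (\<lambda>v i j. \<gamma> v i j + (if i = j then t else 0))) *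
        det (list_block_diag \<alpha> ys (\<lambda>v i j. \<eta> v i j + (if i = j then t else 0)))) \<in> range poly"
      by (intro fun_algebra_mult[OF fun_algebra_poly] fun_algebra_const[OF fun_algebra_poly]
          block_diag_shift_range_poly)
    show "(\<lambda>t. poly_eval ws (two_sided_entries Q \<alpha> p (\<lambda>v i j. \<gamma> v i j + (if i = j then t else 0))
        (\<lambda>v i j. \<eta> v i j + (if i = j then t else 0)))) \<in> range poly"
      by (intro poly_eval_in_fun_algebra[OF fun_algebra_poly] two_sided_entries_shift_range_poly)
  next
    fix \<gamma> \<eta> :: "'v \<Rightarrow> nat \<Rightarrow> nat \<Rightarrow> 'k"
    define g where "g v = mat (\<alpha> v) (\<alpha> v) (\<lambda>(i, j). \<gamma> v i j)" for v
    \<comment> \<open>Transposed to match the index convention of \<open>two_sided_entries\<close>;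
      the determinant is unaffected.\<close>
    define h where "h v = mat (\<alpha> v) (\<alpha> v) (\<lambda>(i, j). \<eta> v j i)" for v
    have det_h: "det (h v) = det (mat (\<alpha> v) (\<alpha> v) (\<lambda>(i, j). \<eta> v i j))" for v
    proof -
      have "h v = transpose_mat (mat (\<alpha> v) (\<alpha> v) (\<lambda>(i, j). \<eta> v i j))"
        by (rule eq_matI) (auto simp: h_def)
      then show ?thesis by (simp add: det_transpose[of _ "\<alpha> v"])
    qed
    assume "\<And>v. v \<in> verts Q \<Longrightarrow> det (mat (\<alpha> v) (\<alpha> v) (\<lambda>(i, j). \<gamma> v i j)) \<noteq> 0"
      and "\<And>v. v \<in> verts Q \<Longrightarrow> det (mat (\<alpha> v) (\<alpha> v) (\<lambda>(i, j). \<eta> v i j)) \<noteq> 0"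
    then have "\<forall>v\<in>verts Q. g v \<in> carrier_mat (\<alpha> v) (\<alpha> v) \<and> det (g v) \<noteq> 0"
      and "\<forall>v\<in>verts Q. h v \<in> carrier_mat (\<alpha> v) (\<alpha> v) \<and> det (h v) \<noteq> 0"
      by (auto simp: det_h) (auto simp: g_def h_def)
    then have "f p * (\<Prod>v\<in>verts Q. det (g v) ^ s v) * (\<Prod>v\<in>verts Q. det (h v) ^ m) =
        F (ext_entries Q \<alpha> (\<lambda>a. g (tail Q a) * p a * h (head Q a)) (\<lambda>v. g v * h v))"
      using id p by blast
    also have "ext_entries Q \<alpha> (\<lambda>a. g (tail Q a) * p a * h (head Q a)) (\<lambda>v. g v * h v) =
        two_sided_entries Q \<alpha> p \<gamma> \<eta>"
      unfolding g_def h_def by (rule ext_entries_two_sided[OF p])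
    finally show "f p * det (list_block_diag \<alpha> xs \<gamma>) * det (list_block_diag \<alpha> ys \<eta>) =
        poly_eval ws (two_sided_entries Q \<alpha> p \<gamma> \<eta>)"
      unfolding det_list_block_diag xs_prod ys_prod det_h g_def ws .
  qed simp
  with xs ys show ?thesis by blast
qed

theorem theorem2p3:
  fixes Q :: "('v, 'a) pre_digraph"
    and \<alpha> :: "'v \<Rightarrow> nat"
    and f :: "('a \<Rightarrow> 'k::{alg_closed_field, field_char_0} mat) \<Rightarrow> 'k"
  assumes "fin_digraph Q"
    and "semi_invariant Q \<alpha> f"
  shows "\<exists>D c. finite D \<and> D \<subseteq> determinantal_semi_invariants Q \<alpha> \<and>
    f = (\<lambda>p\<in>rep_space Q \<alpha>. \<Sum>P\<in>D. c P * P p)"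
proof -
  have "f \<in> det_span Q \<alpha>"
  \<comment> \<open>If \<open>f\<close> vanishes on the whole space, the empty combination
    represents it. Otherwise a point with nonzero value is available for the division that
    identifies the weight.\<close>
  proof (cases "\<exists>p\<in>rep_space Q \<alpha>. f p \<noteq> 0")
    case False
    then show ?thesis unfolding det_span_def by (intro CollectI exI[of _ "{}"]) auto
  next
    case True
    then obtain p\<^sub>0 where p0: "p\<^sub>0 \<in> rep_space Q \<alpha>" "f p\<^sub>0 \<noteq> 0" by blast
    obtain xs ys ws where xs: "set xs \<subseteq> verts Q" and ys: "set ys \<subseteq> verts Q"
      and id: "\<And>p \<gamma> \<eta>. p \<in> rep_space Q \<alpha> \<Longrightarrow>
        f p * det (list_block_diag \<alpha> xs \<gamma>) * det (list_block_diag \<alpha> ys \<eta>) =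
          poly_eval ws (two_sided_entries Q \<alpha> p \<gamma> \<eta>)"
      using semi_invariant_block_identity[OF assms p0] by blast
    define N where "N = total_dim \<alpha> xs"
    define \<epsilon> :: "'v \<Rightarrow> nat \<Rightarrow> nat \<Rightarrow> 'k" where "\<epsilon> v i j = (if i = j then 1 else 0)" for v i j
    have "mat n n (\<lambda>(i, j). \<epsilon> v i j) = 1\<^sub>m n" for n v by (rule eq_matI) (auto simp: \<epsilon>_def)
    then have det_\<epsilon>: "det (list_block_diag \<alpha> zs \<epsilon>) = 1" for zs
      unfolding det_list_block_diag by (induction zs) simp_all
    \<comment> \<open>Scaling one side by 2 and the other by 1/2 fixes every entry of the two-sided
      action, hence the polynomial, but multiplies the determinants by powers of 2 and 1/2.
      Comparison at \<open>p\<^sub>0\<close> makes the future matrices square.\<close>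
    have N_ys: "total_dim \<alpha> ys = N"
    proof -
      have "f p\<^sub>0 * (2 ^ N * 1) * (inverse 2 ^ total_dim \<alpha> ys * 1) =
          poly_eval ws (two_sided_entries Q \<alpha> p\<^sub>0 (\<lambda>v i j. 2 * \<epsilon> v i j) (\<lambda>v i j. inverse 2 * \<epsilon> v i j))"
        using id[OF p0(1), of "\<lambda>v i j. 2 * \<epsilon> v i j" "\<lambda>v i j. inverse 2 * \<epsilon> v i j"]
        by (simp only: det_block_diag_scale det_\<epsilon> N_def)
      also have "two_sided_entries Q \<alpha> p\<^sub>0 (\<lambda>v i j. 2 * \<epsilon> v i j) (\<lambda>v i j. inverse 2 * \<epsilon> v i j) =
          two_sided_entries Q \<alpha> p\<^sub>0 \<epsilon> \<epsilon>"
        by (rule ext) (simp only: two_sided_entries_scale, simp)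
      also have "poly_eval ws \<dots> = f p\<^sub>0" using id[OF p0(1), of \<epsilon> \<epsilon>] by (simp add: det_\<epsilon>)
      finally have "of_nat (2 ^ N) = (of_nat (2 ^ total_dim \<alpha> ys) :: 'k)"
        using p0(2) by (simp add: field_simps power_inverse)
      then show ?thesis by (simp only: of_nat_eq_iff) simp
    qed
    \<comment> \<open>Scaling \<open>\<gamma>\<close> by \<open>t\<close> multiplies the determinant
      side by \<open>t ^ N\<close>, so only words with \<open>N\<close> factors are needed.\<close>
    define ws' where "ws' = filter (\<lambda>(c, w). length w = N) ws"
    have id': "poly_eval ws' (two_sided_entries Q \<alpha> p \<gamma> \<eta>) =
        f p * det (list_block_diag \<alpha> xs \<gamma>) * det (list_block_diag \<alpha> ys \<eta>)"
      if p: "p \<in> rep_space Q \<alpha>" for p \<gamma> \<eta>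
      unfolding ws'_def
    proof (rule poly_eval_homogeneous_part)
      fix t
      have "(\<lambda>\<iota>. t * two_sided_entries Q \<alpha> p \<gamma> \<eta> \<iota>) = two_sided_entries Q \<alpha> p (\<lambda>v i j. t * \<gamma> v i j) \<eta>"
        using two_sided_entries_scale[of Q \<alpha> p t \<gamma> 1 \<eta>] by (auto simp: fun_eq_iff)
      then show "poly_eval ws (\<lambda>\<iota>. t * two_sided_entries Q \<alpha> p \<gamma> \<eta> \<iota>) =
          t ^ N * (f p * det (list_block_diag \<alpha> xs \<gamma>) * det (list_block_diag \<alpha> ys \<eta>))"
        using id[OF p, of "\<lambda>v i j. t * \<gamma> v i j" \<eta>] by (simp add: det_block_diag_scale N_def mult_ac)
    qed
    have "\<exists>C>0. list_omega \<alpha> zs (\<lambda>\<gamma>. det (list_block_diag \<alpha> zs \<gamma>)) = (of_int C :: 'k)" for zs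
      by (rule omega_det_pos) (erule (3) block_pos_inj)
    then obtain C C' where C: "C > 0" "list_omega \<alpha> xs (\<lambda>\<gamma>. det (list_block_diag \<alpha> xs \<gamma>)) = (of_int C :: 'k)"
      and C': "C' > 0" "list_omega \<alpha> ys (\<lambda>\<gamma>. det (list_block_diag \<alpha> ys \<gamma>)) = (of_int C' :: 'k)"
      by metis
    define T where "T w p = list_omega \<alpha> xs (\<lambda>\<gamma>. list_omega \<alpha> ys (\<lambda>\<eta>.
        prod_list (map (two_sided_entries Q \<alpha> p \<gamma> \<eta>) w)))" for w and p :: "'a \<Rightarrow> 'k mat"
    have T_span: "(\<lambda>p. \<Sum>(c, w)\<leftarrow>us. c * T w p) \<in> det_span Q \<alpha>"
      if "\<forall>(c, w)\<in>set us. length w = N" for us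
      using that
    proof (induction us)
      case (Cons u us)
      obtain c w where u: "u = (c, w)" by (cases u)
      then have "length w = N" using Cons.prems by simp
      then have "T w \<in> det_span Q \<alpha>"
        unfolding T_def[abs_def] using N_ys by (intro omega_monomial_in_span[OF assms(1) xs ys]) (auto simp: N_def)
      then have "(\<lambda>p. c * T w p + (\<Sum>(c, w)\<leftarrow>us. c * T w p)) \<in> det_span Q \<alpha>"
        using Cons by (intro det_span_add det_span_scale) auto
      then show ?case by (simp add: u)
    qed (simp add: det_span_zero)
    have f_eq: "f p = inverse (of_int (C * C')) * (\<Sum>(c, w)\<leftarrow>ws'. c * T w p)" if p: "p \<in> rep_space Q \<alpha>" for p
    proof -
      \<comment> \<open>The processes act on \<open>\<gamma>\<close> and \<open>\<eta>\<close>
        alone, so \<open>f p\<close> factors out. The two determinants contribute the positive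
        integers \<open>C\<close> and \<open>C'\<close>, which can be divided out.\<close>
      have "(\<Sum>(c, w)\<leftarrow>ws'. c * T w p) = list_omega \<alpha> xs (\<lambda>\<gamma>. list_omega \<alpha> ys (\<lambda>\<eta>.
          f p * det (list_block_diag \<alpha> xs \<gamma>) * det (list_block_diag \<alpha> ys \<eta>)))"
        unfolding T_def omega_process_poly_eval[symmetric] id'[OF p] ..
      also have "\<dots> = f p * of_int C * of_int C'"
        by (simp only: omega_process_linear C C')
      finally show ?thesis using C(1) C'(1) by (simp add: field_simps)
    qed
    have "(\<lambda>p. inverse (of_int (C * C')) * (\<Sum>(c, w)\<leftarrow>ws'. c * T w p)) \<in> det_span Q \<alpha>"
      by (intro det_span_scale T_span) (auto simp: ws'_def)
    then show ?thesis unfolding det_span_def using f_eq by auto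
  qed
  then obtain D c where D: "finite D" "D \<subseteq> determinantal_semi_invariants Q \<alpha>"
    and fD: "\<And>p. p \<in> rep_space Q \<alpha> \<Longrightarrow> f p = (\<Sum>P\<in>D. c P * P p)"
    by (auto simp: det_span_def)
  \<comment> \<open>Elements of the coordinate ring are extensional, which upgrades agreement on
    \<open>rep_space\<close> to equality of functions.\<close>
  have "f \<in> coordinate_ring Q \<alpha>"
    using assms(2) by (auto simp: semi_invariant_def semi_invariant_of_weight_def)
  then have "f = restrict f (rep_space Q \<alpha>)"
    unfolding coordinate_ring_def by (rule generated_algebra_restrict)
  also have "\<dots> = (\<lambda>p\<in>rep_space Q \<alpha>. \<Sum>P\<in>D. c P * P p)" by (rule restrict_ext) (rule fD)
  finally show ?thesis using D by blast
qed

end
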